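(* Let $V\subseteq L^2(\mathbb{R}^d)$ be a finitely generated shift-invariant space and $L:V\to V$ a bounded shift-preserving operator which is $s$-diagonalizable. Let $\beta(V,L)$ be the smallest natural number $m$ for which there exist sequences $a_1,\dots,a_m$ of bounded spectrum such that $(a_1,\dots,a_m)$ is an $s$-diagonalization of $L$. Then $$\beta(V,L)=\mathfrak{g}.$$
   Context: For $k\in\mathbb{Z}^d$, $T_kf(x)=f(x-k)$. A closed subspace $V\subseteq L^2(\mathbb{R}^d)$ is shift invariant if $T_kf\in V$ for all $f\in V$, $k\in\mathbb{Z}^d$; it is finitely generated if $V=\overline{\mathrm{span}}\{T_k\varphi:\varphi\in\Phi,\ k\in\mathbb{Z}^d\}$ for some finite $\Phi\subset L^2(\mathbb{R}^d)$. Let $\hat f(\omega)=\int f(x)e^{-2\pi i\langle\omega,x\rangle}dx$, and let $\mathcal{T}:L^2(\mathbb{R}^d)\to L^2([0,1)^d,\ell^2(\mathbb{Z}^d))$ be the isometric isomorphism $\mathcal{T}f(\omega)=\{\hat f(\omega+k)\}_{k\in\mathbb{Z}^d}$. A range function is a map $J$ from $[0,1)^d$ to the closed subspaces of $\ell^2(\mathbb{Z}^d)$; it is measurable if $\omega\mapsto\langle P_{J(\omega)}u,v\rangle$ is measurable for all $u,v\in\ell^2(\mathbb{Z}^d)$ ($P_S$ is the orthogonal projection onto $S$). Each shift-invariant $V$ has a measurable range function $J=J_V$, unique up to null sets, with $f\in V$ iff $\mathcal{T}f(\omega)\in J(\omega)$ for a.e. $\omega$. The spectrum of $V$ is $\sigma(V)=\{\omega\in[0,1)^d: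 J(\omega)\neq\{0\}\}$. If $V$ is finitely generated, $J(\omega)$ is finite-dimensional a.e. An operator $L:V\to V$ is shift preserving if it is bounded, linear and $LT_k=T_kL$ for all $k\in\mathbb{Z}^d$. Its range operator $R$ is the (a.e. unique) measurable field of bounded operators $R(\omega):J(\omega)\to J(\omega)$ with $\mathcal{T}(Lf)(\omega)=R(\omega)(\mathcal{T}f(\omega))$ for a.e. $\omega$ and all $f\in V$; measurable means $\omega\mapsto\langle R(\omega)P_{J(\omega)}u,v\rangle$ is measurable for all $u,v\in\ell^2(\mathbb{Z}^d)$. A sequence $a\in\ell^2(\mathbb{Z}^d)$ is of bounded spectrum if $\hat a\in L^\infty([0,1)^d)$, where $\hat a(\omega)=\sum_k a_ke^{-2\pi i\langle\omega,k\rangle}$. Then $\Lambda_a$ is the bounded operator on $L^2(\mathbb{R}^d)$ with $\mathcal{T}(\Lambda_af)(\omega)=\hat a(\omega)\mathcal{T}f(\omega)$. $\Lambda_a$ is an $s$-eigenvalue of $L$ if $V_a:=\ker(L-\Lambda_a)=\{f\in V:Lf=\Lambda_af\}\ne\{0\}$. $L$ is $s$-diagonalizable if there are finitely many ($m\ge1$) sequences of bounded spectrum $a_1,\dots,a_m$ such that $\Lambda_{a_1},\dots,\Lambda_{a_m}$ are $s$-eigenvalues of $L$ and $V=V_{a_1}\oplus\dots\oplus V_{a_m}$ (direct sum, not necessarily orthogonal); then $(a_1,\dots,a_m)$ is called an $s$-diagonalization of $L$. For $i\ge 1$ let $B_i$ be the set of $\omega\in\sigma(V)$ for which $R(\omega)$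 has exactly $i$ different eigenvalues, and $\mathfrak{g}:=\max\{i\in\mathbb{N}:|B_i|>0\}$ (equivalently, $\mathfrak{g}$ is the essential supremum over $\sigma(V)$ of the number of distinct eigenvalues of $R(\omega)$). *)

theory Defs
  imports "HOL-Analysis.Analysis"
begin

text \<open>
  Elements of an \<open>L\<^sup>2\<close> space are represented by square-integrable functions, and
  equality in \<open>L\<^sup>2\<close> is equality almost everywhere.  With \<open>M = lebesgue\<close> this is
  \<open>L\<^sup>2(\<real>\<^sup>d)\<close>; with the counting measure it is \<open>\<ell>\<^sup>2\<close>, where equality almost
  everywhere is equality.
\<close>

definition L2_space :: "'a measure \<Rightarrow> ('a \<Rightarrow> complex) set" where
  "L2_space M = {f. f \<in> borel_measurable M \<and> integrable M (\<lambda>x. (cmod (f x))\<^sup>2)}"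

definition L2_inner :: "'a measure \<Rightarrow> ('a \<Rightarrow> complex) \<Rightarrow> ('a \<Rightarrow> complex) \<Rightarrow> complex" where
  "L2_inner M f g = (\<integral>x. f x * cnj (g x) \<partial>M)"

definition L2_norm :: "'a measure \<Rightarrow> ('a \<Rightarrow> complex) \<Rightarrow> real" where
  "L2_norm M f = sqrt (\<integral>x. (cmod (f x))\<^sup>2 \<partial>M)"

definition L2_tendsto :: "'a measure \<Rightarrow> (nat \<Rightarrow> 'a \<Rightarrow> complex) \<Rightarrow> ('a \<Rightarrow> complex) \<Rightarrow> bool" where
  "L2_tendsto M s f \<longleftrightarrow> (\<forall>n. s n \<in> L2_space M) \<and> f \<in> L2_space M \<and>
     (\<lambda>n. L2_norm M (\<lambda>x. s n x - f x)) \<longlonglongrightarrow> 0"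

text \<open>
  Closedness also makes the set of representatives saturated: a function equal
  almost everywhere to a member is the limit of a constant sequence of members.
\<close>

definition closed_subspace :: "'a measure \<Rightarrow> ('a \<Rightarrow> complex) set \<Rightarrow> bool" where
  "closed_subspace M S \<longleftrightarrow>
     S \<subseteq> L2_space M \<and> (\<lambda>_. 0) \<in> S \<and>
     (\<forall>f\<in>S. \<forall>g\<in>S. (\<lambda>x. f x + g x) \<in> S) \<and>
     (\<forall>c. \<forall>f\<in>S. (\<lambda>x. c * f x) \<in> S) \<and>
     (\<forall>s f. (\<forall>n. s n \<in> S) \<and> L2_tendsto M s f \<longrightarrow> f \<in> S)"

definition lin_span :: "('a \<Rightarrow> complex) set \<Rightarrow> ('a \<Rightarrow> complex) set" where
  "lin_span S = {\<lambda>x. \<Sum>g\<in>F. c g * g x | F c. finite F \<and> F \<subseteq> S}"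

definition closed_span :: "'a measure \<Rightarrow> ('a \<Rightarrow> complex) set \<Rightarrow> ('a \<Rightarrow> complex) set" where
  "closed_span M S = {f. \<exists>s. (\<forall>n. s n \<in> lin_span S) \<and> L2_tendsto M s f}"

text \<open>
  A bounded linear operator from the closed subspace \<open>S\<close> to itself.  Linearity and
  boundedness imply that it respects equality almost everywhere.
\<close>

definition bounded_operator_on ::
    "'a measure \<Rightarrow> ('a \<Rightarrow> complex) set \<Rightarrow> (('a \<Rightarrow> complex) \<Rightarrow> 'a \<Rightarrow> complex) \<Rightarrow> bool" where
  "bounded_operator_on M S A \<longleftrightarrow>
     (\<forall>f\<in>S. A f \<in> S) \<and>
     (\<forall>f\<in>S. \<forall>g\<in>S. AE x in M. A (\<lambda>y. f y + g y) x = A f x + A g x) \<and>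
     (\<forall>c. \<forall>f\<in>S. AE x in M. A (\<lambda>y. c * f y) x = c * A f x) \<and>
     (\<exists>C. \<forall>f\<in>S. L2_norm M (A f) \<le> C * L2_norm M f)"

abbreviation ell2 :: "('k \<Rightarrow> complex) set" where
  "ell2 \<equiv> L2_space (count_space UNIV)"

abbreviation ell2_inner :: "('k \<Rightarrow> complex) \<Rightarrow> ('k \<Rightarrow> complex) \<Rightarrow> complex" where
  "ell2_inner \<equiv> L2_inner (count_space UNIV)"

definition ell2_proj :: "('k \<Rightarrow> complex) set \<Rightarrow> ('k \<Rightarrow> complex) \<Rightarrow> 'k \<Rightarrow> complex" where
  "ell2_proj S u = (THE p. p \<in> S \<and> (\<forall>v\<in>S. ell2_inner (\<lambda>k. u k - p k) v = 0))"

text \<open>The embedding of \<open>\<int>\<^sup>d\<close> into \<open>\<real>\<^sup>d\<close>.\<close>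

definition of_zvec :: "int ^ 'd \<Rightarrow> real ^ 'd" where
  "of_zvec k = (\<chi> i. real_of_int (k $ i))"

definition unit_cube :: "(real ^ 'd) set" where
  "unit_cube = {\<omega>. \<forall>i. 0 \<le> \<omega> $ i \<and> \<omega> $ i < 1}"

definition shift_op :: "int ^ 'd \<Rightarrow> (real ^ 'd \<Rightarrow> complex) \<Rightarrow> real ^ 'd \<Rightarrow> complex" where
  "shift_op k f = (\<lambda>x. f (x - of_zvec k))"

definition shift_invariant :: "(real ^ 'd \<Rightarrow> complex) set \<Rightarrow> bool" where
  "shift_invariant V \<longleftrightarrow>
     closed_subspace lebesgue V \<and> (\<forall>f\<in>V. \<forall>k. shift_op k f \<in> V)"

definition finitely_generated :: "(real ^ 'd \<Rightarrow> complex) set \<Rightarrow> bool" where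
  "finitely_generated V \<longleftrightarrow>
     (\<exists>\<Phi>. finite \<Phi> \<and> \<Phi> \<subseteq> L2_space lebesgue \<and>
        V = closed_span lebesgue {shift_op k \<phi> | k \<phi>. \<phi> \<in> \<Phi>})"

definition shift_preserving ::
    "(real ^ 'd \<Rightarrow> complex) set \<Rightarrow> ((real ^ 'd \<Rightarrow> complex) \<Rightarrow> real ^ 'd \<Rightarrow> complex) \<Rightarrow> bool" where
  "shift_preserving V L \<longleftrightarrow>
     bounded_operator_on lebesgue V L \<and>
     (\<forall>f\<in>V. \<forall>k. AE x in lebesgue. L (shift_op k f) x = shift_op k (L f) x)"

definition fourier_integral :: "(real ^ 'd \<Rightarrow> complex) \<Rightarrow> real ^ 'd \<Rightarrow> complex" where
  "fourier_integral f \<omega> = (\<integral>x. f x * cis (- (2 * pi * (\<omega> \<bullet> x))) \<partial>lebesgue)"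

text \<open>
  The Fourier transform on \<open>L\<^sup>2(\<real>\<^sup>d)\<close> is the continuous extension of the integral
  formula from \<open>L\<^sup>1 \<inter> L\<^sup>2\<close>; the result is determined up to null sets.
\<close>

definition fourier :: "(real ^ 'd \<Rightarrow> complex) \<Rightarrow> real ^ 'd \<Rightarrow> complex" where
  "fourier f = (SOME g. \<exists>s. (\<forall>n. integrable lebesgue (s n)) \<and>
     L2_tendsto lebesgue s f \<and> L2_tendsto lebesgue (\<lambda>n. fourier_integral (s n)) g)"

definition fiberization :: "(real ^ 'd \<Rightarrow> complex) \<Rightarrow> real ^ 'd \<Rightarrow> int ^ 'd \<Rightarrow> complex" where
  "fiberization f \<omega> = (\<lambda>k. fourier f (\<omega> + of_zvec k))"

definition measurable_range_function ::
    "(real ^ 'd \<Rightarrow> (int ^ 'd \<Rightarrow> complex) set) \<Rightarrow> bool" where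
  "measurable_range_function J \<longleftrightarrow>
     (\<forall>\<omega>\<in>unit_cube. closed_subspace (count_space UNIV) (J \<omega>)) \<and>
     (\<forall>u\<in>ell2. \<forall>v\<in>ell2.
        (\<lambda>\<omega>. ell2_inner (ell2_proj (J \<omega>) u) v) \<in> borel_measurable (lebesgue_on unit_cube))"

definition is_range_function ::
    "(real ^ 'd \<Rightarrow> complex) set \<Rightarrow> (real ^ 'd \<Rightarrow> (int ^ 'd \<Rightarrow> complex) set) \<Rightarrow> bool" where
  "is_range_function V J \<longleftrightarrow>
     measurable_range_function J \<and>
     (\<forall>f\<in>L2_space lebesgue.
        f \<in> V \<longleftrightarrow> (AE \<omega> in lebesgue_on unit_cube. fiberization f \<omega> \<in> J \<omega>))"

definition spectrum :: "(real ^ 'd \<Rightarrow> (int ^ 'd \<Rightarrow> complex) set) \<Rightarrow> (real ^ 'd) set" where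
  "spectrum J = {\<omega> \<in> unit_cube. J \<omega> \<noteq> {\<lambda>_. 0}}"

text \<open>\<open>J\<close> is meant to be the range function of \<open>V\<close>.\<close>

definition is_range_operator ::
    "(real ^ 'd \<Rightarrow> complex) set \<Rightarrow> ((real ^ 'd \<Rightarrow> complex) \<Rightarrow> real ^ 'd \<Rightarrow> complex) \<Rightarrow>
     (real ^ 'd \<Rightarrow> (int ^ 'd \<Rightarrow> complex) set) \<Rightarrow>
     (real ^ 'd \<Rightarrow> (int ^ 'd \<Rightarrow> complex) \<Rightarrow> int ^ 'd \<Rightarrow> complex) \<Rightarrow> bool" where
  "is_range_operator V L J R \<longleftrightarrow>
     (\<forall>\<omega>\<in>unit_cube. bounded_operator_on (count_space UNIV) (J \<omega>) (R \<omega>)) \<and>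
     (\<forall>u\<in>ell2. \<forall>v\<in>ell2.
        (\<lambda>\<omega>. ell2_inner (R \<omega> (ell2_proj (J \<omega>) u)) v) \<in> borel_measurable (lebesgue_on unit_cube)) \<and>
     (\<forall>f\<in>V. AE \<omega> in lebesgue_on unit_cube.
        fiberization (L f) \<omega> = R \<omega> (fiberization f \<omega>))"

text \<open>
  For \<open>a \<in> \<ell>\<^sup>2(\<int>\<^sup>d)\<close> the Fourier series converges unconditionally in \<open>L\<^sup>2([0,1)\<^sup>d)\<close>,
  and not pointwise in general.
\<close>

definition fourier_series :: "(int ^ 'd \<Rightarrow> complex) \<Rightarrow> real ^ 'd \<Rightarrow> complex" where
  "fourier_series a = (SOME h. h \<in> L2_space (lebesgue_on unit_cube) \<and>
     ((\<lambda>F. L2_norm (lebesgue_on unit_cube)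
        (\<lambda>\<omega>. (\<Sum>k\<in>F. a k * cis (- (2 * pi * (\<omega> \<bullet> of_zvec k)))) - h \<omega>)) \<longlongrightarrow> 0)
       (finite_subsets_at_top UNIV))"

definition bounded_spectrum :: "(int ^ 'd \<Rightarrow> complex) \<Rightarrow> bool" where
  "bounded_spectrum a \<longleftrightarrow> a \<in> ell2 \<and>
     (\<exists>C. AE \<omega> in lebesgue_on unit_cube. cmod (fourier_series a \<omega>) \<le> C)"

definition Lambda_op ::
    "(int ^ 'd \<Rightarrow> complex) \<Rightarrow> (real ^ 'd \<Rightarrow> complex) \<Rightarrow> real ^ 'd \<Rightarrow> complex" where
  "Lambda_op a f = (SOME g. g \<in> L2_space lebesgue \<and>
     (AE \<omega> in lebesgue_on unit_cube.
        fiberization g \<omega> = (\<lambda>k. fourier_series a \<omega> * fiberization f \<omega> k)))"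

definition s_eigenspace ::
    "(real ^ 'd \<Rightarrow> complex) set \<Rightarrow> ((real ^ 'd \<Rightarrow> complex) \<Rightarrow> real ^ 'd \<Rightarrow> complex) \<Rightarrow>
     (int ^ 'd \<Rightarrow> complex) \<Rightarrow> (real ^ 'd \<Rightarrow> complex) set" where
  "s_eigenspace V L a = {f \<in> V. AE x in lebesgue. L f x = Lambda_op a f x}"

definition is_s_eigenvalue ::
    "(real ^ 'd \<Rightarrow> complex) set \<Rightarrow> ((real ^ 'd \<Rightarrow> complex) \<Rightarrow> real ^ 'd \<Rightarrow> complex) \<Rightarrow>
     (int ^ 'd \<Rightarrow> complex) \<Rightarrow> bool" where
  "is_s_eigenvalue V L a \<longleftrightarrow> (\<exists>f \<in> s_eigenspace V L a. \<not> (AE x in lebesgue. f x = 0))"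

definition is_direct_sum ::
    "'a measure \<Rightarrow> ('a \<Rightarrow> complex) set \<Rightarrow> (nat \<Rightarrow> ('a \<Rightarrow> complex) set) \<Rightarrow> nat \<Rightarrow> bool" where
  "is_direct_sum M V W m \<longleftrightarrow>
     V = {f \<in> L2_space M. \<exists>g. (\<forall>j<m. g j \<in> W j) \<and> (AE x in M. f x = (\<Sum>j<m. g j x))} \<and>
     (\<forall>g. (\<forall>j<m. g j \<in> W j) \<and> (AE x in M. (\<Sum>j<m. g j x) = 0) \<longrightarrow>
        (\<forall>j<m. AE x in M. g j x = 0))"

definition is_s_diagonalization ::
    "(real ^ 'd \<Rightarrow> complex) set \<Rightarrow> ((real ^ 'd \<Rightarrow> complex) \<Rightarrow> real ^ 'd \<Rightarrow> complex) \<Rightarrow>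
     (int ^ 'd \<Rightarrow> complex) list \<Rightarrow> bool" where
  "is_s_diagonalization V L as \<longleftrightarrow>
     as \<noteq> [] \<and>
     (\<forall>a\<in>set as. bounded_spectrum a \<and> is_s_eigenvalue V L a) \<and>
     is_direct_sum lebesgue V (\<lambda>j. s_eigenspace V L (as ! j)) (length as)"

definition s_diagonalizable ::
    "(real ^ 'd \<Rightarrow> complex) set \<Rightarrow> ((real ^ 'd \<Rightarrow> complex) \<Rightarrow> real ^ 'd \<Rightarrow> complex) \<Rightarrow> bool" where
  "s_diagonalizable V L \<longleftrightarrow> (\<exists>as. is_s_diagonalization V L as)"

definition s_beta ::
    "(real ^ 'd \<Rightarrow> complex) set \<Rightarrow> ((real ^ 'd \<Rightarrow> complex) \<Rightarrow> real ^ 'd \<Rightarrow> complex) \<Rightarrow> nat" where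
  "s_beta V L = (LEAST m. \<exists>as. length as = m \<and> is_s_diagonalization V L as)"

definition eigenvalues_on ::
    "('k \<Rightarrow> complex) set \<Rightarrow> (('k \<Rightarrow> complex) \<Rightarrow> 'k \<Rightarrow> complex) \<Rightarrow> complex set" where
  "eigenvalues_on S A = {\<mu>. \<exists>v\<in>S. v \<noteq> (\<lambda>_. 0) \<and> A v = (\<lambda>k. \<mu> * v k)}"

definition eigenvalue_level ::
    "(real ^ 'd \<Rightarrow> (int ^ 'd \<Rightarrow> complex) set) \<Rightarrow>
     (real ^ 'd \<Rightarrow> (int ^ 'd \<Rightarrow> complex) \<Rightarrow> int ^ 'd \<Rightarrow> complex) \<Rightarrow> nat \<Rightarrow> (real ^ 'd) set" where
  "eigenvalue_level J R i =
     {\<omega> \<in> spectrum J. finite (eigenvalues_on (J \<omega>) (R \<omega>)) \<and>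
        card (eigenvalues_on (J \<omega>) (R \<omega>)) = i}"

definition essential_levels ::
    "(real ^ 'd \<Rightarrow> (int ^ 'd \<Rightarrow> complex) set) \<Rightarrow>
     (real ^ 'd \<Rightarrow> (int ^ 'd \<Rightarrow> complex) \<Rightarrow> int ^ 'd \<Rightarrow> complex) \<Rightarrow> nat set" where
  "essential_levels J R = {i. 1 \<le> i \<and> emeasure lebesgue (eigenvalue_level J R i) > 0}"

definition s_gnum ::
    "(real ^ 'd \<Rightarrow> (int ^ 'd \<Rightarrow> complex) set) \<Rightarrow>
     (real ^ 'd \<Rightarrow> (int ^ 'd \<Rightarrow> complex) \<Rightarrow> int ^ 'd \<Rightarrow> complex) \<Rightarrow> nat" where
  "s_gnum J R = Max (essential_levels J R)"

end

theory Submission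
  imports Defs "HOL-Probability.Characteristic_Functions"
begin

text \<open>
  Fiberization turns \<open>L\<close> into the field of operators \<open>R \<omega>\<close> on \<open>J \<omega>\<close>, and \<open>\<Lambda>\<^sub>a\<close> into
  multiplication by the scalar \<open>fourier_series a \<omega>\<close>, the symbol of \<open>a\<close>.  A function lies in the
  eigenspace of \<open>a\<close> iff almost all of its fibers are eigenvectors of \<open>R \<omega>\<close> for the symbol, or
  zero (\<open>s_eigenspace_iff\<close>).

  Let \<open>a\<^sub>1, \<dots>, a\<^sub>m\<close> be an \<open>s\<close>-diagonalization.  The orthogonal projections of the unit vectors
  \<open>e\<^sub>n\<close> to \<open>J \<omega>\<close> are the fibers of functions in \<open>V\<close> (\<open>projection_generators\<close>); decomposing these
  functions writes the projections as sums of \<open>m\<close> eigenvectors.  As they span a dense subspace of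
  \<open>J \<omega>\<close>, every eigenvalue of \<open>R \<omega>\<close> is one of the \<open>m\<close> symbols
  (\<open>eigenvalues_of_decomposition\<close>).  Hence \<open>R \<omega>\<close> has at most \<open>m\<close> eigenvalues, which gives
  \<open>s_gnum J R \<le> s_beta V L\<close>.  More precisely, the eigenvalues are the symbols of those indices
  for which some component is nonzero at \<open>\<omega>\<close>, and their number is a measurable function of
  \<open>\<omega>\<close>.  Some eigenvalue exists on a set of positive measure since \<open>L\<close> has a nonzero
  eigenfunction.

  Conversely, list the eigenvalues of \<open>R \<omega>\<close> at each frequency, without repetition, and continue
  the list by distinct constants that exceed all symbols (\<open>listed\<close>).  The first
  \<open>g = s_gnum J R\<close> entries of these lists are bounded measurable functions, and every bounded measurable function on the cube
  is the symbol of a sequence (\<open>fourier_series_surjective\<close>).  Cutting the components of a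
  decomposition along the sets where an old symbol equals a given list entry shows that the new
  eigenspaces span \<open>V\<close>; they are independent because list entries are distinct; and they are
  nontrivial because each of the \<open>g\<close> entries is an eigenvalue on the set of frequencies with
  exactly \<open>g\<close> eigenvalues.

  The analytic input consists of four facts: the Fourier transform is a bijection of
  \<open>L\<^sup>2(\<real>\<^sup>d)\<close> up to null sets (\<open>fourier_injective\<close>, \<open>fourier_surjective\<close>), proved by Gaussian
  damping; Fourier series converge and the trigonometric system is complete
  (\<open>is_fourier_series_exists\<close>, \<open>trigonometric_completeness\<close>); integer translates of the unit cube
  tile the space, so that fibers may be prescribed and multiplied by scalars
  (\<open>fiberization_surjective\<close>, \<open>fiberization_multiplier\<close>); and closed subspaces have orthogonal
  projections (\<open>L2_projection_exists\<close>).
\<close>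

section \<open>Square-integrable functions\<close>

text \<open>
  The square of the \<open>L\<^sup>2\<close> norm, as an extended nonnegative number: it is defined for all
  functions, so that estimates need no integrability side conditions, and it is unchanged
  by completion of the measure.
\<close>

definition energy :: "'a measure \<Rightarrow> ('a \<Rightarrow> complex) \<Rightarrow> ennreal" where
  "energy M f = (\<integral>\<^sup>+x. ennreal ((cmod (f x))\<^sup>2) \<partial>M)"

lemma L2_space_iff_energy: "f \<in> L2_space M \<longleftrightarrow> f \<in> borel_measurable M \<and> energy M f < \<infinity>"
  by (auto simp: L2_space_def energy_def integrable_iff_bounded)

lemma L2_space_measurable: "f \<in> L2_space M \<Longrightarrow> f \<in> borel_measurable M"
  by (simp add: L2_space_def)

lemma L2_space_measurable_diff:
  "f \<in> L2_space M \<Longrightarrow> g \<in> L2_space M \<Longrightarrow> (\<lambda>x. f x - g x) \<in> borel_measurable M"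
  by (auto simp: L2_space_def)

lemma energy_cong_AE: "AE x in M. f x = g x \<Longrightarrow> energy M f = energy M g"
  unfolding energy_def by (rule nn_integral_cong_AE) auto

lemma energy_uminus: "energy M (\<lambda>x. - f x) = energy M f"
  by (simp add: energy_def)

lemma energy_minus_commute: "energy M (\<lambda>x. f x - g x) = energy M (\<lambda>x. g x - f x)"
  by (simp add: energy_def norm_minus_commute)

text \<open>
  This weak form of the triangle inequality is all that limits in \<open>L\<^sup>2\<close> need: the factor 2 is
  harmless, and square roots never enter.
\<close>

lemma cmod_add_square_le: "(cmod (a + b))\<^sup>2 \<le> 2 * (cmod a)\<^sup>2 + 2 * (cmod b)\<^sup>2"
proof -
  have "(cmod (a + b))\<^sup>2 \<le> (cmod a + cmod b)\<^sup>2"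
    by (simp add: norm_triangle_ineq power_mono)
  also have "\<dots> \<le> 2 * (cmod a)\<^sup>2 + 2 * (cmod b)\<^sup>2"
    using sum_squares_bound[of "cmod a" "cmod b"] by (simp add: power2_sum)
  finally show ?thesis .
qed

lemma energy_add_le:
  assumes [measurable]: "f \<in> borel_measurable M" "g \<in> borel_measurable M"
  shows "energy M (\<lambda>x. f x + g x) \<le> 2 * energy M f + 2 * energy M g"
proof -
  have "energy M (\<lambda>x. f x + g x) \<le> (\<integral>\<^sup>+x. 2 * ennreal ((cmod (f x))\<^sup>2) + 2 * ennreal ((cmod (g x))\<^sup>2) \<partial>M)"
    unfolding energy_def
  proof (rule nn_integral_mono)
    fix x
    have "ennreal ((cmod (f x + g x))\<^sup>2) \<le> ennreal (2 * (cmod (f x))\<^sup>2 + 2 * (cmod (g x))\<^sup>2)"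
      by (rule ennreal_leI[OF cmod_add_square_le])
    then show "ennreal ((cmod (f x + g x))\<^sup>2) \<le> 2 * ennreal ((cmod (f x))\<^sup>2) + 2 * ennreal ((cmod (g x))\<^sup>2)"
      by (simp add: ennreal_mult ennreal_plus)
  qed
  also have "\<dots> = 2 * energy M f + 2 * energy M g"
    by (simp add: energy_def nn_integral_add nn_integral_cmult)
  finally show ?thesis .
qed

lemma energy_triangle:
  assumes "f \<in> borel_measurable M" "g \<in> borel_measurable M" "h \<in> borel_measurable M"
  shows "energy M (\<lambda>x. f x - h x) \<le> 2 * energy M (\<lambda>x. f x - g x) + 2 * energy M (\<lambda>x. g x - h x)"
  using energy_add_le[of "\<lambda>x. f x - g x" M "\<lambda>x. g x - h x"] assms by simp

lemma energy_cmult: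
  assumes [measurable]: "f \<in> borel_measurable M"
  shows "energy M (\<lambda>x. c * f x) = ennreal ((cmod c)\<^sup>2) * energy M f"
proof -
  have "ennreal ((cmod (c * f x))\<^sup>2) = ennreal ((cmod c)\<^sup>2) * ennreal ((cmod (f x))\<^sup>2)" for x
    by (subst ennreal_mult[symmetric]) (simp_all add: norm_mult power_mult_distrib)
  then show ?thesis
    unfolding energy_def by (simp only:) (rule nn_integral_cmult, measurable)
qed

lemma energy_mult_le:
  assumes "AE x in M. cmod (c x) \<le> C" and [measurable]: "f \<in> borel_measurable M" and "0 \<le> C"
  shows "energy M (\<lambda>x. c x * f x) \<le> ennreal (C\<^sup>2) * energy M f"
proof -
  have "AE x in M. ennreal ((cmod (c x * f x))\<^sup>2) \<le> ennreal ((cmod (complex_of_real C * f x))\<^sup>2)"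
    using assms(1)
  proof eventually_elim
    case (elim x)
    then have "cmod (c x * f x) \<le> cmod (complex_of_real C * f x)"
      using \<open>0 \<le> C\<close> unfolding norm_mult by (intro mult_right_mono) auto
    then show ?case by (intro ennreal_leI power_mono) auto
  qed
  then have "energy M (\<lambda>x. c x * f x) \<le> energy M (\<lambda>x. complex_of_real C * f x)"
    unfolding energy_def by (rule nn_integral_mono_AE)
  also have "\<dots> = ennreal (C\<^sup>2) * energy M f"
    by (subst energy_cmult) simp_all
  finally show ?thesis .
qed

lemma energy_eq_0_iff:
  assumes [measurable]: "f \<in> borel_measurable M"
  shows "energy M f = 0 \<longleftrightarrow> (AE x in M. f x = 0)"
proof -
  have "energy M f = 0 \<longleftrightarrow> (AE x in M. ennreal ((cmod (f x))\<^sup>2) = 0)"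
    unfolding energy_def by (rule nn_integral_0_iff_AE) measurable
  moreover have "ennreal ((cmod (f x))\<^sup>2) = 0 \<longleftrightarrow> f x = 0" for x
    using ennreal_eq_0_iff[of "(cmod (f x))\<^sup>2"] by simp
  ultimately show ?thesis by simp
qed

lemma L2_norm_nonneg: "0 \<le> L2_norm M f"
  unfolding L2_norm_def by (rule real_sqrt_ge_zero) (rule integral_nonneg_AE, simp)

lemma L2_norm_power2: "(L2_norm M f)\<^sup>2 = (\<integral>x. (cmod (f x))\<^sup>2 \<partial>M)"
  unfolding L2_norm_def by (rule real_sqrt_pow2) (rule integral_nonneg_AE, simp)

lemma L2_norm_energy:
  assumes "f \<in> L2_space M"
  shows "ennreal ((L2_norm M f)\<^sup>2) = energy M f" "L2_norm M f = sqrt (enn2real (energy M f))"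
proof -
  have i: "integrable M (\<lambda>x. (cmod (f x))\<^sup>2)" using assms by (simp add: L2_space_def)
  have e: "(\<integral>\<^sup>+x. ennreal ((cmod (f x))\<^sup>2) \<partial>M) = ennreal (\<integral>x. (cmod (f x))\<^sup>2 \<partial>M)"
    by (rule nn_integral_eq_integral[OF i]) simp
  show *: "ennreal ((L2_norm M f)\<^sup>2) = energy M f"
    unfolding L2_norm_power2 energy_def e ..
  show "L2_norm M f = sqrt (enn2real (energy M f))"
    unfolding *[symmetric] using L2_norm_nonneg[of M f] by simp
qed

lemma L2_space_zero: "(\<lambda>x. 0) \<in> L2_space M"
  by (simp add: L2_space_def)

lemma L2_space_add:
  assumes "f \<in> L2_space M" "g \<in> L2_space M"
  shows "(\<lambda>x. f x + g x) \<in> L2_space M"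
proof -
  have "2 * energy M f + 2 * energy M g < \<infinity>"
    using assms by (simp add: L2_space_iff_energy ennreal_mult_less_top)
  then show ?thesis
    using assms energy_add_le[of f M g] by (auto simp: L2_space_iff_energy intro: le_less_trans)
qed

lemma L2_space_cmult:
  assumes "f \<in> L2_space M" shows "(\<lambda>x. c * f x) \<in> L2_space M"
proof -
  have [measurable]: "f \<in> borel_measurable M" and "energy M f < \<infinity>"
    using assms by (simp_all add: L2_space_iff_energy)
  then show ?thesis unfolding L2_space_iff_energy by (simp add: energy_cmult ennreal_mult_less_top)
qed

lemma L2_space_uminus: "f \<in> L2_space M \<Longrightarrow> (\<lambda>x. - f x) \<in> L2_space M"
  unfolding L2_space_iff_energy by (simp add: energy_uminus)

lemma L2_space_diff:
  "f \<in> L2_space M \<Longrightarrow> g \<in> L2_space M \<Longrightarrow> (\<lambda>x. f x - g x) \<in> L2_space M"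
  using L2_space_add[OF _ L2_space_uminus, of f M g] by simp

lemma L2_space_sum:
  "(\<And>i. i \<in> I \<Longrightarrow> f i \<in> L2_space M) \<Longrightarrow> (\<lambda>x. \<Sum>i\<in>I. f i x) \<in> L2_space M"
proof (induction I rule: infinite_finite_induct)
  case (insert i I)
  then have "(\<lambda>x. f i x + (\<Sum>j\<in>I. f j x)) \<in> L2_space M"
    by (intro L2_space_add) simp_all
  then show ?case using insert.hyps by simp
qed (simp_all add: L2_space_zero)

lemma L2_space_bounded_mult:
  assumes "AE x in M. cmod (c x) \<le> C" "c \<in> borel_measurable M" "f \<in> L2_space M"
  shows "(\<lambda>x. c x * f x) \<in> L2_space M"
proof -
  have *: "AE x in M. cmod (c x) \<le> max 0 C" using assms(1) by eventually_elim auto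
  have "ennreal ((max 0 C)\<^sup>2) * energy M f < \<infinity>"
    using assms by (simp add: L2_space_iff_energy ennreal_mult_less_top)
  moreover have "energy M (\<lambda>x. c x * f x) \<le> ennreal ((max 0 C)\<^sup>2) * energy M f"
    using assms by (intro energy_mult_le *) (auto simp: L2_space_measurable)
  ultimately show ?thesis
    using assms by (auto simp: L2_space_iff_energy intro: le_less_trans)
qed

lemma tendsto_0_of_square:
  assumes "((\<lambda>n. ennreal ((f n)\<^sup>2)) \<longlongrightarrow> 0) F" "\<And>n. 0 \<le> f n"
  shows "(f \<longlongrightarrow> 0) F"
proof -
  have "((\<lambda>n. (f n)\<^sup>2) \<longlongrightarrow> 0) F"
    using assms(1) by (subst (asm) ennreal_0[symmetric], subst (asm) tendsto_ennreal_iff) auto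
  from tendsto_real_sqrt[OF this] show ?thesis using assms(2) by simp
qed

lemma tendsto_L2_norm_iff_energy:
  assumes f: "\<And>n. f n \<in> L2_space M"
  shows "((\<lambda>n. L2_norm M (f n)) \<longlongrightarrow> 0) F \<longleftrightarrow> ((\<lambda>n. energy M (f n)) \<longlongrightarrow> 0) F"
proof
  assume "((\<lambda>n. L2_norm M (f n)) \<longlongrightarrow> 0) F"
  from tendsto_power[OF this, of 2] have "((\<lambda>n. ennreal ((L2_norm M (f n))\<^sup>2)) \<longlongrightarrow> ennreal 0) F"
    by (intro tendsto_ennrealI) simp
  then show "((\<lambda>n. energy M (f n)) \<longlongrightarrow> 0) F" unfolding L2_norm_energy(1)[OF f] ennreal_0 .
next
  assume "((\<lambda>n. energy M (f n)) \<longlongrightarrow> 0) F"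
  then show "((\<lambda>n. L2_norm M (f n)) \<longlongrightarrow> 0) F"
    unfolding L2_norm_energy(1)[OF f, symmetric] by (rule tendsto_0_of_square) (rule L2_norm_nonneg)
qed

lemma L2_tendsto_iff_energy:
  "L2_tendsto M s f \<longleftrightarrow> (\<forall>n. s n \<in> L2_space M) \<and> f \<in> L2_space M \<and>
     (\<lambda>n. energy M (\<lambda>x. s n x - f x)) \<longlonglongrightarrow> 0"
proof (cases "(\<forall>n. s n \<in> L2_space M) \<and> f \<in> L2_space M")
  case True
  then have "(\<lambda>x. s n x - f x) \<in> L2_space M" for n by (intro L2_space_diff) auto
  from tendsto_L2_norm_iff_energy[of "\<lambda>n x. s n x - f x", OF this, of sequentially] show ?thesis unfolding L2_tendsto_def by argo
next
  case False
  then show ?thesis unfolding L2_tendsto_def by argo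
qed

lemma L2_tendsto_D:
  assumes "L2_tendsto M s f"
  shows "s n \<in> L2_space M" "f \<in> L2_space M" "(\<lambda>n. energy M (\<lambda>x. s n x - f x)) \<longlonglongrightarrow> 0"
  using assms by (auto simp: L2_tendsto_iff_energy)

lemma tendsto_0_double_sum_ennreal:
  assumes "(a \<longlongrightarrow> (0::ennreal)) F" "(b \<longlongrightarrow> 0) F"
  shows "((\<lambda>n. 2 * a n + 2 * b n) \<longlongrightarrow> 0) F"
proof -
  have "((\<lambda>n. 2 * a n + 2 * b n) \<longlongrightarrow> 2 * 0 + 2 * 0) F"
    using assms by (intro tendsto_add ennreal_tendsto_cmult) auto
  then show ?thesis by simp
qed

lemma tendsto_0_le_ennreal:
  assumes "(b \<longlongrightarrow> (0::ennreal)) F" "eventually (\<lambda>n. a n \<le> b n) F"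
  shows "(a \<longlongrightarrow> 0) F"
  by (rule tendsto_sandwich[OF _ assms(2) tendsto_const assms(1)]) auto

lemma L2_tendsto_add:
  assumes "L2_tendsto M s f" "L2_tendsto M t g"
  shows "L2_tendsto M (\<lambda>n x. s n x + t n x) (\<lambda>x. f x + g x)"
  unfolding L2_tendsto_iff_energy
proof (intro conjI allI)
  note st = L2_tendsto_D[OF assms(1)] L2_tendsto_D[OF assms(2)]
  show "(\<lambda>n. energy M (\<lambda>x. s n x + t n x - (f x + g x))) \<longlonglongrightarrow> 0"
  proof (rule tendsto_0_le_ennreal[OF tendsto_0_double_sum_ennreal[OF st(3) st(6)]], intro always_eventually allI)
    fix n
    have "(\<lambda>x. s n x + t n x - (f x + g x)) = (\<lambda>x. (s n x - f x) + (t n x - g x))" by auto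
    then show "energy M (\<lambda>x. s n x + t n x - (f x + g x)) \<le>
        2 * energy M (\<lambda>x. s n x - f x) + 2 * energy M (\<lambda>x. t n x - g x)"
      using energy_add_le[of "\<lambda>x. s n x - f x" M "\<lambda>x. t n x - g x"] st
      by (simp add: L2_space_measurable_diff)
  qed
qed (use L2_tendsto_D[OF assms(1)] L2_tendsto_D[OF assms(2)] in \<open>auto intro: L2_space_add\<close>)

lemma L2_tendsto_cmult:
  assumes "L2_tendsto M s f"
  shows "L2_tendsto M (\<lambda>n x. c * s n x) (\<lambda>x. c * f x)"
  unfolding L2_tendsto_iff_energy
proof (intro conjI allI)
  note s = L2_tendsto_D[OF assms(1)]
  have "energy M (\<lambda>x. c * s n x - c * f x) = ennreal ((cmod c)\<^sup>2) * energy M (\<lambda>x. s n x - f x)" for n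
    using energy_cmult[of "\<lambda>x. s n x - f x" M c] s
    by (simp add: L2_space_measurable_diff right_diff_distrib)
  moreover have "(\<lambda>n. ennreal ((cmod c)\<^sup>2) * energy M (\<lambda>x. s n x - f x)) \<longlonglongrightarrow> ennreal ((cmod c)\<^sup>2) * 0"
    using s by (intro ennreal_tendsto_cmult) auto
  ultimately show "(\<lambda>n. energy M (\<lambda>x. c * s n x - c * f x)) \<longlonglongrightarrow> 0" by simp
qed (use L2_tendsto_D[OF assms(1)] in \<open>auto intro: L2_space_cmult\<close>)

lemma L2_tendsto_cong_AE:
  assumes "L2_tendsto M s f" "AE x in M. f x = g x" "g \<in> borel_measurable M"
  shows "L2_tendsto M s g"
proof -
  have "energy M (\<lambda>x. s n x - f x) = energy M (\<lambda>x. s n x - g x)" for n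
    by (rule energy_cong_AE) (use assms(2) in auto)
  moreover have "energy M f = energy M g" by (rule energy_cong_AE[OF assms(2)])
  ultimately show ?thesis
    using assms unfolding L2_tendsto_iff_energy L2_space_iff_energy by simp
qed

lemma L2_tendsto_unique:
  assumes "L2_tendsto M s f" "L2_tendsto M s g"
  shows "AE x in M. f x = g x"
proof -
  note st = L2_tendsto_D[OF assms(1)] L2_tendsto_D[OF assms(2)]
  have "(\<lambda>n. energy M (\<lambda>x. f x - g x)) \<longlonglongrightarrow> 0"
  proof (rule tendsto_0_le_ennreal[OF tendsto_0_double_sum_ennreal[OF st(3) st(6)]], intro always_eventually allI)
    fix n
    show "energy M (\<lambda>x. f x - g x) \<le>
        2 * energy M (\<lambda>x. s n x - f x) + 2 * energy M (\<lambda>x. s n x - g x)"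
      using energy_triangle[of f M "s n" g] st
      by (simp add: L2_space_measurable energy_minus_commute[of M "s n" f])
  qed
  then have "energy M (\<lambda>x. f x - g x) = 0"
    by (simp add: LIMSEQ_const_iff)
  then show ?thesis
    using st by (subst (asm) energy_eq_0_iff) (auto intro: L2_space_measurable_diff)
qed

lemma ennreal_tendsto_0D: "(a \<longlonglongrightarrow> (0::ennreal)) \<Longrightarrow> 0 < e \<Longrightarrow> \<exists>N. \<forall>n\<ge>N. a n < e"
  using order_tendstoD(2)[of a 0 sequentially e] by (auto simp: eventually_sequentially)

text \<open>
  Riesz--Fischer.  A subsequence whose steps \<open>d\<^sub>k\<close> have energy at most \<open>8\<^sup>-\<^sup>k\<close> converges almost
  everywhere, because \<open>2 d\<^sub>k \<le> 2\<^sup>-\<^sup>k + 2\<^sup>k d\<^sub>k\<^sup>2\<close> and the right-hand sides are summable almost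
  everywhere; Fatou's lemma turns the pointwise limit into the \<open>L\<^sup>2\<close> limit.
\<close>

lemma L2_complete:
  assumes s: "\<And>n. s n \<in> L2_space M"
    and cauchy: "\<And>e. 0 < e \<Longrightarrow> \<exists>N. \<forall>m\<ge>N. \<forall>n\<ge>N. energy M (\<lambda>x. s m x - s n x) < e"
  shows "\<exists>f. L2_tendsto M s f"
proof -
  have [measurable]: "s n \<in> borel_measurable M" for n using s by (simp add: L2_space_measurable)
  have "\<forall>k. \<exists>N. \<forall>m\<ge>N. \<forall>n\<ge>N. energy M (\<lambda>x. s m x - s n x) < ennreal ((1/8) ^ k)"
    using cauchy by simp
  then obtain N where N: "\<And>k m n. m \<ge> N k \<Longrightarrow> n \<ge> N k \<Longrightarrow> energy M (\<lambda>x. s m x - s n x) < ennreal ((1/8) ^ k)"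
    by metis
  \<comment> \<open>the maximum makes the indices admissible for all earlier accuracies\<close>
  define r where "r k = Max (N ` {..k}) + k" for k
  have r_ge: "N k \<le> r j" if "k \<le> j" for j k
    unfolding r_def using that by (intro trans_le_add1 Max_ge) auto
  have r_ge_id: "k \<le> r k" for k by (simp add: r_def)
  define d where "d k x = cmod (s (r (Suc k)) x - s (r k) x)" for k x
  have [measurable]: "d k \<in> borel_measurable M" for k unfolding d_def by measurable
  have d_int: "(\<integral>\<^sup>+x. ennreal (2 ^ k * (d k x)\<^sup>2) \<partial>M) \<le> ennreal ((1/4) ^ k)" for k
  proof -
    have "(\<integral>\<^sup>+x. ennreal (2 ^ k * (d k x)\<^sup>2) \<partial>M) = ennreal (2 ^ k) * energy M (\<lambda>x. s (r (Suc k)) x - s (r k) x)"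
      by (simp add: energy_def d_def ennreal_mult nn_integral_cmult)
    also have "\<dots> \<le> ennreal (2 ^ k) * ennreal ((1/8) ^ k)"
      using N[of k "r (Suc k)" "r k"] r_ge[of k k] r_ge[of k "Suc k"] by (intro mult_left_mono) auto
    also have "\<dots> = ennreal ((1/4) ^ k)"
      by (simp add: ennreal_mult[symmetric] power_mult_distrib[symmetric])
    finally show ?thesis .
  qed
  have "(\<integral>\<^sup>+x. (\<Sum>k. ennreal (2 ^ k * (d k x)\<^sup>2)) \<partial>M) = (\<Sum>k. \<integral>\<^sup>+x. ennreal (2 ^ k * (d k x)\<^sup>2) \<partial>M)"
    by (rule nn_integral_suminf) measurable
  also have "\<dots> \<le> (\<Sum>k. ennreal ((1/4) ^ k))"
    by (intro suminf_le d_int) auto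
  also have "\<dots> = ennreal (\<Sum>k. (1/4) ^ k)"
    by (rule suminf_ennreal2) (auto intro: summable_geometric)
  also have "\<dots> < \<infinity>" by simp
  finally have fin: "(\<integral>\<^sup>+x. (\<Sum>k. ennreal (2 ^ k * (d k x)\<^sup>2)) \<partial>M) \<noteq> \<infinity>" by simp
  have "AE x in M. (\<Sum>k. ennreal (2 ^ k * (d k x)\<^sup>2)) \<noteq> \<infinity>"
    by (rule nn_integral_PInf_AE[OF _ fin]) measurable
  then have conv: "AE x in M. convergent (\<lambda>k. s (r k) x)"
  proof eventually_elim
    fix x assume "(\<Sum>k. ennreal (2 ^ k * (d k x)\<^sup>2)) \<noteq> \<infinity>"
    then have sm: "summable (\<lambda>k. 2 ^ k * (d k x)\<^sup>2)"
      by (intro summable_suminf_not_top) auto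
    have "summable (\<lambda>k. (1/2) ^ k + 2 ^ k * (d k x)\<^sup>2)"
      by (intro summable_add sm summable_geometric) auto
    then have "summable (\<lambda>k. s (r (Suc k)) x - s (r k) x)"
    proof (rule summable_comparison_test'[of _ 0])
      fix k :: nat
      have "0 \<le> ((1/2) ^ k - d k x)\<^sup>2" by simp
      then have "2 * (1/2)^k * d k x \<le> ((1/2)^k)\<^sup>2 + (d k x)\<^sup>2"
        by (simp add: power2_diff)
      then have "2^k * (2 * (1/2)^k * d k x) \<le> 2^k * (((1/2)^k)\<^sup>2 + (d k x)\<^sup>2)"
        by (intro mult_left_mono) auto
      also have "\<dots> = (1/2)^k + 2^k * (d k x)\<^sup>2"
        by (simp add: distrib_left power2_eq_square power_one_over field_simps)
      also have "2^k * (2 * (1/2)^k * d k x) = 2 * d k x" by (simp add: power_one_over)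
      finally have "2 * d k x \<le> (1/2)^k + 2^k * (d k x)\<^sup>2" .
      moreover have "0 \<le> d k x" "norm (s (r (Suc k)) x - s (r k) x) = d k x" by (simp_all add: d_def)
      ultimately show "norm (s (r (Suc k)) x - s (r k) x) \<le> (1/2) ^ k + 2 ^ k * (d k x)\<^sup>2"
        by linarith
    qed
    then have "convergent (\<lambda>n. \<Sum>k<n. s (r (Suc k)) x - s (r k) x)"
      by (simp add: summable_iff_convergent)
    moreover have "(\<Sum>k<n. s (r (Suc k)) x - s (r k) x) = - s (r 0) x + s (r n) x" for n
      using sum_lessThan_telescope[of "\<lambda>k. s (r k) x" n] by simp
    ultimately show "convergent (\<lambda>k. s (r k) x)"
      by (simp only: convergent_add_const_iff)
  qed
  define f where "f x = lim (\<lambda>k. s (r k) x)" for x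
  have [measurable]: "f \<in> borel_measurable M" unfolding f_def by measurable
  have lim: "AE x in M. (\<lambda>k. s (r k) x) \<longlonglongrightarrow> f x"
    using conv by eventually_elim (simp add: f_def convergent_LIMSEQ_iff)
  have close: "energy M (\<lambda>x. s n x - f x) \<le> ennreal ((1/8) ^ k)" if "n \<ge> N k" for n k
  proof -
    have "energy M (\<lambda>x. s n x - f x) = (\<integral>\<^sup>+x. liminf (\<lambda>j. ennreal ((cmod (s n x - s (r j) x))\<^sup>2)) \<partial>M)"
      unfolding energy_def
    proof (rule nn_integral_cong_AE)
      show "AE x in M. ennreal ((cmod (s n x - f x))\<^sup>2) = liminf (\<lambda>j. ennreal ((cmod (s n x - s (r j) x))\<^sup>2))"
        using lim
      proof eventually_elim
        case (elim x)
        then have "(\<lambda>j. ennreal ((cmod (s n x - s (r j) x))\<^sup>2)) \<longlonglongrightarrow> ennreal ((cmod (s n x - f x))\<^sup>2)"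
          by (intro tendsto_intros)
        then show ?case
          by (intro lim_imp_Liminf[symmetric]) auto
      qed
    qed
    also have "\<dots> \<le> liminf (\<lambda>j. energy M (\<lambda>x. s n x - s (r j) x))"
      unfolding energy_def by (rule nn_integral_liminf) measurable
    also have "\<dots> \<le> ennreal ((1/8) ^ k)"
    proof (rule Liminf_le)
      show "\<forall>\<^sub>F j in sequentially. energy M (\<lambda>x. s n x - s (r j) x) \<le> ennreal ((1/8) ^ k)"
        unfolding eventually_sequentially
        by (rule exI[of _ k]) (use N[of k n] that r_ge in \<open>auto intro!: less_imp_le\<close>)
    qed simp
    finally show ?thesis .
  qed
  have fL2: "f \<in> L2_space M"
  proof -
    have "(\<lambda>x. s (N 0) x - f x) \<in> L2_space M"
      using close[of 0 "N 0"] by (auto simp: L2_space_iff_energy intro: le_less_trans)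
    from L2_space_diff[OF s[of "N 0"] this] show ?thesis by simp
  qed
  have "(\<lambda>n. energy M (\<lambda>x. s n x - f x)) \<longlonglongrightarrow> 0"
  proof (rule order_tendstoI)
    fix e :: ennreal assume "0 < e"
    have "(\<lambda>k. ennreal ((1/8) ^ k)) \<longlonglongrightarrow> ennreal 0"
      by (intro tendsto_ennrealI LIMSEQ_power_zero) auto
    then obtain k where "ennreal ((1/8) ^ k) < e"
      using ennreal_tendsto_0D[of "\<lambda>k. ennreal ((1/8) ^ k)"] \<open>0 < e\<close> by auto
    then show "\<forall>\<^sub>F n in sequentially. energy M (\<lambda>x. s n x - f x) < e"
      unfolding eventually_sequentially using close by (meson le_less_trans)
  qed simp
  then show ?thesis using s fL2 by (auto simp: L2_tendsto_iff_energy)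
qed

section \<open>Gaussian kernels\<close>

lemma borel_measurable_vec_nth [measurable]: "(\<lambda>x::real^'d. x $ i) \<in> borel_measurable borel"
  by (simp add: borel_measurable_continuous_onI continuous_on_component)

lemma cis_measurable [measurable]: "cis \<in> borel_measurable borel"
  by (intro borel_measurable_continuous_onI continuous_intros)

text \<open>
  Lebesgue measure on \<open>\<real>\<^sup>d\<close> is the image of a product measure indexed by the standard basis, so
  the product rule for integrals holds over the coordinates.
\<close>

lemma
  fixes f :: "'d::finite \<Rightarrow> real \<Rightarrow> complex"
  assumes f: "\<And>i. integrable lborel (f i)"
  shows integrable_prod_vec: "integrable lborel (\<lambda>x::real^'d. \<Prod>i\<in>UNIV. f i (x $ i))"
    and integral_prod_vec: "(\<integral>(x::real^'d). (\<Prod>i\<in>UNIV. f i (x $ i)) \<partial>lborel) = (\<Prod>i\<in>UNIV. integral\<^sup>L lborel (f i))"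
proof -
  interpret product_sigma_finite "\<lambda>b::real^'d. lborel :: real measure" ..
  have [measurable]: "f i \<in> borel_measurable borel" for i
    using f[of i] borel_measurable_integrable by auto
  have reindex: "(\<Prod>b\<in>(Basis::(real^'d) set). h (axis_index b)) = (\<Prod>i\<in>UNIV. h i)" for h :: "'d \<Rightarrow> complex"
  proof -
    have B: "(Basis::(real^'d) set) = range (\<lambda>i. axis i 1)"
      by (auto simp: Basis_vec_def)
    have "inj (\<lambda>i::'d. axis i (1::real))" by (auto simp: inj_on_def axis_eq_axis)
    then show ?thesis unfolding B by (subst prod.reindex) (auto simp: axis_index_axis)
  qed
  let ?S = "\<lambda>h. \<Sum>b\<in>(Basis::(real^'d) set). h b *\<^sub>R b"
  have meas: "?S \<in> measurable (\<Pi>\<^sub>M b\<in>Basis. lborel) borel" by measurable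
  have nth: "?S h $ i = h (axis i 1)" for h i
  proof -
    have "?S h $ i = ?S h \<bullet> axis i 1" by (simp add: inner_axis)
    also have "\<dots> = h (axis i 1)" by (rule inner_sum_left_Basis) simp
    finally show ?thesis .
  qed
  have eq: "(\<Prod>i\<in>UNIV. f i (?S h $ i)) = (\<Prod>b\<in>(Basis::(real^'d) set). f (axis_index b) (h b))" for h
  proof -
    have "(\<Prod>b\<in>(Basis::(real^'d) set). f (axis_index b) (h b)) =
        (\<Prod>b\<in>(Basis::(real^'d) set). f (axis_index b) (h (axis (axis_index b) 1)))"
      by (intro prod.cong) (auto simp: Basis_vec_def axis_index_axis)
    then show ?thesis unfolding nth by (simp only: reindex[of "\<lambda>i. f i (h (axis i 1))"])
  qed
  show "integrable lborel (\<lambda>x::real^'d. \<Prod>i\<in>UNIV. f i (x $ i))"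
    unfolding lborel_eq[where 'a="real^'d"]
    by (subst integrable_distr_eq[OF meas]) (measurable, unfold eq, intro product_integrable_prod f finite_Basis)
  show "(\<integral>(x::real^'d). (\<Prod>i\<in>UNIV. f i (x $ i)) \<partial>lborel) = (\<Prod>i\<in>UNIV. integral\<^sup>L lborel (f i))"
    unfolding lborel_eq[where 'a="real^'d"]
    by (subst integral_distr[OF meas])
       (measurable, unfold eq, subst product_integral_prod[OF finite_Basis f], rule reindex)
qed

text \<open>
  The characteristic function of the standard normal distribution, rescaled by
  \<open>z = 2 \<pi> \<delta> u\<close>.
\<close>

lemma
  fixes \<delta> y :: real
  assumes "0 < \<delta>"
  shows integrable_gaussian_1: "integrable lborel (\<lambda>u. complex_of_real (exp (- 2 * pi\<^sup>2 * \<delta>\<^sup>2 * u\<^sup>2)) * cis (2 * pi * (u * y)))"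
    and integral_gaussian_1: "(\<integral>u. complex_of_real (exp (- 2 * pi\<^sup>2 * \<delta>\<^sup>2 * u\<^sup>2)) * cis (2 * pi * (u * y)) \<partial>lborel) =
      complex_of_real (std_normal_density (y / \<delta>) / \<delta>)"
proof -
  define g where "g z = complex_of_real (std_normal_density z) * cis (y / \<delta> * z)" for z
  have sn: "integrable lborel std_normal_density"
    by (simp add: integrable_normal_density)
  have [measurable]: "g \<in> borel_measurable borel" unfolding g_def by measurable
  have gi: "integrable lborel g"
    by (rule Bochner_Integration.integrable_bound[OF integrable_of_real[OF sn, where 'a=complex]])
       (auto simp: g_def norm_mult)
  have "complex_of_real (exp (- ((y / \<delta>)\<^sup>2) / 2)) = char std_normal_distribution (y / \<delta>)"
    by (simp add: char_std_normal_distribution)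
  also have "\<dots> = (\<integral>z. std_normal_density z *\<^sub>R iexp (y / \<delta> * z) \<partial>lborel)"
    unfolding char_def by (subst integral_density) (auto simp: normal_density_nonneg)
  also have "\<dots> = (\<integral>z. g z \<partial>lborel)"
    by (intro Bochner_Integration.integral_cong refl) (simp add: g_def scaleR_conv_of_real cis_conv_exp)
  also have "\<dots> = \<bar>2 * pi * \<delta>\<bar> *\<^sub>R (\<integral>u. g (0 + 2 * pi * \<delta> * u) \<partial>lborel)"
    using assms by (intro lborel_integral_real_affine) auto
  finally have 1: "complex_of_real (exp (- ((y / \<delta>)\<^sup>2) / 2)) = \<bar>2 * pi * \<delta>\<bar> *\<^sub>R (\<integral>u. g (0 + 2 * pi * \<delta> * u) \<partial>lborel)" .
  have 2: "g (0 + 2 * pi * \<delta> * u) = complex_of_real (1 / sqrt (2 * pi)) *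
      (complex_of_real (exp (- 2 * pi\<^sup>2 * \<delta>\<^sup>2 * u\<^sup>2)) * cis (2 * pi * (u * y)))" for u
    using assms by (simp add: g_def std_normal_density_def power_mult_distrib field_simps)
  have "integrable lborel (\<lambda>u. g (0 + 2 * pi * \<delta> * u))"
    using assms by (intro lborel_integrable_real_affine gi) auto
  then have "integrable lborel (\<lambda>u. complex_of_real (sqrt (2 * pi)) * g (0 + 2 * pi * \<delta> * u))"
    by (intro integrable_mult_right)
  moreover have "complex_of_real (sqrt (2 * pi)) * g (0 + 2 * pi * \<delta> * u) =
      complex_of_real (exp (- 2 * pi\<^sup>2 * \<delta>\<^sup>2 * u\<^sup>2)) * cis (2 * pi * (u * y))" for u
  proof -
    have "complex_of_real (sqrt (2 * pi)) * complex_of_real (1 / sqrt (2 * pi)) = 1"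
      by (subst of_real_mult[symmetric]) simp
    then show ?thesis unfolding 2 by (simp only: mult.assoc[symmetric]) simp
  qed
  ultimately show "integrable lborel (\<lambda>u. complex_of_real (exp (- 2 * pi\<^sup>2 * \<delta>\<^sup>2 * u\<^sup>2)) * cis (2 * pi * (u * y)))"
    by (simp only:)
  have "complex_of_real (exp (- ((y / \<delta>)\<^sup>2) / 2)) = complex_of_real (2 * pi * \<delta> / sqrt (2 * pi)) *
      (\<integral>u. complex_of_real (exp (- 2 * pi\<^sup>2 * \<delta>\<^sup>2 * u\<^sup>2)) * cis (2 * pi * (u * y)) \<partial>lborel)"
    unfolding 1 2 integral_mult_right_zero using assms by (simp add: scaleR_conv_of_real)
  moreover have "complex_of_real (2 * pi * \<delta> / sqrt (2 * pi)) \<noteq> 0" using assms by simp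
  ultimately have "(\<integral>u. complex_of_real (exp (- 2 * pi\<^sup>2 * \<delta>\<^sup>2 * u\<^sup>2)) * cis (2 * pi * (u * y)) \<partial>lborel) =
      complex_of_real (exp (- ((y / \<delta>)\<^sup>2) / 2)) / complex_of_real (2 * pi * \<delta> / sqrt (2 * pi))"
    by (simp add: field_simps)
  also have "\<dots> = complex_of_real (exp (- ((y / \<delta>)\<^sup>2) / 2) / (2 * pi * \<delta> / sqrt (2 * pi)))"
    by simp
  also have "exp (- ((y / \<delta>)\<^sup>2) / 2) / (2 * pi * \<delta> / sqrt (2 * pi)) = std_normal_density (y / \<delta>) / \<delta>"
  proof -
    have "2 * pi / sqrt (2 * pi) = sqrt (2 * pi)" by (rule real_div_sqrt) simp
    then have "2 * pi * \<delta> / sqrt (2 * pi) = sqrt (2 * pi) * \<delta>" by (simp add: field_simps)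
    then show ?thesis by (simp only: std_normal_density_def) simp
  qed
  finally show "(\<integral>u. complex_of_real (exp (- 2 * pi\<^sup>2 * \<delta>\<^sup>2 * u\<^sup>2)) * cis (2 * pi * (u * y)) \<partial>lborel) =
      complex_of_real (std_normal_density (y / \<delta>) / \<delta>)" .
qed

text \<open>
  The weight \<open>gauss_weight \<delta>\<close> tends to 1 as \<open>\<delta> \<rightarrow> 0\<close>, and its Fourier transform
  \<open>gauss_kernel \<delta>\<close> is a product of normal densities of standard deviation \<open>\<delta>\<close>: multiplying a
  Fourier transform by the weight amounts to averaging the function on the scale \<open>\<delta>\<close>.
\<close>

definition gauss_weight :: "real \<Rightarrow> real ^ 'd \<Rightarrow> real" where
  "gauss_weight \<delta> \<omega> = exp (- 2 * pi\<^sup>2 * \<delta>\<^sup>2 * (\<omega> \<bullet> \<omega>))"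

definition gauss_kernel :: "real \<Rightarrow> real ^ 'd \<Rightarrow> real" where
  "gauss_kernel \<delta> y = (\<Prod>i\<in>UNIV. std_normal_density (y $ i / \<delta>) / \<delta>)"

lemma gauss_weight_measurable [measurable]: "gauss_weight \<delta> \<in> borel_measurable borel"
  unfolding gauss_weight_def by measurable

lemma gauss_kernel_measurable [measurable]: "gauss_kernel \<delta> \<in> borel_measurable borel"
  unfolding gauss_kernel_def by measurable

lemma gauss_weight_pos: "0 < gauss_weight \<delta> \<omega>" and gauss_weight_le_1: "gauss_weight \<delta> \<omega> \<le> 1"
  by (simp_all add: gauss_weight_def)

lemma gauss_kernel_nonneg: "0 < \<delta> \<Longrightarrow> 0 \<le> gauss_kernel \<delta> y"
  by (auto simp: gauss_kernel_def intro!: prod_nonneg normal_density_nonneg)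

lemma
  fixes y :: "real ^ 'd"
  assumes "0 < \<delta>"
  shows integrable_gauss_weight_cis: "integrable lborel (\<lambda>\<omega>::real^'d. complex_of_real (gauss_weight \<delta> \<omega>) * cis (2 * pi * (\<omega> \<bullet> y)))"
    and integral_gauss_weight_cis: "(\<integral>(\<omega>::real^'d). complex_of_real (gauss_weight \<delta> \<omega>) * cis (2 * pi * (\<omega> \<bullet> y)) \<partial>lborel) =
       complex_of_real (gauss_kernel \<delta> y)"
proof -
  have cis_sum: "cis (\<Sum>i\<in>A. h i) = (\<Prod>i\<in>A. cis (h i))" if "finite A" for A :: "'d set" and h
    using that by (induction A) (auto simp: cis_mult[symmetric])
  have eq: "complex_of_real (gauss_weight \<delta> \<omega>) * cis (2 * pi * (\<omega> \<bullet> y)) =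
    (\<Prod>i\<in>UNIV. complex_of_real (exp (- 2 * pi\<^sup>2 * \<delta>\<^sup>2 * (\<omega> $ i)\<^sup>2)) * cis (2 * pi * (\<omega> $ i * y $ i)))" for \<omega> :: "real^'d"
  proof -
    have "gauss_weight \<delta> \<omega> = (\<Prod>i\<in>UNIV. exp (- 2 * pi\<^sup>2 * \<delta>\<^sup>2 * (\<omega> $ i)\<^sup>2))"
      unfolding gauss_weight_def inner_vec_def
      by (subst exp_sum[symmetric]) (auto simp: sum_distrib_left power2_eq_square)
    moreover have "cis (2 * pi * (\<omega> \<bullet> y)) = (\<Prod>i\<in>UNIV. cis (2 * pi * (\<omega> $ i * y $ i)))"
      unfolding inner_vec_def by (subst cis_sum[symmetric]) (auto simp: sum_distrib_left)
    ultimately show ?thesis by (simp add: prod.distrib)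
  qed
  show "integrable lborel (\<lambda>\<omega>::real^'d. complex_of_real (gauss_weight \<delta> \<omega>) * cis (2 * pi * (\<omega> \<bullet> y)))"
    unfolding eq using integrable_prod_vec[of "\<lambda>i u. complex_of_real (exp (- 2 * pi\<^sup>2 * \<delta>\<^sup>2 * u\<^sup>2)) * cis (2 * pi * (u * y $ i))"]
      integrable_gaussian_1[OF assms] by simp
  show "(\<integral>(\<omega>::real^'d). complex_of_real (gauss_weight \<delta> \<omega>) * cis (2 * pi * (\<omega> \<bullet> y)) \<partial>lborel) =
       complex_of_real (gauss_kernel \<delta> y)"
    unfolding eq using integral_prod_vec[of "\<lambda>i u. complex_of_real (exp (- 2 * pi\<^sup>2 * \<delta>\<^sup>2 * u\<^sup>2)) * cis (2 * pi * (u * y $ i))"]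
      integrable_gaussian_1[OF assms]
    unfolding integral_gaussian_1[OF assms] gauss_kernel_def of_real_prod .
qed

lemma integrable_gauss_weight: "0 < \<delta> \<Longrightarrow> integrable lborel (gauss_weight \<delta> :: real^'d \<Rightarrow> real)"
  using integrable_gauss_weight_cis[of \<delta> "0::real^'d"] complex_of_real_integrable_eq[of lborel "gauss_weight \<delta> :: real^'d \<Rightarrow> real"] by simp

lemma gauss_kernel_minus: "gauss_kernel \<delta> (- y) = gauss_kernel \<delta> y"
  by (simp add: gauss_kernel_def normal_density_def)

lemma nn_integral_gauss_kernel_1: "(\<integral>\<^sup>+y. ennreal (gauss_kernel 1 (y::real^'d)) \<partial>lborel) = 1"
proof -
  have sn: "integrable lborel (\<lambda>u. complex_of_real (std_normal_density u))"
    by (intro integrable_of_real) (simp add: integrable_normal_density)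
  have int: "integrable lborel (\<lambda>y::real^'d. complex_of_real (gauss_kernel 1 y))"
    using integrable_prod_vec[of "\<lambda>(i::'d) u. complex_of_real (std_normal_density u)"] sn
    by (simp add: gauss_kernel_def)
  have "(\<integral>(y::real^'d). complex_of_real (gauss_kernel 1 y) \<partial>lborel) = 1"
    using integral_prod_vec[of "\<lambda>(i::'d) u. complex_of_real (std_normal_density u)"] sn
    by (simp add: gauss_kernel_def)
  then have "(\<integral>(y::real^'d). gauss_kernel 1 y \<partial>lborel) = 1"
    by (simp only: integral_complex_of_real) (simp only: of_real_eq_1_iff)
  moreover have "integrable lborel (gauss_kernel 1 :: real^'d \<Rightarrow> real)"
    using int by (simp only: complex_of_real_integrable_eq)
  ultimately show ?thesis
    by (subst nn_integral_eq_integral) (auto simp: gauss_kernel_nonneg)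
qed

lemma gauss_kernel_scale:
  assumes "0 < \<delta>" shows "gauss_kernel \<delta> (\<delta> *\<^sub>R z :: real^'d) = gauss_kernel 1 z / \<delta> ^ CARD('d)"
  using assms by (simp add: gauss_kernel_def prod_dividef)

text \<open>
  All kernels are dilations of one probability density; after this substitution the scale
  \<open>\<delta>\<close> appears only in the argument of \<open>h\<close>, where the limit \<open>\<delta> \<rightarrow> 0\<close> is dominated.
\<close>

lemma nn_integral_gauss_kernel_substitution:
  fixes h :: "real^'d \<Rightarrow> ennreal"
  assumes "0 < \<delta>" and [measurable]: "h \<in> borel_measurable borel"
  shows "(\<integral>\<^sup>+y. h y * ennreal (gauss_kernel \<delta> (x - y)) \<partial>lborel) =
         (\<integral>\<^sup>+z. h (x + \<delta> *\<^sub>R z) * ennreal (gauss_kernel 1 z) \<partial>lborel)"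
proof -
  have *: "lborel = density (distr lborel borel (\<lambda>z::real^'d. x + \<delta> *\<^sub>R z)) (\<lambda>_. \<delta> ^ CARD('d))"
    using lborel_affine[of \<delta> x] assms(1) by simp
  have "(\<integral>\<^sup>+y. h y * ennreal (gauss_kernel \<delta> (x - y)) \<partial>lborel) =
     (\<integral>\<^sup>+z. ennreal (\<delta> ^ CARD('d)) * (h (x + \<delta> *\<^sub>R z) * ennreal (gauss_kernel \<delta> (x - (x + \<delta> *\<^sub>R z)))) \<partial>lborel)"
    by (subst *, subst nn_integral_density) (measurable, subst nn_integral_distr, measurable)
  also have "\<dots> = (\<integral>\<^sup>+z. h (x + \<delta> *\<^sub>R z) * ennreal (gauss_kernel 1 z) \<partial>lborel)"
  proof (intro nn_integral_cong)
    fix z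
    have "gauss_kernel \<delta> (x - (x + \<delta> *\<^sub>R z)) = gauss_kernel 1 z / \<delta> ^ CARD('d)"
      using gauss_kernel_minus[of \<delta> "\<delta> *\<^sub>R z"] gauss_kernel_scale[OF assms(1), of z] by simp
    then have "ennreal (gauss_kernel 1 z) = ennreal (\<delta> ^ CARD('d)) * ennreal (gauss_kernel \<delta> (x - (x + \<delta> *\<^sub>R z)))"
      using assms(1) gauss_kernel_nonneg[of 1 z] by (subst ennreal_mult[symmetric]) auto
    then show "ennreal (\<delta> ^ CARD('d)) * (h (x + \<delta> *\<^sub>R z) * ennreal (gauss_kernel \<delta> (x - (x + \<delta> *\<^sub>R z)))) =
        h (x + \<delta> *\<^sub>R z) * ennreal (gauss_kernel 1 z)"
      by (simp add: mult_ac)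
  qed
  finally show ?thesis .
qed

lemma nn_integral_gauss_kernel:
  assumes "0 < \<delta>" shows "(\<integral>\<^sup>+y. ennreal (gauss_kernel \<delta> (x - y :: real^'d)) \<partial>lborel) = 1"
  using nn_integral_gauss_kernel_substitution[OF assms, of "\<lambda>_. 1" x] by (simp add: nn_integral_gauss_kernel_1)

section \<open>The Plancherel inequality\<close>

lemma cnj_measurable [measurable]: "cnj \<in> borel_measurable borel"
  by (intro borel_measurable_continuous_onI continuous_intros)

lemma integrable_pair_bounded_mult:
  fixes p q :: "'a::euclidean_space \<Rightarrow> complex" and c :: "'a \<times> 'a \<Rightarrow> complex"
  assumes p: "integrable lborel p" and q: "integrable lborel q"
    and c [measurable]: "c \<in> borel_measurable (lborel \<Otimes>\<^sub>M lborel)" and B: "\<And>z. cmod (c z) \<le> B"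
  shows "integrable (lborel \<Otimes>\<^sub>M lborel) (\<lambda>(x, y). p x * q y * c (x, y))"
proof -
  have [measurable]: "p \<in> borel_measurable lborel" "q \<in> borel_measurable lborel"
    using p q by (auto dest: borel_measurable_integrable)
  have "integrable (lborel \<Otimes>\<^sub>M lborel) (\<lambda>z. p (fst z) * q (snd z))"
  proof (rule lborel_pair.Fubini_integrable)
    show "(\<lambda>z. p (fst z) * q (snd z)) \<in> borel_measurable (lborel \<Otimes>\<^sub>M lborel)" by measurable
    show "integrable lborel (\<lambda>x. \<integral>y. norm (p (fst (x, y)) * q (snd (x, y))) \<partial>lborel)"
      using p by (simp add: norm_mult)
    show "AE x in lborel. integrable lborel (\<lambda>y. p (fst (x, y)) * q (snd (x, y)))"
      using q by simp
  qed
  then have "integrable (lborel \<Otimes>\<^sub>M lborel) (\<lambda>z. complex_of_real B * (p (fst z) * q (snd z)))"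
    by (rule integrable_mult_right)
  then show ?thesis
  proof (rule Bochner_Integration.integrable_bound)
    show "AE z in lborel \<Otimes>\<^sub>M lborel. norm (case z of (x, y) \<Rightarrow> p x * q y * c (x, y))
        \<le> norm (complex_of_real B * (p (fst z) * q (snd z)))"
    proof (rule AE_I2)
      fix z
      have "cmod (c z) \<le> \<bar>B\<bar>" using B[of z] by linarith
      then have "cmod (c z) * (cmod (p (fst z)) * cmod (q (snd z))) \<le> \<bar>B\<bar> * (cmod (p (fst z)) * cmod (q (snd z)))"
        by (intro mult_right_mono) auto
      then show "norm (case z of (x, y) \<Rightarrow> p x * q y * c (x, y)) \<le> norm (complex_of_real B * (p (fst z) * q (snd z)))"
        by (simp add: case_prod_beta norm_mult mult_ac)
    qed
  qed (simp add: case_prod_beta)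
qed

lemma Fubini_bounded_mult:
  fixes p q :: "'a::euclidean_space \<Rightarrow> complex" and c :: "'a \<times> 'a \<Rightarrow> complex"
  assumes "integrable lborel p" "integrable lborel q"
    "c \<in> borel_measurable (lborel \<Otimes>\<^sub>M lborel)" "\<And>z. cmod (c z) \<le> B"
  shows "(\<integral>y. (\<integral>x. p x * q y * c (x, y) \<partial>lborel) \<partial>lborel) = (\<integral>x. (\<integral>y. p x * q y * c (x, y) \<partial>lborel) \<partial>lborel)"
  by (rule lborel_pair.Fubini_integral) (rule integrable_pair_bounded_mult[OF assms])

text \<open>
  \<open>fourier_integral\<close> taken with respect to the uncompleted measure, for which Fubini's theorem
  is available.
\<close>

definition ft :: "(real^'d \<Rightarrow> complex) \<Rightarrow> real^'d \<Rightarrow> complex" where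
  "ft f \<omega> = (\<integral>x. f x * cis (- (2 * pi * (\<omega> \<bullet> x))) \<partial>lborel)"

lemma ft_measurable [measurable]:
  assumes [measurable]: "f \<in> borel_measurable lborel"
  shows "ft f \<in> borel_measurable borel"
proof -
  have "(\<lambda>\<omega>::real^'a. \<integral>x. (\<lambda>(\<omega>, x). f x * cis (- (2 * pi * (\<omega> \<bullet> x)))) (\<omega>, x) \<partial>lborel) \<in> borel_measurable borel"
    by (intro lborel.borel_measurable_lebesgue_integral) measurable
  then show ?thesis unfolding ft_def[abs_def] by simp
qed

lemma integrable_times_cis:
  assumes "integrable lborel f"
    and [measurable]: "t \<in> borel_measurable lborel"
  shows "integrable lborel (\<lambda>x. f x * cis (t x))"
  by (rule Bochner_Integration.integrable_bound[OF assms(1)])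
     (use borel_measurable_integrable[OF assms(1)] in \<open>auto simp: norm_mult\<close>)

lemma norm_ft_le: "cmod (ft f \<omega>) \<le> (\<integral>x. cmod (f x) \<partial>lborel)"
  unfolding ft_def by (rule order_trans[OF integral_norm_bound]) (simp add: norm_mult)

lemma integrable_gauss_weight_ft:
  assumes "0 < \<delta>" "integrable lborel (f :: real^'d \<Rightarrow> complex)"
  shows "integrable lborel (\<lambda>\<omega>. complex_of_real (gauss_weight \<delta> \<omega>) * ft f \<omega>)"
proof -
  have [measurable]: "f \<in> borel_measurable lborel" using assms by auto
  have "integrable lborel (\<lambda>\<omega>. (\<integral>x. cmod (f x) \<partial>lborel) * gauss_weight \<delta> \<omega>)"
    using integrable_gauss_weight[OF assms(1)] by (rule integrable_mult_right)
  then show ?thesis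
  proof (rule Bochner_Integration.integrable_bound)
    have "cmod (complex_of_real (gauss_weight \<delta> \<omega>) * ft f \<omega>) \<le> norm ((\<integral>x. cmod (f x) \<partial>lborel) * gauss_weight \<delta> \<omega>)" for \<omega>
    proof -
      have "cmod (complex_of_real (gauss_weight \<delta> \<omega>) * ft f \<omega>) = gauss_weight \<delta> \<omega> * cmod (ft f \<omega>)"
        using gauss_weight_pos[of \<delta> \<omega>] by (simp add: norm_mult)
      also have "\<dots> \<le> gauss_weight \<delta> \<omega> * (\<integral>x. cmod (f x) \<partial>lborel)"
        using gauss_weight_pos[of \<delta> \<omega>] norm_ft_le[of f \<omega>] by (intro mult_left_mono) auto
      also have "\<dots> \<le> norm ((\<integral>x. cmod (f x) \<partial>lborel) * gauss_weight \<delta> \<omega>)"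
        by (simp add: mult.commute)
      finally show ?thesis .
    qed
    then show "AE \<omega> in lborel. norm (complex_of_real (gauss_weight \<delta> \<omega>) * ft f \<omega>)
        \<le> norm ((\<integral>x. cmod (f x) \<partial>lborel) * gauss_weight \<delta> \<omega>)" by simp
  qed simp
qed

text \<open>
  The damped inversion integral is an average of \<open>f\<close>: the damping makes the double integral
  absolutely convergent, and the inner integral is the transform of the Gaussian weight.
\<close>

lemma ft_gauss_weight_ft:
  assumes "0 < \<delta>" and f: "integrable lborel (f :: real^'d \<Rightarrow> complex)"
  shows "(\<integral>\<omega>. complex_of_real (gauss_weight \<delta> \<omega>) * ft f \<omega> * cis (2 * pi * (\<omega> \<bullet> x)) \<partial>lborel) =
         (\<integral>y. f y * complex_of_real (gauss_kernel \<delta> (x - y)) \<partial>lborel)"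
proof -
  let ?W = "\<lambda>\<omega>::real^'d. complex_of_real (gauss_weight \<delta> \<omega>)"
  let ?c = "\<lambda>(\<omega>, y). cis (2 * pi * (\<omega> \<bullet> (x - y)))"
  have W: "integrable lborel ?W"
    using integrable_gauss_weight[OF assms(1)] by (rule integrable_of_real)
  have "(\<integral>\<omega>. ?W \<omega> * ft f \<omega> * cis (2 * pi * (\<omega> \<bullet> x)) \<partial>lborel) = (\<integral>\<omega>. (\<integral>y. ?W \<omega> * f y * ?c (\<omega>, y) \<partial>lborel) \<partial>lborel)"
  proof (intro Bochner_Integration.integral_cong refl)
    fix \<omega>
    have "?W \<omega> * ft f \<omega> * cis (2 * pi * (\<omega> \<bullet> x)) =
        (?W \<omega> * cis (2 * pi * (\<omega> \<bullet> x))) * (\<integral>y. f y * cis (- (2 * pi * (\<omega> \<bullet> y))) \<partial>lborel)"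
      unfolding ft_def by (simp add: mult_ac)
    also have "\<dots> = (\<integral>y. (?W \<omega> * cis (2 * pi * (\<omega> \<bullet> x))) * (f y * cis (- (2 * pi * (\<omega> \<bullet> y)))) \<partial>lborel)"
      by (simp only: integral_mult_right_zero)
    also have "\<dots> = (\<integral>y. ?W \<omega> * f y * ?c (\<omega>, y) \<partial>lborel)"
    proof (intro Bochner_Integration.integral_cong refl)
      fix y
      have "cis (2 * pi * (\<omega> \<bullet> x)) * cis (- (2 * pi * (\<omega> \<bullet> y))) = ?c (\<omega>, y)"
        by (simp add: cis_mult inner_diff_right right_diff_distrib)
      then show "(?W \<omega> * cis (2 * pi * (\<omega> \<bullet> x))) * (f y * cis (- (2 * pi * (\<omega> \<bullet> y)))) = ?W \<omega> * f y * ?c (\<omega>, y)"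
        by (metis mult.assoc mult.left_commute)
    qed
    finally show "?W \<omega> * ft f \<omega> * cis (2 * pi * (\<omega> \<bullet> x)) = (\<integral>y. ?W \<omega> * f y * ?c (\<omega>, y) \<partial>lborel)" .
  qed
  also have "\<dots> = (\<integral>y. (\<integral>\<omega>. ?W \<omega> * f y * ?c (\<omega>, y) \<partial>lborel) \<partial>lborel)"
    by (rule Fubini_bounded_mult[symmetric, where B=1]) (use W f in \<open>auto simp: case_prod_beta\<close>)
  also have "\<dots> = (\<integral>y. f y * complex_of_real (gauss_kernel \<delta> (x - y)) \<partial>lborel)"
  proof (intro Bochner_Integration.integral_cong refl)
    fix y
    have "(\<integral>\<omega>. ?W \<omega> * f y * ?c (\<omega>, y) \<partial>lborel) = (\<integral>\<omega>. f y * (?W \<omega> * cis (2 * pi * (\<omega> \<bullet> (x - y)))) \<partial>lborel)"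
      by (intro Bochner_Integration.integral_cong refl) (simp add: mult_ac)
    also have "\<dots> = f y * complex_of_real (gauss_kernel \<delta> (x - y))"
      by (simp only: integral_mult_right_zero integral_gauss_weight_cis[OF assms(1)])
    finally show "(\<integral>\<omega>. ?W \<omega> * f y * ?c (\<omega>, y) \<partial>lborel) = f y * complex_of_real (gauss_kernel \<delta> (x - y))" .
  qed
  finally show ?thesis .
qed

lemma norm_integral_le_nn_integral:
  fixes f :: "'a \<Rightarrow> complex"
  shows "ennreal (cmod (\<integral>x. f x \<partial>M)) \<le> (\<integral>\<^sup>+x. ennreal (cmod (f x)) \<partial>M)"
  by (cases "integrable M f") (auto intro: integral_norm_bound_ennreal simp: not_integrable_integral_eq)

text \<open>
  Since \<open>2 |f x| |f y| \<le> |f x|\<^sup>2 + |f y|\<^sup>2\<close> and the kernel has mass 1 in each variable.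
\<close>

lemma nn_integral_kernel_young:
  assumes "0 < \<delta>" and [measurable]: "f \<in> borel_measurable borel"
  shows "(\<integral>\<^sup>+x. (\<integral>\<^sup>+y. ennreal (cmod (f x) * cmod (f y) * gauss_kernel \<delta> (x - y :: real^'d)) \<partial>lborel) \<partial>lborel) \<le> energy lborel f"
proof -
  let ?K = "gauss_kernel \<delta> :: real^'d \<Rightarrow> real"
  let ?q = "\<lambda>x. ennreal ((cmod (f x))\<^sup>2)"
  have K: "0 \<le> ?K z" for z by (rule gauss_kernel_nonneg[OF assms(1)])
  have "2 * (\<integral>\<^sup>+x. (\<integral>\<^sup>+y. ennreal (cmod (f x) * cmod (f y) * ?K (x - y)) \<partial>lborel) \<partial>lborel)
      = (\<integral>\<^sup>+x. (\<integral>\<^sup>+y. 2 * ennreal (cmod (f x) * cmod (f y) * ?K (x - y)) \<partial>lborel) \<partial>lborel)"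
    by (simp add: nn_integral_cmult)
  also have "\<dots> \<le> (\<integral>\<^sup>+x. (\<integral>\<^sup>+y. ?q x * ennreal (?K (x - y)) + ?q y * ennreal (?K (x - y)) \<partial>lborel) \<partial>lborel)"
  proof (intro nn_integral_mono)
    fix x y
    have "2 * (cmod (f x) * cmod (f y)) \<le> (cmod (f x))\<^sup>2 + (cmod (f y))\<^sup>2"
      using sum_squares_bound[of "cmod (f x)" "cmod (f y)"] by (simp add: mult.assoc)
    then have "2 * (cmod (f x) * cmod (f y)) * ?K (x - y) \<le> ((cmod (f x))\<^sup>2 + (cmod (f y))\<^sup>2) * ?K (x - y)"
      by (intro mult_right_mono K)
    then have "ennreal (2 * (cmod (f x) * cmod (f y) * ?K (x - y))) \<le>
        ennreal ((cmod (f x))\<^sup>2 * ?K (x - y) + (cmod (f y))\<^sup>2 * ?K (x - y))"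
      by (intro ennreal_leI) (simp add: algebra_simps)
    then show "2 * ennreal (cmod (f x) * cmod (f y) * ?K (x - y)) \<le> ?q x * ennreal (?K (x - y)) + ?q y * ennreal (?K (x - y))"
      using K by (simp add: ennreal_mult ennreal_plus)
  qed
  also have "\<dots> = (\<integral>\<^sup>+x. (\<integral>\<^sup>+y. ?q x * ennreal (?K (x - y)) \<partial>lborel) + (\<integral>\<^sup>+y. ?q y * ennreal (?K (x - y)) \<partial>lborel) \<partial>lborel)"
    by (intro nn_integral_cong nn_integral_add) measurable
  also have "\<dots> = (\<integral>\<^sup>+x. (\<integral>\<^sup>+y. ?q x * ennreal (?K (x - y)) \<partial>lborel) \<partial>lborel) + (\<integral>\<^sup>+x. (\<integral>\<^sup>+y. ?q y * ennreal (?K (x - y)) \<partial>lborel) \<partial>lborel)"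
    by (intro nn_integral_add) measurable
  also have "(\<integral>\<^sup>+x. (\<integral>\<^sup>+y. ?q x * ennreal (?K (x - y)) \<partial>lborel) \<partial>lborel) = energy lborel f"
    by (simp add: nn_integral_cmult nn_integral_gauss_kernel[OF assms(1)] energy_def)
  also have "(\<integral>\<^sup>+x. (\<integral>\<^sup>+y. ?q y * ennreal (?K (x - y)) \<partial>lborel) \<partial>lborel) = (\<integral>\<^sup>+y. (\<integral>\<^sup>+x. ?q y * ennreal (?K (x - y)) \<partial>lborel) \<partial>lborel)"
    by (rule lborel_pair.Fubini'[symmetric]) measurable
  also have "\<dots> = (\<integral>\<^sup>+y. (\<integral>\<^sup>+x. ?q y * ennreal (?K (y - x)) \<partial>lborel) \<partial>lborel)"
  proof (intro nn_integral_cong)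
    fix x y :: "real^'d"
    show "?q y * ennreal (?K (x - y)) = ?q y * ennreal (?K (y - x))"
      using gauss_kernel_minus[of \<delta> "x - y"] by simp
  qed
  also have "\<dots> = energy lborel f"
    by (simp add: nn_integral_cmult nn_integral_gauss_kernel[OF assms(1)] energy_def)
  finally have "2 * (\<integral>\<^sup>+x. (\<integral>\<^sup>+y. ennreal (cmod (f x) * cmod (f y) * ?K (x - y)) \<partial>lborel) \<partial>lborel) \<le> 2 * energy lborel f"
    by (simp add: mult_2)
  then show ?thesis by (simp add: ennreal_mult_le_mult_iff)
qed

text \<open>
  By Fubini, the damped energy of the transform is the inner product of \<open>f\<close> with its own average
  by the kernel.
\<close>

lemma energy_ft_gauss_le:
  assumes "0 < \<delta>" and f: "integrable lborel (f :: real^'d \<Rightarrow> complex)"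
  shows "(\<integral>\<^sup>+\<omega>. ennreal (gauss_weight \<delta> \<omega> * (cmod (ft f \<omega>))\<^sup>2) \<partial>lborel) \<le> energy lborel f"
proof -
  have fm [measurable]: "f \<in> borel_measurable borel" using f by auto
  let ?W = "\<lambda>\<omega>::real^'d. complex_of_real (gauss_weight \<delta> \<omega>)"
  let ?p = "\<lambda>\<omega>. ?W \<omega> * ft f \<omega>"
  let ?c = "\<lambda>(\<omega>, x). cis (2 * pi * (\<omega> \<bullet> x)) :: complex"
  have p: "integrable lborel ?p" by (rule integrable_gauss_weight_ft[OF assms])
  have q: "integrable lborel (\<lambda>x. cnj (f x))" using f by simp
  have cnj_ft: "cnj (ft f \<omega>) = (\<integral>x. cnj (f x) * cis (2 * pi * (\<omega> \<bullet> x)) \<partial>lborel)" for \<omega>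
  proof -
    have "cnj (ft f \<omega>) = (\<integral>x. cnj (f x * cis (- (2 * pi * (\<omega> \<bullet> x)))) \<partial>lborel)"
      unfolding ft_def by (rule Bochner_Integration.integral_cnj[symmetric])
    then show ?thesis by (simp only: complex_cnj_mult cis_cnj minus_minus)
  qed
  have sq: "?p \<omega> * cnj (ft f \<omega>) = complex_of_real (gauss_weight \<delta> \<omega> * (cmod (ft f \<omega>))\<^sup>2)" for \<omega>
    by (simp only: mult.assoc complex_norm_square[symmetric] of_real_mult)
  have int: "integrable lborel (\<lambda>\<omega>. ?p \<omega> * cnj (ft f \<omega>))"
  proof (rule Bochner_Integration.integrable_bound)
    show "integrable lborel (\<lambda>\<omega>. complex_of_real (\<integral>x. cmod (f x) \<partial>lborel) * ?p \<omega>)"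
      by (rule integrable_mult_right) (rule p)
    have "cmod (?p \<omega> * cnj (ft f \<omega>)) \<le> cmod (complex_of_real (\<integral>x. cmod (f x) \<partial>lborel) * ?p \<omega>)" for \<omega>
    proof -
      have "cmod (ft f \<omega>) \<le> \<bar>\<integral>x. cmod (f x) \<partial>lborel\<bar>" using norm_ft_le[of f \<omega>] by linarith
      then have "cmod (?p \<omega>) * cmod (ft f \<omega>) \<le> cmod (?p \<omega>) * \<bar>\<integral>x. cmod (f x) \<partial>lborel\<bar>"
        by (rule mult_left_mono) simp
      then show ?thesis by (simp only: norm_mult complex_mod_cnj norm_of_real mult_ac)
    qed
    then show "AE \<omega> in lborel. norm (?p \<omega> * cnj (ft f \<omega>)) \<le> norm (complex_of_real (\<integral>x. cmod (f x) \<partial>lborel) * ?p \<omega>)"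
      by simp
  qed measurable
  have "(\<integral>\<omega>. ?p \<omega> * cnj (ft f \<omega>) \<partial>lborel) = (\<integral>\<omega>. (\<integral>x. ?p \<omega> * cnj (f x) * ?c (\<omega>, x) \<partial>lborel) \<partial>lborel)"
    unfolding cnj_ft integral_mult_right_zero[symmetric] by (simp add: mult.assoc)
  also have "\<dots> = (\<integral>x. (\<integral>\<omega>. ?p \<omega> * cnj (f x) * ?c (\<omega>, x) \<partial>lborel) \<partial>lborel)"
    by (rule Fubini_bounded_mult[symmetric, where B=1]) (use p q in \<open>auto simp: case_prod_beta\<close>)
  also have "\<dots> = (\<integral>x. cnj (f x) * (\<integral>y. f y * complex_of_real (gauss_kernel \<delta> (x - y)) \<partial>lborel) \<partial>lborel)"
    unfolding ft_gauss_weight_ft[OF assms, symmetric] integral_mult_right_zero[symmetric] by (simp add: mult_ac)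
  finally have eq: "(\<integral>\<omega>. ?p \<omega> * cnj (ft f \<omega>) \<partial>lborel) = (\<integral>x. cnj (f x) * (\<integral>y. f y * complex_of_real (gauss_kernel \<delta> (x - y)) \<partial>lborel) \<partial>lborel)" .
  have intr: "integrable lborel (\<lambda>\<omega>. gauss_weight \<delta> \<omega> * (cmod (ft f \<omega>))\<^sup>2)"
    using int unfolding sq complex_of_real_integrable_eq .
  have nn: "0 \<le> gauss_weight \<delta> \<omega> * (cmod (ft f \<omega>))\<^sup>2" for \<omega>
    using gauss_weight_pos[of \<delta> \<omega>] by (intro mult_nonneg_nonneg) auto
  have "(\<integral>\<^sup>+\<omega>. ennreal (gauss_weight \<delta> \<omega> * (cmod (ft f \<omega>))\<^sup>2) \<partial>lborel) = ennreal (\<integral>\<omega>. gauss_weight \<delta> \<omega> * (cmod (ft f \<omega>))\<^sup>2 \<partial>lborel)"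
    using intr nn by (intro nn_integral_eq_integral) auto
  also have "\<dots> \<le> ennreal (cmod (\<integral>\<omega>. ?p \<omega> * cnj (ft f \<omega>) \<partial>lborel))"
    unfolding sq integral_complex_of_real by (rule ennreal_leI) simp
  also have "\<dots> \<le> (\<integral>\<^sup>+x. ennreal (cmod (cnj (f x) * (\<integral>y. f y * complex_of_real (gauss_kernel \<delta> (x - y)) \<partial>lborel))) \<partial>lborel)"
    unfolding eq by (rule norm_integral_le_nn_integral)
  also have "\<dots> \<le> (\<integral>\<^sup>+x. (\<integral>\<^sup>+y. ennreal (cmod (f x) * cmod (f y) * gauss_kernel \<delta> (x - y)) \<partial>lborel) \<partial>lborel)"
  proof (intro nn_integral_mono)
    fix x
    have "ennreal (cmod (cnj (f x) * (\<integral>y. f y * complex_of_real (gauss_kernel \<delta> (x - y)) \<partial>lborel)))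
        = ennreal (cmod (\<integral>y. f x * (f y * complex_of_real (gauss_kernel \<delta> (x - y))) \<partial>lborel))"
      by (simp add: norm_mult)
    also have "\<dots> \<le> (\<integral>\<^sup>+y. ennreal (cmod (f x * (f y * complex_of_real (gauss_kernel \<delta> (x - y))))) \<partial>lborel)"
      by (rule norm_integral_le_nn_integral)
    also have "\<dots> = (\<integral>\<^sup>+y. ennreal (cmod (f x) * cmod (f y) * gauss_kernel \<delta> (x - y)) \<partial>lborel)"
      by (intro nn_integral_cong) (simp add: norm_mult gauss_kernel_nonneg[OF assms(1)] mult.assoc)
    finally show "ennreal (cmod (cnj (f x) * (\<integral>y. f y * complex_of_real (gauss_kernel \<delta> (x - y)) \<partial>lborel)))
      \<le> (\<integral>\<^sup>+y. ennreal (cmod (f x) * cmod (f y) * gauss_kernel \<delta> (x - y)) \<partial>lborel)" .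
  qed
  also have "\<dots> \<le> energy lborel f" by (rule nn_integral_kernel_young[OF assms(1) fm])
  finally show ?thesis .
qed

definition approx_scale :: "nat \<Rightarrow> real" where "approx_scale n = inverse (real (Suc n))"

lemma approx_scale_pos: "0 < approx_scale n"
  by (simp add: approx_scale_def)

lemma approx_scale_tendsto: "approx_scale \<longlonglongrightarrow> 0"
  unfolding approx_scale_def by (rule LIMSEQ_inverse_real_of_nat)

lemma gauss_weight_tendsto: "(\<lambda>n. gauss_weight (approx_scale n) \<omega>) \<longlonglongrightarrow> 1"
proof -
  have "(\<lambda>n. exp (- 2 * pi\<^sup>2 * (approx_scale n)\<^sup>2 * (\<omega> \<bullet> \<omega>))) \<longlonglongrightarrow> exp (- 2 * pi\<^sup>2 * 0\<^sup>2 * (\<omega> \<bullet> \<omega>))"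
    by (intro tendsto_intros approx_scale_tendsto)
  then show ?thesis by (simp add: gauss_weight_def)
qed

text \<open>
  The inequality half of Plancherel's theorem, from the damped version by Fatou's lemma.  It is
  enough to extend the transform to \<open>L\<^sup>2\<close>; inversion will give the rest.
\<close>

theorem energy_ft_le:
  assumes f: "integrable lborel (f :: real^'d \<Rightarrow> complex)"
  shows "energy lborel (ft f) \<le> energy lborel f"
proof -
  have fm [measurable]: "f \<in> borel_measurable borel" using f by auto
  let ?g = "\<lambda>n \<omega>. ennreal (gauss_weight (approx_scale n) \<omega> * (cmod (ft f \<omega>))\<^sup>2)"
  have "energy lborel (ft f) = (\<integral>\<^sup>+\<omega>. liminf (\<lambda>n. ?g n \<omega>) \<partial>lborel)"
    unfolding energy_def
  proof (intro nn_integral_cong lim_imp_Liminf[symmetric])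
    fix \<omega>
    have "(\<lambda>n. ?g n \<omega>) \<longlonglongrightarrow> ennreal (1 * (cmod (ft f \<omega>))\<^sup>2)"
      by (intro tendsto_intros gauss_weight_tendsto)
    then show "(\<lambda>n. ?g n \<omega>) \<longlonglongrightarrow> ennreal ((cmod (ft f \<omega>))\<^sup>2)" by simp
  qed simp
  also have "\<dots> \<le> liminf (\<lambda>n. \<integral>\<^sup>+\<omega>. ?g n \<omega> \<partial>lborel)"
    by (rule nn_integral_liminf) measurable
  also have "\<dots> \<le> energy lborel f"
    by (rule Liminf_le) (auto intro!: always_eventually energy_ft_gauss_le[OF approx_scale_pos f])
  finally show ?thesis .
qed

section \<open>Fourier inversion\<close>

text \<open>
  A complex measure with density \<open>h\<close> whose image under \<open>E\<close> vanishes on an intersection-stable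
  generator has image 0.
\<close>

lemma set_integral_vimage_eq_0:
  fixes h :: "'a \<Rightarrow> complex"
  assumes h: "integrable M h" and E: "E \<in> measurable M N"
    and G: "Int_stable G" "G \<subseteq> Pow (space N)" "sets N = sigma_sets (space N) G"
    and total: "integral\<^sup>L M h = 0"
    and zero: "\<And>A. A \<in> G \<Longrightarrow> set_lebesgue_integral M (E -` A \<inter> space M) h = 0"
    and A: "A \<in> sets N"
  shows "set_lebesgue_integral M (E -` A \<inter> space M) h = 0"
proof -
  have hs: "set_integrable M B h" if "B \<in> sets M" for B
    unfolding set_integrable_def using integrable_mult_indicator[OF that h] .
  have "A \<in> sigma_sets (space N) G" using G(3) A by simp
  with G(1,2) show ?thesis
  proof (induction rule: sigma_sets_induct_disjoint)
    case (basic A) then show ?case by (rule zero)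
  next
    case empty show ?case by (simp add: set_lebesgue_integral_def)
  next
    case (compl A)
    let ?A = "E -` A \<inter> space M"
    have A: "?A \<in> sets M" using compl.hyps G(3) E by (auto intro: measurable_sets)
    have eq: "E -` (space N - A) \<inter> space M = space M - ?A"
      using measurable_space[OF E] by auto
    have "0 = set_lebesgue_integral M (space M) h"
      using total by (simp add: set_integral_space[OF h])
    also have "space M = ?A \<union> (space M - ?A)" by blast
    also have "set_lebesgue_integral M \<dots> h = set_lebesgue_integral M ?A h + set_lebesgue_integral M (space M - ?A) h"
      using A by (intro set_integral_Un hs) auto
    also have "set_lebesgue_integral M ?A h = 0" by (rule compl.IH)
    finally show ?case unfolding eq by (simp only: add_0)
  next
    case (union A)
    have A: "E -` A i \<inter> space M \<in> sets M" for i
      using union.hyps G(3) E by (auto intro!: measurable_sets[OF E] simp: image_subset_iff)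
    have eq: "E -` (\<Union>i. A i) \<inter> space M = (\<Union>i. E -` A i \<inter> space M)" by auto
    have "set_lebesgue_integral M (\<Union>i. E -` A i \<inter> space M) h = (\<Sum>i. set_lebesgue_integral M (E -` A i \<inter> space M) h)"
    proof (rule lebesgue_integral_countable_add[OF A])
      show "E -` A i \<inter> space M \<inter> (E -` A j \<inter> space M) = {}" if "i \<noteq> j" for i j
        using union.hyps(1) that by (auto simp: disjoint_family_on_def)
      show "set_integrable M (\<Union>i. E -` A i \<inter> space M) h"
        by (intro hs sets.countable_UN) (use A in auto)
    qed
    also have "\<dots> = 0" unfolding union.IH by simp
    finally show ?case unfolding eq .
  qed
qed

lemma (in sigma_finite_measure) AE_eq_0_of_generator_integrals:
  fixes h :: "'a \<Rightarrow> complex"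
  assumes h: "integrable M h"
    and G: "Int_stable G" "G \<subseteq> Pow (space M)" "sets M = sigma_sets (space M) G"
    and total: "integral\<^sup>L M h = 0"
    and zero: "\<And>A. A \<in> G \<Longrightarrow> set_lebesgue_integral M A h = 0"
  shows "AE x in M. h x = 0"
proof (rule density_zero[OF h])
  have id: "(\<lambda>x. x) -` A \<inter> space M = A" if "A \<subseteq> space M" for A
    using that by auto
  fix A assume A: "A \<in> sets M"
  have "set_lebesgue_integral M ((\<lambda>x. x) -` A \<inter> space M) h = 0"
  proof (rule set_integral_vimage_eq_0[OF h _ G total _ A])
    show "set_lebesgue_integral M ((\<lambda>x. x) -` B \<inter> space M) h = 0" if "B \<in> G" for B
      using zero[OF that] G(2) that by (subst id) auto
  qed simp
  then show "set_lebesgue_integral M A h = 0" by (simp only: id[OF sets.sets_into_space[OF A]])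
qed

text \<open>
  As \<open>h\<close> need only be locally integrable, the generator argument is applied to \<open>h\<close> cut off outside
  a box; intersections of boxes are boxes.
\<close>

lemma AE_eq_0_of_box_integrals:
  fixes h :: "'a::euclidean_space \<Rightarrow> complex"
  assumes int: "\<And>a b. set_integrable lborel (box a b) h"
    and zero: "\<And>a b. set_lebesgue_integral lborel (box a b) h = 0"
  shows "AE x in lborel. h x = 0"
proof -
  have "AE x in lborel. indicat_real (box a b) x *\<^sub>R h x = 0" for a b
  proof (rule lborel.AE_eq_0_of_generator_integrals[where G="range (\<lambda>(a, b). box a b)"])
    show "integrable lborel (\<lambda>x. indicat_real (box a b) x *\<^sub>R h x)"
      using int[of a b] by (simp add: set_integrable_def)
    show "Int_stable (range (\<lambda>(a, b). box a b :: 'a set))"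
    proof (rule Int_stableI)
      fix A B :: "'a set" assume "A \<in> range (\<lambda>(a, b). box a b)" "B \<in> range (\<lambda>(a, b). box a b)"
      then obtain a b c d where "A = box a b" "B = box c d" by auto
      then show "A \<inter> B \<in> range (\<lambda>(a, b). box a b)" by (auto simp: box_Int_box)
    qed
    show "sets lborel = sigma_sets (space lborel) (range (\<lambda>(a, b). box a b :: 'a set))"
      by (simp add: borel_eq_box)
    show "(\<integral>x. indicat_real (box a b) x *\<^sub>R h x \<partial>lborel) = 0"
      using zero[of a b] by (simp add: set_lebesgue_integral_def)
    fix A :: "'a set" assume "A \<in> range (\<lambda>(a, b). box a b)"
    then obtain c d where "A = box c d" by auto
    then obtain c' d' where "A \<inter> box a b = box c' d'" by (auto simp: box_Int_box)
    then have "set_lebesgue_integral lborel A (\<lambda>x. indicat_real (box a b) x *\<^sub>R h x) = set_lebesgue_integral lborel (box c' d') h"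
      unfolding set_lebesgue_integral_def
      by (intro Bochner_Integration.integral_cong refl) (auto simp: indicator_def)
    then show "set_lebesgue_integral lborel A (\<lambda>x. indicat_real (box a b) x *\<^sub>R h x) = 0"
      by (simp add: zero)
  qed auto
  then have "AE x in lborel. \<forall>n::nat. indicat_real (box (- real n *\<^sub>R One) (real n *\<^sub>R One)) x *\<^sub>R h x = 0"
    unfolding AE_all_countable by (intro allI)
  then show ?thesis
  proof eventually_elim
    case (elim x)
    have "x \<in> (\<Union>n::nat. box (- real n *\<^sub>R One) (real n *\<^sub>R One))"
      by (simp add: UN_box_eq_UNIV)
    then obtain n :: nat where "x \<in> box (- real n *\<^sub>R One) (real n *\<^sub>R One)" by auto
    then show ?case using elim[rule_format, of n] by simp
  qed
qed

lemma nn_integral_set_le_energy: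
  assumes [measurable]: "f \<in> borel_measurable M" "U \<in> sets M"
  shows "(\<integral>\<^sup>+x. ennreal (cmod (f x)) * indicator U x \<partial>M)\<^sup>2 \<le> energy M f * emeasure M U"
proof -
  have "(indicator U x)\<^sup>2 = (indicator U x :: ennreal)" for x
    by (simp add: indicator_def)
  then have "(\<integral>\<^sup>+x. (indicator U x)\<^sup>2 \<partial>M) = emeasure M U"
    using nn_integral_indicator[OF assms(2)] by (simp only:)
  then show ?thesis
    using Cauchy_Schwarz_nn_integral[of "\<lambda>x. ennreal (cmod (f x))" M "indicator U"]
    by (simp add: energy_def ennreal_power)
qed

lemma L2_set_integrable:
  assumes "f \<in> L2_space M" and [measurable]: "U \<in> sets M" and "emeasure M U < \<infinity>"
  shows "set_integrable M U f"
  unfolding set_integrable_def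
proof (rule integrableI_bounded)
  have [measurable]: "f \<in> borel_measurable M" using assms(1) by (rule L2_space_measurable)
  show "(\<lambda>x. indicat_real U x *\<^sub>R f x) \<in> borel_measurable M" by measurable
  have "energy M f * emeasure M U < \<infinity>"
    using assms by (simp add: L2_space_iff_energy ennreal_mult_less_top)
  then have "(\<integral>\<^sup>+x. ennreal (cmod (f x)) * indicator U x \<partial>M)\<^sup>2 < \<infinity>"
    using nn_integral_set_le_energy[of f M U] by (auto intro: le_less_trans)
  then have "(\<integral>\<^sup>+x. ennreal (cmod (f x)) * indicator U x \<partial>M) < \<infinity>"
    by (simp add: power_less_top_ennreal)
  also have "(\<integral>\<^sup>+x. ennreal (cmod (f x)) * indicator U x \<partial>M) = (\<integral>\<^sup>+x. ennreal (norm (indicat_real U x *\<^sub>R f x)) \<partial>M)"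
    by (intro nn_integral_cong) (auto simp: indicator_def)
  finally show "(\<integral>\<^sup>+x. ennreal (norm (indicat_real U x *\<^sub>R f x)) \<partial>M) < \<infinity>" .
qed

text \<open>
  By the Cauchy--Schwarz inequality, on a set of finite measure.
\<close>

lemma L2_tendsto_set_integral:
  assumes st: "L2_tendsto M s g" and U [measurable]: "U \<in> sets M" and fin: "emeasure M U < \<infinity>"
  shows "(\<lambda>n. set_lebesgue_integral M U (s n)) \<longlonglongrightarrow> set_lebesgue_integral M U g"
proof -
  note sD = L2_tendsto_D[OF st]
  have [measurable]: "s n \<in> borel_measurable M" "g \<in> borel_measurable M" for n
    using sD by (auto simp: L2_space_measurable)
  have "(\<lambda>n. emeasure M U * energy M (\<lambda>x. s n x - g x)) \<longlonglongrightarrow> emeasure M U * 0"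
    using fin by (intro ennreal_tendsto_cmult sD(3)) auto
  then have lim: "(\<lambda>n. energy M (\<lambda>x. s n x - g x) * emeasure M U) \<longlonglongrightarrow> 0"
    by (simp add: mult.commute)
  have le: "ennreal ((cmod (set_lebesgue_integral M U (s n) - set_lebesgue_integral M U g))\<^sup>2)
      \<le> energy M (\<lambda>x. s n x - g x) * emeasure M U" for n
  proof -
    have "set_lebesgue_integral M U (s n) - set_lebesgue_integral M U g = (\<integral>x. indicat_real U x *\<^sub>R (s n x - g x) \<partial>M)"
      using set_integral_diff(2)[OF L2_set_integrable[OF sD(1) U fin] L2_set_integrable[OF sD(2) U fin]]
      by (simp add: set_lebesgue_integral_def)
    then have "ennreal (cmod (set_lebesgue_integral M U (s n) - set_lebesgue_integral M U g)) \<le>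
       (\<integral>\<^sup>+x. ennreal (cmod (indicat_real U x *\<^sub>R (s n x - g x))) \<partial>M)"
      using norm_integral_le_nn_integral by metis
    also have "\<dots> = (\<integral>\<^sup>+x. ennreal (cmod (s n x - g x)) * indicator U x \<partial>M)"
      by (intro nn_integral_cong) (auto simp: indicator_def)
    finally have "(ennreal (cmod (set_lebesgue_integral M U (s n) - set_lebesgue_integral M U g)))\<^sup>2 \<le>
      (\<integral>\<^sup>+x. ennreal (cmod (s n x - g x)) * indicator U x \<partial>M)\<^sup>2"
      by (rule power_mono) simp
    also have "\<dots> \<le> energy M (\<lambda>x. s n x - g x) * emeasure M U"
      by (rule nn_integral_set_le_energy) measurable
    finally show ?thesis by (simp add: ennreal_power)
  qed
  have "(\<lambda>n. ennreal ((cmod (set_lebesgue_integral M U (s n) - set_lebesgue_integral M U g))\<^sup>2)) \<longlonglongrightarrow> 0"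
    by (rule tendsto_0_le_ennreal[OF lim]) (use le in auto)
  then have "(\<lambda>n. cmod (set_lebesgue_integral M U (s n) - set_lebesgue_integral M U g)) \<longlonglongrightarrow> 0"
    by (rule tendsto_0_of_square) simp
  then show ?thesis by (simp add: LIM_zero_iff tendsto_norm_zero_iff)
qed

lemma lborel_distr_uminus_euclidean: "distr lborel borel uminus = (lborel :: 'a::euclidean_space measure)"
  using lborel_affine[of "-1" "0::'a"] by (simp add: density_1)

lemma integral_lborel_uminus:
  fixes h :: "'a::euclidean_space \<Rightarrow> complex"
  assumes [measurable]: "h \<in> borel_measurable borel"
  shows "(\<integral>x. h (- x) \<partial>lborel) = (\<integral>x. h x \<partial>lborel)"
  by (subst (2) lborel_distr_uminus_euclidean[symmetric]) (subst integral_distr, measurable)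

lemma integrable_lborel_uminus:
  fixes h :: "'a::euclidean_space \<Rightarrow> complex"
  assumes "integrable lborel h"
  shows "integrable lborel (\<lambda>x. h (- x))"
proof -
  have [measurable]: "h \<in> borel_measurable borel" using assms by auto
  show ?thesis
    using assms
    by (subst (asm) lborel_distr_uminus_euclidean[symmetric]) (subst (asm) integrable_distr_eq, auto)
qed

lemma null_frontier_box: "AE x in lborel. x \<notin> frontier (box a b :: 'a::euclidean_space set)"
proof -
  have "negligible (frontier (box a b))"
    by (auto simp: frontier_box negligible_frontier_interval)
  then have "frontier (box a b) \<in> null_sets lborel"
    using null_sets_completion_iff[of "frontier (box a b)" "lborel :: 'a measure"]
    by (simp add: negligible_iff_null_sets)
  then show ?thesis by (rule AE_not_in)
qed

definition gauss_average :: "(real^'d) set \<Rightarrow> nat \<Rightarrow> real^'d \<Rightarrow> real" where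
  "gauss_average U n y = enn2real (\<integral>\<^sup>+x. indicator U x * ennreal (gauss_kernel (approx_scale n) (y - x)) \<partial>lborel)"

lemma nn_integral_indicator_kernel_le_1:
  assumes "0 < \<delta>"
  shows "(\<integral>\<^sup>+x. indicator U x * ennreal (gauss_kernel \<delta> (y - x :: real^'d)) \<partial>lborel) \<le> 1"
proof -
  have "(\<integral>\<^sup>+x. indicator U x * ennreal (gauss_kernel \<delta> (y - x)) \<partial>lborel) \<le> (\<integral>\<^sup>+x. ennreal (gauss_kernel \<delta> (y - x)) \<partial>lborel)"
    by (intro nn_integral_mono) (auto simp: indicator_def)
  then show ?thesis by (simp add: nn_integral_gauss_kernel[OF assms])
qed

lemma gauss_average_bounds: "0 \<le> gauss_average U n y" "gauss_average U n y \<le> 1"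
  unfolding gauss_average_def
  using enn2real_mono[OF nn_integral_indicator_kernel_le_1[OF approx_scale_pos, of U n y]] by auto

lemma gauss_average_measurable [measurable]:
  assumes [measurable]: "U \<in> sets borel"
  shows "gauss_average U n \<in> borel_measurable borel"
  unfolding gauss_average_def[abs_def] by measurable

text \<open>
  Off the frontier of \<open>U\<close>, the dilated argument eventually stays on the same side as \<open>y\<close>.
\<close>

lemma gauss_average_tendsto:
  fixes U :: "(real^'d) set"
  assumes U [measurable]: "open U" "y \<notin> frontier U"
  shows "(\<lambda>n. gauss_average U n y) \<longlonglongrightarrow> indicator U y"
proof -
  have [measurable]: "U \<in> sets borel" using U by simp
  let ?u = "\<lambda>n z. indicator U (y + approx_scale n *\<^sub>R z) * ennreal (gauss_kernel 1 z) :: ennreal"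
  have eq: "(\<integral>\<^sup>+x. indicator U x * ennreal (gauss_kernel (approx_scale n) (y - x)) \<partial>lborel) = (\<integral>\<^sup>+z. ?u n z \<partial>lborel)" for n
    by (rule nn_integral_gauss_kernel_substitution[OF approx_scale_pos]) measurable
  have lim: "(\<lambda>n. y + approx_scale n *\<^sub>R z) \<longlonglongrightarrow> y" for z
    using tendsto_add[OF tendsto_const tendsto_scaleR[OF approx_scale_tendsto tendsto_const], of y z] by simp
  have ind: "\<forall>\<^sub>F n in sequentially. indicator U (y + approx_scale n *\<^sub>R z) = (indicator U y :: ennreal)" for z
  proof (cases "y \<in> U")
    case True
    with topological_tendstoD[OF lim U(1)] have "\<forall>\<^sub>F n in sequentially. y + approx_scale n *\<^sub>R z \<in> U" by simp
    then show ?thesis by eventually_elim (simp add: True)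
  next
    case False
    then have "y \<in> - closure U" using U by (auto simp: frontier_def interior_open)
    moreover have "open (- closure U)" by auto
    ultimately have "\<forall>\<^sub>F n in sequentially. y + approx_scale n *\<^sub>R z \<in> - closure U"
      using topological_tendstoD[OF lim] by blast
    then show ?thesis
    proof eventually_elim
      case (elim n)
      then have "y + approx_scale n *\<^sub>R z \<notin> U" using closure_subset by auto
      then show ?case by (simp add: False)
    qed
  qed
  have "(\<lambda>n. \<integral>\<^sup>+z. ?u n z \<partial>lborel) \<longlonglongrightarrow> (\<integral>\<^sup>+z. indicator U y * ennreal (gauss_kernel 1 (z :: real^'d)) \<partial>lborel)"
  proof (rule nn_integral_dominated_convergence[where w="\<lambda>z. ennreal (gauss_kernel 1 z)"])
    show "AE z in lborel. (\<lambda>n. ?u n z) \<longlonglongrightarrow> indicator U y * ennreal (gauss_kernel 1 z)"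
    proof (rule AE_I2)
      fix z
      show "(\<lambda>n. ?u n z) \<longlonglongrightarrow> indicator U y * ennreal (gauss_kernel 1 z)"
        by (rule tendsto_eventually) (use ind[of z] in eventually_elim, simp)
    qed
    show "AE z in lborel. ?u n z \<le> ennreal (gauss_kernel 1 z)" for n
      by (rule AE_I2) (auto simp: indicator_def)
    show "(\<integral>\<^sup>+z. ennreal (gauss_kernel 1 (z :: real^'d)) \<partial>lborel) < \<infinity>" by (simp add: nn_integral_gauss_kernel_1)
  qed measurable
  then have "(\<lambda>n. \<integral>\<^sup>+z. ?u n z \<partial>lborel) \<longlonglongrightarrow> indicator U y"
    by (simp add: nn_integral_cmult nn_integral_gauss_kernel_1)
  then have "(\<lambda>n. enn2real (\<integral>\<^sup>+z. ?u n z \<partial>lborel)) \<longlonglongrightarrow> enn2real (indicator U y)"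
    by (intro tendsto_enn2real) (auto simp: indicator_def)
  moreover have "enn2real (indicator U y) = indicator U y"
    by (simp add: indicator_def)
  ultimately show ?thesis unfolding gauss_average_def eq by (simp only:)
qed

lemma gauss_kernel_bounded:
  assumes "0 < \<delta>"
  shows "cmod (complex_of_real (gauss_kernel \<delta> (z :: real^'d))) \<le> (\<integral>\<omega>. gauss_weight \<delta> (\<omega> :: real^'d) \<partial>lborel)"
proof -
  have "cmod (complex_of_real (gauss_kernel \<delta> z)) \<le> (\<integral>\<omega>. norm (complex_of_real (gauss_weight \<delta> (\<omega> :: real^'d)) * cis (2 * pi * (\<omega> \<bullet> z))) \<partial>lborel)"
    unfolding integral_gauss_weight_cis[OF assms, symmetric] by (rule integral_norm_bound)
  also have "\<dots> = (\<integral>\<omega>. gauss_weight \<delta> (\<omega> :: real^'d) \<partial>lborel)"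
    by (intro Bochner_Integration.integral_cong refl) (simp add: norm_mult gauss_weight_pos less_imp_le)
  finally show ?thesis .
qed

lemma ft_gauss_weight_ft':
  assumes "0 < \<delta>" and f: "integrable lborel (f :: real^'d \<Rightarrow> complex)"
  shows "ft (\<lambda>\<omega>. complex_of_real (gauss_weight \<delta> \<omega>) * ft f \<omega>) x = (\<integral>y. f y * complex_of_real (gauss_kernel \<delta> (- x - y)) \<partial>lborel)"
  unfolding ft_gauss_weight_ft[OF assms, symmetric] ft_def[of "\<lambda>\<omega>. complex_of_real (gauss_weight \<delta> \<omega>) * ft f \<omega>"]
  by (simp add: inner_commute)

lemma set_integral_ft_gauss_weight_ft:
  fixes f :: "real^'d \<Rightarrow> complex"
  assumes f: "integrable lborel f" and U [measurable]: "U \<in> sets borel" and fin: "emeasure lborel U < \<infinity>"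
  shows "set_lebesgue_integral lborel U (ft (\<lambda>\<omega>. complex_of_real (gauss_weight (approx_scale n) \<omega>) * ft f \<omega>)) =
    (\<integral>y. f y * complex_of_real (gauss_average U n (- y)) \<partial>lborel)"
proof -
  let ?K = "gauss_kernel (approx_scale n) :: real^'d \<Rightarrow> real"
  let ?p = "\<lambda>x. complex_of_real (indicat_real U x)"
  let ?c = "\<lambda>(x, y). complex_of_real (?K (- x - y))"
  have p: "integrable lborel ?p"
    by (intro integrable_of_real integrable_real_indicator) (use fin in auto)
  have "set_lebesgue_integral lborel U (ft (\<lambda>\<omega>. complex_of_real (gauss_weight (approx_scale n) \<omega>) * ft f \<omega>)) =
     (\<integral>x. (\<integral>y. ?p x * f y * ?c (x, y) \<partial>lborel) \<partial>lborel)"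
    unfolding set_lebesgue_integral_def ft_gauss_weight_ft'[OF approx_scale_pos f] scaleR_conv_of_real
      integral_mult_right_zero[symmetric] by (simp add: mult.assoc)
  also have "\<dots> = (\<integral>y. (\<integral>x. ?p x * f y * ?c (x, y) \<partial>lborel) \<partial>lborel)"
    by (rule Fubini_bounded_mult[symmetric, where B="\<integral>\<omega>. gauss_weight (approx_scale n) (\<omega> :: real^'d) \<partial>lborel"])
       (use p f in \<open>auto simp: case_prod_beta simp del: norm_of_real intro!: gauss_kernel_bounded approx_scale_pos\<close>)
  also have "\<dots> = (\<integral>y. f y * complex_of_real (gauss_average U n (- y)) \<partial>lborel)"
  proof (intro Bochner_Integration.integral_cong refl)
    fix y
    have "?p x * f y * ?c (x, y) = f y * complex_of_real (indicat_real U x * ?K (- y - x))" for x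
    proof -
      have "- x - y = - y - x" by simp
      then show ?thesis by (simp only: case_prod_conv of_real_mult mult_ac)
    qed
    then have "(\<integral>x. ?p x * f y * ?c (x, y) \<partial>lborel) = f y * complex_of_real (\<integral>x. indicat_real U x * ?K (- y - x) \<partial>lborel)"
      by (simp only: integral_mult_right_zero integral_complex_of_real)
    also have "(\<integral>x. indicat_real U x * ?K (- y - x) \<partial>lborel) = gauss_average U n (- y)"
    proof (subst integral_eq_nn_integral)
      show "AE x in lborel. 0 \<le> indicat_real U x * ?K (- y - x)"
        by (simp add: gauss_kernel_nonneg[OF approx_scale_pos])
      have "ennreal (indicat_real U x * ?K (- y - x)) = indicator U x * ennreal (?K (- y - x))" for x
        by (simp add: indicator_def)
      then show "enn2real (\<integral>\<^sup>+x. ennreal (indicat_real U x * ?K (- y - x)) \<partial>lborel) = gauss_average U n (- y)"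
        unfolding gauss_average_def by (simp only:)
    qed measurable
    finally show "(\<integral>x. ?p x * f y * ?c (x, y) \<partial>lborel) = f y * complex_of_real (gauss_average U n (- y))" .
  qed
  finally show ?thesis .
qed

text \<open>
  The two sides have the same integrals over all boxes.  Over a box, the damped double transform
  is the integral of \<open>f\<close> against the averaged indicator of the reflected box; as \<open>n\<close> grows, one side
  converges because \<open>L\<^sup>2\<close> limits commute with integration over the box, the other by dominated
  convergence.
\<close>

theorem ft_inversion:
  fixes f :: "real^'d \<Rightarrow> complex"
  assumes f: "integrable lborel f"
    and conv: "L2_tendsto lborel (\<lambda>n. ft (\<lambda>\<omega>. complex_of_real (gauss_weight (approx_scale n) \<omega>) * ft f \<omega>)) g"
  shows "AE x in lborel. g x = f (- x)"
proof -
  let ?s = "\<lambda>n. ft (\<lambda>\<omega>. complex_of_real (gauss_weight (approx_scale n) \<omega>) * ft f \<omega>)"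
  have [measurable]: "f \<in> borel_measurable borel" using f by auto
  have gL2: "g \<in> L2_space lborel" by (rule L2_tendsto_D(2)[OF conv])
  have fi: "integrable lborel (\<lambda>x. f (- x))" by (rule integrable_lborel_uminus[OF f])
  have box: "set_integrable lborel (box a b) g" "set_integrable lborel (box a b) (\<lambda>x. f (- x))"
     "set_lebesgue_integral lborel (box a b) g = set_lebesgue_integral lborel (box a b) (\<lambda>x. f (- x))" for a b
  proof -
    have fin: "emeasure lborel (box a b) < \<infinity>" by (rule emeasure_lborel_box_finite)
    show "set_integrable lborel (box a b) g" by (rule L2_set_integrable[OF gL2 _ fin]) simp
    show "set_integrable lborel (box a b) (\<lambda>x. f (- x))"
      unfolding set_integrable_def by (rule integrable_mult_indicator[OF _ fi]) simp
    have "(\<lambda>n. set_lebesgue_integral lborel (box a b) (?s n)) \<longlonglongrightarrow> set_lebesgue_integral lborel (box a b) g"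
      by (rule L2_tendsto_set_integral[OF conv _ fin]) simp
    then have 1: "(\<lambda>n. \<integral>y. f y * complex_of_real (gauss_average (box a b) n (- y)) \<partial>lborel) \<longlonglongrightarrow> set_lebesgue_integral lborel (box a b) g"
      by (subst (asm) set_integral_ft_gauss_weight_ft[OF f _ fin]) auto
    have "(\<lambda>n. \<integral>y. f y * complex_of_real (gauss_average (box a b) n (- y)) \<partial>lborel) \<longlonglongrightarrow>
        (\<integral>y. f y * complex_of_real (indicat_real (box a b) (- y)) \<partial>lborel)"
    proof (rule integral_dominated_convergence[where w="\<lambda>y. cmod (f y)"])
      show "integrable lborel (\<lambda>y. cmod (f y))" using f by simp
      have "AE y in distr lborel borel uminus. y \<notin> frontier (box a b)"
        unfolding lborel_distr_uminus_euclidean by (rule null_frontier_box)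
      then have "AE y in lborel. - y \<notin> frontier (box a b)"
        by (rule AE_distrD[rotated]) simp
      then show "AE y in lborel. (\<lambda>n. f y * complex_of_real (gauss_average (box a b) n (- y))) \<longlonglongrightarrow> f y * complex_of_real (indicat_real (box a b) (- y))"
      proof eventually_elim
        case (elim y)
        show ?case by (intro tendsto_intros gauss_average_tendsto elim open_box)
      qed
      show "AE y in lborel. norm (f y * complex_of_real (gauss_average (box a b) n (- y))) \<le> cmod (f y)" for n
      proof (rule AE_I2)
        fix y
        have "\<bar>gauss_average (box a b) n (- y)\<bar> \<le> 1"
          using gauss_average_bounds[of "box a b" n "- y"] by simp
        then have "cmod (f y) * \<bar>gauss_average (box a b) n (- y)\<bar> \<le> cmod (f y) * 1"
          by (intro mult_left_mono) auto
        then show "norm (f y * complex_of_real (gauss_average (box a b) n (- y))) \<le> cmod (f y)"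
          by (simp add: norm_mult)
      qed
    qed measurable
    then have "set_lebesgue_integral lborel (box a b) g = (\<integral>y. f y * complex_of_real (indicat_real (box a b) (- y)) \<partial>lborel)"
      by (rule LIMSEQ_unique[OF 1])
    also have "\<dots> = (\<integral>x. f (- x) * complex_of_real (indicat_real (box a b) (- (- x))) \<partial>lborel)"
      by (rule integral_lborel_uminus[symmetric]) measurable
    also have "\<dots> = set_lebesgue_integral lborel (box a b) (\<lambda>x. f (- x))"
      unfolding set_lebesgue_integral_def by (simp add: scaleR_conv_of_real mult.commute)
    finally show "set_lebesgue_integral lborel (box a b) g = set_lebesgue_integral lborel (box a b) (\<lambda>x. f (- x))" .
  qed
  have "AE x in lborel. g x - f (- x) = 0"
    by (rule AE_eq_0_of_box_integrals)
       (use set_integral_diff[OF box(1,2)] box(3) in auto)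
  then show ?thesis by simp
qed

lemma energy_lebesgue: "energy lebesgue f = energy lborel f"
  by (simp add: energy_def nn_integral_completion)

lemma L2_tendsto_lborel_iff:
  assumes "\<And>n. s n \<in> borel_measurable borel" "f \<in> borel_measurable borel"
  shows "L2_tendsto lborel s f \<longleftrightarrow> L2_tendsto lebesgue s f"
proof -
  have "s n \<in> borel_measurable lebesgue" "f \<in> borel_measurable lebesgue" for n
    using assms by (auto intro!: measurable_completion)
  then show ?thesis
    using assms by (simp add: L2_tendsto_iff_energy L2_space_iff_energy energy_lebesgue)
qed

text \<open>
  Results for Borel functions carry over to Lebesgue measurable ones through such a
  representative.
\<close>

lemma borel_representative:
  fixes f :: "'a::euclidean_space \<Rightarrow> complex"
  assumes "f \<in> borel_measurable lebesgue"
  obtains g where "g \<in> borel_measurable borel" "AE x in lebesgue. f x = g x"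
proof -
  have "(\<lambda>x. Re (f x)) \<in> borel_measurable lebesgue" "(\<lambda>x. Im (f x)) \<in> borel_measurable lebesgue"
    using assms by measurable
  then obtain u v where u: "u \<in> borel_measurable lborel" "AE x in lborel. Re (f x) = u x"
    and v: "v \<in> borel_measurable lborel" "AE x in lborel. Im (f x) = v x"
    by (metis completion_ex_borel_measurable_real)
  show ?thesis
  proof
    show "(\<lambda>x. Complex (u x) (v x)) \<in> borel_measurable borel"
      using u(1) v(1) by (simp add: borel_measurable_complex_iff)
    have "AE x in lborel. f x = Complex (u x) (v x)"
      using u(2) v(2) by eventually_elim (simp add: complex_eq_iff)
    then show "AE x in lebesgue. f x = Complex (u x) (v x)" by (rule AE_completion)
  qed
qed

lemma fourier_integral_eq_ft:
  fixes f :: "real^'d \<Rightarrow> complex"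
  assumes "f \<in> borel_measurable lebesgue" "g \<in> borel_measurable borel" "AE x in lebesgue. f x = g x"
  shows "fourier_integral f = ft g"
proof (rule ext)
  fix \<omega> :: "real^'d"
  note [measurable] = assms(1,2)
  have [measurable]: "g \<in> borel_measurable lebesgue"
    by (rule measurable_completion) (simp add: assms(2))
  have [measurable]: "(\<lambda>x. cis (- (2 * pi * (\<omega> \<bullet> x)))) \<in> borel_measurable lebesgue"
    by (rule measurable_completion) measurable
  have "fourier_integral f \<omega> = (\<integral>x. g x * cis (- (2 * pi * (\<omega> \<bullet> x))) \<partial>lebesgue)"
    unfolding fourier_integral_def
  proof (rule integral_cong_AE)
    show "AE x in lebesgue. f x * cis (- (2 * pi * (\<omega> \<bullet> x))) = g x * cis (- (2 * pi * (\<omega> \<bullet> x)))"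
      using assms(3) by eventually_elim simp
  qed measurable
  also have "\<dots> = ft g \<omega>"
    unfolding ft_def by (rule integral_completion) measurable
  finally show "fourier_integral f \<omega> = ft g \<omega>" .
qed

lemma integrable_borel_representative:
  fixes f :: "real^'d \<Rightarrow> complex"
  assumes "integrable lebesgue f"
  obtains g where "integrable lborel g" "AE x in lebesgue. f x = g x" "fourier_integral f = ft g"
proof -
  have fm: "f \<in> borel_measurable lebesgue" using assms by auto
  then obtain g where g: "g \<in> borel_measurable borel" "AE x in lebesgue. f x = g x"
    by (rule borel_representative)
  have "g \<in> borel_measurable lebesgue" using g(1) by (auto intro!: measurable_completion)
  then have "integrable lebesgue g"
    by (rule integrable_cong_AE_imp[OF assms]) (use g(2) in auto)
  then have "integrable lborel g"
    using g(1) integrable_completion[of g lborel] by simp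
  then show ?thesis by (rule that[OF _ g(2) fourier_integral_eq_ft[OF fm g]])
qed

section \<open>The Fourier transform as a bijection\<close>

lemma lebesgue_affine_one:
  fixes t :: "'a::euclidean_space" and c :: real
  assumes "\<bar>c\<bar> = 1"
  shows "distr lebesgue lebesgue (\<lambda>x. t + c *\<^sub>R x) = lebesgue"
    and "(\<lambda>x. t + c *\<^sub>R x) \<in> lebesgue \<rightarrow>\<^sub>M lebesgue"
proof -
  have c: "c \<noteq> 0" using assms by auto
  have eq: "(\<Sum>j\<in>Basis. (c * (x \<bullet> j)) *\<^sub>R j) = c *\<^sub>R x" for x :: 'a
    unfolding scaleR_scaleR[symmetric] scaleR_sum_right[symmetric] euclidean_representation ..
  have "lebesgue = density (distr lebesgue lebesgue (\<lambda>x. t + c *\<^sub>R x)) (\<lambda>_. \<Prod>j\<in>(Basis::'a set). ennreal \<bar>c\<bar>)"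
    using lebesgue_affine_euclidean[where c="\<lambda>_::'a. c" and t=t] c unfolding eq assms by simp
  then show "distr lebesgue lebesgue (\<lambda>x. t + c *\<^sub>R x) = lebesgue"
    by (simp add: assms density_1)
  show "(\<lambda>x. t + c *\<^sub>R x) \<in> lebesgue \<rightarrow>\<^sub>M lebesgue"
    using lebesgue_affine_measurable[where c="\<lambda>_::'a. c" and t=t] c unfolding eq by simp
qed

lemma distr_lebesgue_uminus: "distr lebesgue lebesgue uminus = (lebesgue :: 'a::euclidean_space measure)"
  and measurable_lebesgue_uminus: "(uminus :: 'a \<Rightarrow> 'a) \<in> lebesgue \<rightarrow>\<^sub>M lebesgue"
  using lebesgue_affine_one[of "-1" "0::'a"] by simp_all

lemma distr_lebesgue_translation: "distr lebesgue lebesgue (\<lambda>x. t + x) = (lebesgue :: 'a::euclidean_space measure)"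
  and measurable_lebesgue_translation: "(\<lambda>x::'a. t + x) \<in> lebesgue \<rightarrow>\<^sub>M lebesgue"
  using lebesgue_affine_one[of "1" "t::'a"] by simp_all

lemma measurable_lebesgue_reflect:
  fixes f :: "'a::euclidean_space \<Rightarrow> 'b::topological_space"
  assumes "f \<in> borel_measurable lebesgue"
  shows "(\<lambda>x. f (- x)) \<in> borel_measurable lebesgue"
  using measurable_comp[OF measurable_lebesgue_uminus assms] by (simp add: comp_def)

lemma energy_reflect:
  fixes f :: "'a::euclidean_space \<Rightarrow> complex"
  assumes [measurable]: "f \<in> borel_measurable lebesgue"
  shows "energy lebesgue (\<lambda>x. f (- x)) = energy lebesgue f"
proof -
  have "energy (distr lebesgue lebesgue uminus) f = energy lebesgue (\<lambda>x. f (- x))"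
    unfolding energy_def by (rule nn_integral_distr[OF measurable_lebesgue_uminus]) measurable
  then show ?thesis by (simp add: distr_lebesgue_uminus)
qed

lemma L2_tendsto_reflect:
  fixes f :: "'a::euclidean_space \<Rightarrow> complex"
  assumes "L2_tendsto lebesgue s f"
  shows "L2_tendsto lebesgue (\<lambda>n x. s n (- x)) (\<lambda>x. f (- x))"
proof -
  note s = L2_tendsto_D[OF assms]
  have m: "s n \<in> borel_measurable lebesgue" "f \<in> borel_measurable lebesgue"
    "(\<lambda>x. s n x - f x) \<in> borel_measurable lebesgue" for n
    using s by (auto intro: L2_space_measurable L2_space_measurable_diff)
  show ?thesis
    using s energy_reflect[OF m(1)] energy_reflect[OF m(2)] energy_reflect[OF m(3)]
      measurable_lebesgue_reflect[OF m(1)] measurable_lebesgue_reflect[OF m(2)]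
    unfolding L2_tendsto_iff_energy L2_space_iff_energy by simp
qed

lemma fourier_integral_measurable:
  fixes f :: "real^'d \<Rightarrow> complex"
  assumes "integrable lebesgue f"
  shows "fourier_integral f \<in> borel_measurable borel"
proof -
  obtain g where "integrable lborel g" "fourier_integral f = ft g"
    using integrable_borel_representative[OF assms] by metis
  then show ?thesis using ft_measurable[of g] by auto
qed

lemma energy_fourier_integral_le:
  fixes f :: "real^'d \<Rightarrow> complex"
  assumes "integrable lebesgue f"
  shows "energy lebesgue (fourier_integral f) \<le> energy lebesgue f"
proof -
  obtain g where g: "integrable lborel g" "AE x in lebesgue. f x = g x" "fourier_integral f = ft g"
    using integrable_borel_representative[OF assms] by metis
  have "energy lebesgue (ft g) \<le> energy lebesgue g"
    unfolding energy_lebesgue by (rule energy_ft_le[OF g(1)])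
  then show ?thesis using energy_cong_AE[OF g(2)] g(3) by simp
qed

lemma fourier_integral_L2:
  fixes f :: "real^'d \<Rightarrow> complex"
  assumes "integrable lebesgue f" "f \<in> L2_space lebesgue"
  shows "fourier_integral f \<in> L2_space lebesgue"
  using energy_fourier_integral_le[OF assms(1)] assms(2) fourier_integral_measurable[OF assms(1)]
  by (auto simp: L2_space_iff_energy intro: le_less_trans measurable_completion)

lemma integrable_lebesgue_times_cis:
  fixes f :: "real^'d \<Rightarrow> complex"
  assumes "integrable lebesgue f"
  shows "integrable lebesgue (\<lambda>x. f x * cis (- (2 * pi * (\<omega> \<bullet> x))))"
proof (rule Bochner_Integration.integrable_bound[OF assms])
  have [measurable]: "f \<in> borel_measurable lebesgue" using assms by auto
  have [measurable]: "(\<lambda>x::real^'d. cis (- (2 * pi * (\<omega> \<bullet> x)))) \<in> borel_measurable lebesgue"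
    by (rule measurable_completion) measurable
  show "(\<lambda>x. f x * cis (- (2 * pi * (\<omega> \<bullet> x)))) \<in> borel_measurable lebesgue" by measurable
qed (simp add: norm_mult)

lemma fourier_integral_add:
  fixes f g :: "real^'d \<Rightarrow> complex"
  assumes "integrable lebesgue f" "integrable lebesgue g"
  shows "fourier_integral (\<lambda>x. f x + g x) = (\<lambda>\<omega>. fourier_integral f \<omega> + fourier_integral g \<omega>)"
  unfolding fourier_integral_def distrib_right
  by (rule ext, intro Bochner_Integration.integral_add integrable_lebesgue_times_cis assms)

lemma fourier_integral_cmult:
  fixes f :: "real^'d \<Rightarrow> complex"
  shows "fourier_integral (\<lambda>x. c * f x) = (\<lambda>\<omega>. c * fourier_integral f \<omega>)"
  unfolding fourier_integral_def mult.assoc integral_mult_right_zero ..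

lemma fourier_integral_diff:
  fixes f g :: "real^'d \<Rightarrow> complex"
  assumes "integrable lebesgue f" "integrable lebesgue g"
  shows "fourier_integral (\<lambda>x. f x - g x) = (\<lambda>\<omega>. fourier_integral f \<omega> - fourier_integral g \<omega>)"
  unfolding fourier_integral_def left_diff_distrib
  by (rule ext, intro Bochner_Integration.integral_diff integrable_lebesgue_times_cis assms)

lemma L2_tendsto_fourier_integral:
  fixes f :: "real^'d \<Rightarrow> complex"
  assumes int: "\<And>n. integrable lebesgue (s n)" and lim: "L2_tendsto lebesgue s f"
  shows "\<exists>g. L2_tendsto lebesgue (\<lambda>n. fourier_integral (s n)) g"
proof (rule L2_complete)
  note s = L2_tendsto_D[OF lim]
  show "fourier_integral (s n) \<in> L2_space lebesgue" for n
    by (rule fourier_integral_L2[OF int s(1)])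
  fix e :: ennreal assume "0 < e"
  have "(\<lambda>n. 2 * (2 * energy lebesgue (\<lambda>x. s n x - f x))) \<longlonglongrightarrow> 2 * (2 * 0)"
    by (intro ennreal_tendsto_cmult s(3)) simp_all
  then have "(\<lambda>n. 2 * (2 * energy lebesgue (\<lambda>x. s n x - f x))) \<longlonglongrightarrow> 0"
    by (simp only: mult_zero_right)
  from ennreal_tendsto_0D[OF this \<open>0 < e\<close>]
  obtain N where N: "\<And>n. n \<ge> N \<Longrightarrow> 2 * (2 * energy lebesgue (\<lambda>x. s n x - f x)) < e"
    by auto
  show "\<exists>N. \<forall>m\<ge>N. \<forall>n\<ge>N. energy lebesgue (\<lambda>x. fourier_integral (s m) x - fourier_integral (s n) x) < e"
  proof (intro exI allI impI)
    fix m n assume mn: "N \<le> m" "N \<le> n"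
    let ?a = "energy lebesgue (\<lambda>x. s m x - f x)" and ?b = "energy lebesgue (\<lambda>x. s n x - f x)"
    have "energy lebesgue (\<lambda>x. fourier_integral (s m) x - fourier_integral (s n) x)
        = energy lebesgue (fourier_integral (\<lambda>x. s m x - s n x))"
      by (simp only: fourier_integral_diff[OF int int])
    also have "\<dots> \<le> energy lebesgue (\<lambda>x. s m x - s n x)"
      by (rule energy_fourier_integral_le) (intro Bochner_Integration.integrable_diff int)
    also have "\<dots> \<le> 2 * ?a + 2 * energy lebesgue (\<lambda>x. f x - s n x)"
      by (rule energy_triangle) (use s in \<open>auto intro: L2_space_measurable\<close>)
    also have "\<dots> = 2 * ?a + 2 * ?b" by (simp only: energy_minus_commute)
    also have "\<dots> \<le> 2 * max ?a ?b + 2 * max ?a ?b"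
      by (intro add_mono mult_left_mono) auto
    also have "\<dots> = 2 * (2 * max ?a ?b)" by (simp add: mult_2)
    also have "\<dots> < e" using N[OF mn(1)] N[OF mn(2)] by (simp add: max_def)
    finally show "energy lebesgue (\<lambda>x. fourier_integral (s m) x - fourier_integral (s n) x) < e" .
  qed
qed

lemma L2_truncation:
  fixes f :: "'a::euclidean_space \<Rightarrow> complex"
  assumes f: "f \<in> L2_space lebesgue"
  defines "s \<equiv> (\<lambda>n::nat. \<lambda>x. indicat_real (cball 0 (real n)) x *\<^sub>R f x)"
  shows "integrable lebesgue (s n)" "L2_tendsto lebesgue s f"
proof -
  have [measurable]: "f \<in> borel_measurable lebesgue" using f by (rule L2_space_measurable)
  have [measurable]: "cball 0 (real n) \<in> sets (lebesgue :: 'a measure)" for n by simp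
  have fin: "emeasure lebesgue (cball (0::'a) (real n)) < \<infinity>" for n
    using emeasure_lborel_cball_finite[of "0::'a" "real n"] by simp
  show "integrable lebesgue (s n)"
    using L2_set_integrable[OF f _ fin] by (simp add: set_integrable_def s_def)
  have [measurable]: "s n \<in> borel_measurable lebesgue" for n unfolding s_def by measurable
  have ef: "energy lebesgue f < \<infinity>" using f by (simp add: L2_space_iff_energy)
  have sL2: "s n \<in> L2_space lebesgue" for n
  proof -
    have "energy lebesgue (s n) \<le> energy lebesgue f"
      unfolding energy_def s_def by (intro nn_integral_mono) (auto simp: indicator_def)
    then show ?thesis using ef by (auto simp: L2_space_iff_energy intro: le_less_trans)
  qed
  have "(\<lambda>n. energy lebesgue (\<lambda>x. s n x - f x)) \<longlonglongrightarrow> (\<integral>\<^sup>+x. 0 \<partial>(lebesgue :: 'a measure))"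
    unfolding energy_def
  proof (rule nn_integral_dominated_convergence[where w="\<lambda>x. ennreal ((cmod (f x))\<^sup>2)"])
    show "AE x in lebesgue. ennreal ((cmod (s n x - f x))\<^sup>2) \<le> ennreal ((cmod (f x))\<^sup>2)" for n
      by (rule AE_I2) (auto simp: s_def indicator_def)
    show "(\<integral>\<^sup>+x. ennreal ((cmod (f x))\<^sup>2) \<partial>lebesgue) < \<infinity>" using ef by (simp add: energy_def)
    show "AE x in lebesgue. (\<lambda>n. ennreal ((cmod (s n x - f x))\<^sup>2)) \<longlonglongrightarrow> 0"
    proof (rule AE_I2)
      fix x :: 'a
      obtain N :: nat where N: "norm x \<le> real N" using real_arch_simple by blast
      have "\<forall>\<^sub>F n in sequentially. ennreal ((cmod (s n x - f x))\<^sup>2) = 0"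
        unfolding eventually_sequentially
        by (rule exI[of _ N]) (use N in \<open>auto simp: s_def indicator_def\<close>)
      then show "(\<lambda>n. ennreal ((cmod (s n x - f x))\<^sup>2)) \<longlonglongrightarrow> 0" by (rule tendsto_eventually)
    qed
  qed measurable
  then show "L2_tendsto lebesgue s f"
    using f sL2 by (simp add: L2_tendsto_iff_energy)
qed

text \<open>
  The relation whose choice function is \<open>fourier\<close>.  The properties of the transform are proved for
  this relation, which is closed in \<open>L\<^sup>2 \<times> L\<^sup>2\<close> and single-valued up to null sets.
\<close>

definition fourier_pair :: "(real^'d \<Rightarrow> complex) \<Rightarrow> (real^'d \<Rightarrow> complex) \<Rightarrow> bool" where
  "fourier_pair f g \<longleftrightarrow> (\<exists>s. (\<forall>n. integrable lebesgue (s n)) \<and>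
     L2_tendsto lebesgue s f \<and> L2_tendsto lebesgue (\<lambda>n. fourier_integral (s n)) g)"

lemma fourier_pair_L2: "fourier_pair f g \<Longrightarrow> f \<in> L2_space lebesgue" "fourier_pair f g \<Longrightarrow> g \<in> L2_space lebesgue"
  by (auto simp: fourier_pair_def dest: L2_tendsto_D)

lemma fourier_pair_exists:
  fixes f :: "real^'d \<Rightarrow> complex"
  assumes "f \<in> L2_space lebesgue"
  shows "\<exists>g. fourier_pair f g"
proof -
  obtain g where "L2_tendsto lebesgue (\<lambda>n. fourier_integral (\<lambda>x. indicat_real (cball 0 (real n)) x *\<^sub>R f x)) g"
    using L2_tendsto_fourier_integral[OF L2_truncation[OF assms]] by auto
  with L2_truncation[OF assms] have "fourier_pair f g"
    unfolding fourier_pair_def by (intro exI conjI allI)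
  then show ?thesis by (rule exI[of "fourier_pair f"])
qed

lemma fourier_pair_add:
  assumes "fourier_pair f g" "fourier_pair f' g'"
  shows "fourier_pair (\<lambda>x. f x + f' x) (\<lambda>x. g x + g' x)"
proof -
  obtain s where s: "\<And>n. integrable lebesgue (s n)" "L2_tendsto lebesgue s f"
    "L2_tendsto lebesgue (\<lambda>n. fourier_integral (s n)) g"
    using assms(1) unfolding fourier_pair_def by metis
  obtain t where t: "\<And>n. integrable lebesgue (t n)" "L2_tendsto lebesgue t f'"
    "L2_tendsto lebesgue (\<lambda>n. fourier_integral (t n)) g'"
    using assms(2) unfolding fourier_pair_def by metis
  have "L2_tendsto lebesgue (\<lambda>n. fourier_integral (\<lambda>x. s n x + t n x)) (\<lambda>x. g x + g' x)"
    unfolding fourier_integral_add[OF s(1) t(1)] by (rule L2_tendsto_add[OF s(3) t(3)])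
  moreover have "integrable lebesgue (\<lambda>x. s n x + t n x)" for n
    by (intro Bochner_Integration.integrable_add s t)
  ultimately show ?thesis
    using L2_tendsto_add[OF s(2) t(2)] unfolding fourier_pair_def
    by (intro exI[of _ "\<lambda>n x. s n x + t n x"] conjI allI)
qed

lemma fourier_pair_cmult:
  assumes "fourier_pair f g"
  shows "fourier_pair (\<lambda>x. c * f x) (\<lambda>x. c * g x)"
proof -
  obtain s where s: "\<And>n. integrable lebesgue (s n)" "L2_tendsto lebesgue s f"
    "L2_tendsto lebesgue (\<lambda>n. fourier_integral (s n)) g"
    using assms(1) unfolding fourier_pair_def by metis
  have "L2_tendsto lebesgue (\<lambda>n. fourier_integral (\<lambda>x. c * s n x)) (\<lambda>x. c * g x)"
    unfolding fourier_integral_cmult by (rule L2_tendsto_cmult[OF s(3)])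
  moreover have "integrable lebesgue (\<lambda>x. c * s n x)" for n
    by (intro integrable_mult_right s)
  ultimately show ?thesis
    using L2_tendsto_cmult[OF s(2)] unfolding fourier_pair_def
    by (intro exI[of _ "\<lambda>n x. c * s n x"] conjI allI)
qed

lemma fourier_pair_diff:
  assumes "fourier_pair f g" "fourier_pair f' g'"
  shows "fourier_pair (\<lambda>x. f x - f' x) (\<lambda>x. g x - g' x)"
  using fourier_pair_add[OF assms(1) fourier_pair_cmult[OF assms(2), of "-1"]] by simp

text \<open>
  The constant 4 instead of 1 comes from two uses of the weak triangle inequality; continuity is
  all that matters.
\<close>

lemma fourier_pair_energy_le:
  assumes "fourier_pair f g"
  shows "energy lebesgue g \<le> 4 * energy lebesgue f"
proof -
  obtain s where s: "\<And>n. integrable lebesgue (s n)" "L2_tendsto lebesgue s f"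
    "L2_tendsto lebesgue (\<lambda>n. fourier_integral (s n)) g"
    using assms(1) unfolding fourier_pair_def by metis
  note sD = L2_tendsto_D[OF s(2)] and hD = L2_tendsto_D[OF s(3)]
  have sm: "s n \<in> borel_measurable lebesgue" "fourier_integral (s n) \<in> borel_measurable lebesgue"
    "f \<in> borel_measurable lebesgue" "g \<in> borel_measurable lebesgue" for n
    using sD hD by (auto intro: L2_space_measurable)
  have le: "energy lebesgue g \<le> 2 * energy lebesgue (\<lambda>x. fourier_integral (s n) x - g x) +
      2 * (2 * energy lebesgue (\<lambda>x. s n x - f x)) + 4 * energy lebesgue f" for n
  proof -
    have "energy lebesgue g \<le> 2 * energy lebesgue (\<lambda>x. g x - fourier_integral (s n) x) + 2 * energy lebesgue (fourier_integral (s n))"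
      using energy_add_le[of "\<lambda>x. g x - fourier_integral (s n) x" lebesgue "fourier_integral (s n)"]
        borel_measurable_diff[OF sm(4) sm(2)] sm(2) by simp
    also have "energy lebesgue (fourier_integral (s n)) \<le> energy lebesgue (s n)"
      by (rule energy_fourier_integral_le[OF s(1)])
    also have "energy lebesgue (s n) \<le> 2 * energy lebesgue (\<lambda>x. s n x - f x) + 2 * energy lebesgue f"
      using energy_add_le[of "\<lambda>x. s n x - f x" lebesgue f] borel_measurable_diff[OF sm(1) sm(3)] sm(3) by simp
    finally have "energy lebesgue g \<le> 2 * energy lebesgue (\<lambda>x. g x - fourier_integral (s n) x) +
       2 * (2 * energy lebesgue (\<lambda>x. s n x - f x) + 2 * energy lebesgue f)"
      by (simp add: add_left_mono mult_left_mono)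
    moreover have "2 * (2 * energy lebesgue (\<lambda>x. s n x - f x) + 2 * energy lebesgue f) =
       2 * (2 * energy lebesgue (\<lambda>x. s n x - f x)) + 4 * energy lebesgue f"
      by (simp add: distrib_left mult.assoc[symmetric])
    ultimately show ?thesis by (simp add: energy_minus_commute[of _ g] add.assoc)
  qed
  have "(\<lambda>n. 2 * energy lebesgue (\<lambda>x. s n x - f x)) \<longlonglongrightarrow> 2 * 0"
    by (intro ennreal_tendsto_cmult sD(3)) simp
  then have "(\<lambda>n. 2 * energy lebesgue (\<lambda>x. fourier_integral (s n) x - g x) + 2 * (2 * energy lebesgue (\<lambda>x. s n x - f x))) \<longlonglongrightarrow> 0"
    by (intro tendsto_0_double_sum_ennreal hD(3)) simp
  then have "(\<lambda>n. 2 * energy lebesgue (\<lambda>x. fourier_integral (s n) x - g x) + 2 * (2 * energy lebesgue (\<lambda>x. s n x - f x)) + 4 * energy lebesgue f)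
     \<longlonglongrightarrow> 0 + 4 * energy lebesgue f"
    by (intro tendsto_add tendsto_const)
  then show ?thesis
    using le by (intro LIMSEQ_le_const[where X="\<lambda>n. 2 * energy lebesgue (\<lambda>x. fourier_integral (s n) x - g x) + 2 * (2 * energy lebesgue (\<lambda>x. s n x - f x)) + 4 * energy lebesgue f"]) auto
qed

lemma fourier_pair_zero:
  assumes "fourier_pair f g" "AE x in lebesgue. f x = 0"
  shows "AE x in lebesgue. g x = 0"
proof -
  have m: "f \<in> borel_measurable lebesgue" "g \<in> borel_measurable lebesgue"
    using fourier_pair_L2[OF assms(1)] by (auto intro: L2_space_measurable)
  have "energy lebesgue f = 0" using assms(2) energy_eq_0_iff[OF m(1)] by simp
  then have "energy lebesgue g = 0" using fourier_pair_energy_le[OF assms(1)] by simp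
  then show ?thesis using energy_eq_0_iff[OF m(2)] by simp
qed

lemma fourier_pair_unique:
  assumes "fourier_pair f g" "fourier_pair f' g'" "AE x in lebesgue. f x = f' x"
  shows "AE x in lebesgue. g x = g' x"
  using fourier_pair_zero[OF fourier_pair_diff[OF assms(1,2)]] assms(3) by simp

lemma fourier_pair_closed:
  assumes p: "\<And>n. fourier_pair (f n) (g n)"
    and f: "L2_tendsto lebesgue f F" and g: "L2_tendsto lebesgue g G"
  shows "fourier_pair F G"
proof -
  note fD = L2_tendsto_D[OF f] and gD = L2_tendsto_D[OF g]
  obtain G' where G': "fourier_pair F G'" using fourier_pair_exists[OF fD(2)] by blast
  have "L2_tendsto lebesgue g G'"
    unfolding L2_tendsto_iff_energy
  proof (intro conjI allI gD(1) fourier_pair_L2(2)[OF G'])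
    have "(\<lambda>n. 4 * energy lebesgue (\<lambda>x. f n x - F x)) \<longlonglongrightarrow> 4 * 0"
      by (intro ennreal_tendsto_cmult fD(3)) simp
    then have "(\<lambda>n. 4 * energy lebesgue (\<lambda>x. f n x - F x)) \<longlonglongrightarrow> 0" by simp
    then show "(\<lambda>n. energy lebesgue (\<lambda>x. g n x - G' x)) \<longlonglongrightarrow> 0"
      by (rule tendsto_0_le_ennreal) (intro always_eventually allI fourier_pair_energy_le fourier_pair_diff p G')
  qed
  then have eq: "AE x in lebesgue. G' x = G x" by (rule L2_tendsto_unique[OF _ g])
  obtain s where s: "\<And>n. integrable lebesgue (s n)" "L2_tendsto lebesgue s F"
    "L2_tendsto lebesgue (\<lambda>n. fourier_integral (s n)) G'"
    using G' unfolding fourier_pair_def by metis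
  have "L2_tendsto lebesgue (\<lambda>n. fourier_integral (s n)) G"
    by (rule L2_tendsto_cong_AE[OF s(3) eq L2_space_measurable[OF gD(2)]])
  then show ?thesis using s unfolding fourier_pair_def by blast
qed

text \<open>
  The functions \<open>s\<^sub>n\<close> obtained from the transform of \<open>f\<close> by Gaussian damping are integrable and
  converge to the transform in \<open>L\<^sup>2\<close>; the limit of their own transforms is the reflection of
  \<open>f\<close>.
\<close>

lemma fourier_pair_inversion_integrable:
  fixes f :: "real^'d \<Rightarrow> complex"
  assumes f: "integrable lebesgue f" "f \<in> L2_space lebesgue"
  shows "fourier_pair (fourier_integral f) (\<lambda>x. f (- x))"
proof -
  obtain g where g: "integrable lborel g" "AE x in lebesgue. f x = g x" "fourier_integral f = ft g"
    using integrable_borel_representative[OF f(1)] by metis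
  have gm [measurable]: "g \<in> borel_measurable borel" using g(1) by auto
  let ?s = "\<lambda>n \<omega>. complex_of_real (gauss_weight (approx_scale n) \<omega>) * ft g \<omega>"
  have sm [measurable]: "?s n \<in> borel_measurable borel" for n by measurable
  have sint: "integrable lborel (?s n)" for n
    by (rule integrable_gauss_weight_ft[OF approx_scale_pos g(1)])
  have sint': "integrable lebesgue (?s n)" for n
    using sint by (subst integrable_completion) simp_all
  have ft_s: "fourier_integral (?s n) = ft (?s n)" for n
    by (rule fourier_integral_eq_ft) (auto intro!: measurable_completion)
  have fin: "energy lborel (ft g) < \<infinity>"
    using fourier_integral_L2[OF f] unfolding g(3) L2_space_iff_energy energy_lebesgue by simp
  have W: "cmod (complex_of_real (gauss_weight (approx_scale n) \<omega>)) \<le> 1"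
    "cmod (complex_of_real (gauss_weight (approx_scale n) \<omega>) - 1) \<le> 1" for n and \<omega> :: "real^'d"
  proof -
    have w: "0 < gauss_weight (approx_scale n) \<omega>" "gauss_weight (approx_scale n) \<omega> \<le> 1"
      by (rule gauss_weight_pos, rule gauss_weight_le_1)
    then show "cmod (complex_of_real (gauss_weight (approx_scale n) \<omega>)) \<le> 1"
      by simp
    have "complex_of_real (gauss_weight (approx_scale n) \<omega>) - 1 = complex_of_real (gauss_weight (approx_scale n) \<omega> - 1)"
      by simp
    then have "cmod (complex_of_real (gauss_weight (approx_scale n) \<omega>) - 1) = \<bar>gauss_weight (approx_scale n) \<omega> - 1\<bar>"
      by (simp only: norm_of_real)
    then show "cmod (complex_of_real (gauss_weight (approx_scale n) \<omega>) - 1) \<le> 1" using w by simp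
  qed
  have "ft g \<in> L2_space lborel" using fin by (simp add: L2_space_iff_energy)
  then have sL2: "?s n \<in> L2_space lborel" for n
    by (intro L2_space_bounded_mult[where C=1] AE_I2 W(1)) measurable
  have "(\<lambda>n. energy lborel (\<lambda>\<omega>. ?s n \<omega> - ft g \<omega>)) \<longlonglongrightarrow> (\<integral>\<^sup>+\<omega>. 0 \<partial>(lborel :: (real^'d) measure))"
    unfolding energy_def
  proof (rule nn_integral_dominated_convergence[where w="\<lambda>\<omega>. ennreal ((cmod (ft g \<omega>))\<^sup>2)"])
    have diff: "?s n \<omega> - ft g \<omega> = (complex_of_real (gauss_weight (approx_scale n) \<omega>) - 1) * ft g \<omega>" for n \<omega>
      by (simp add: algebra_simps)
    show "AE \<omega> in lborel. ennreal ((cmod (?s n \<omega> - ft g \<omega>))\<^sup>2) \<le> ennreal ((cmod (ft g \<omega>))\<^sup>2)" for n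
    proof (rule AE_I2)
      fix \<omega>
      have "cmod (?s n \<omega> - ft g \<omega>) \<le> 1 * cmod (ft g \<omega>)"
        unfolding diff norm_mult by (intro mult_right_mono W(2)) simp
      then show "ennreal ((cmod (?s n \<omega> - ft g \<omega>))\<^sup>2) \<le> ennreal ((cmod (ft g \<omega>))\<^sup>2)"
        by (intro ennreal_leI power_mono) simp_all
    qed
    show "(\<integral>\<^sup>+\<omega>. ennreal ((cmod (ft g \<omega>))\<^sup>2) \<partial>lborel) < \<infinity>" using fin by (simp add: energy_def)
    show "AE \<omega> in lborel. (\<lambda>n. ennreal ((cmod (?s n \<omega> - ft g \<omega>))\<^sup>2)) \<longlonglongrightarrow> 0"
    proof (rule AE_I2)
      fix \<omega>
      have "(\<lambda>n. ennreal ((cmod (?s n \<omega> - ft g \<omega>))\<^sup>2)) \<longlonglongrightarrow> ennreal ((cmod (complex_of_real 1 * ft g \<omega> - ft g \<omega>))\<^sup>2)"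
        by (intro tendsto_intros gauss_weight_tendsto)
      then show "(\<lambda>n. ennreal ((cmod (?s n \<omega> - ft g \<omega>))\<^sup>2)) \<longlonglongrightarrow> 0" by simp
    qed
  qed measurable
  then have lim: "L2_tendsto lborel ?s (ft g)"
    using sL2 fin by (simp add: L2_tendsto_iff_energy L2_space_iff_energy)
  then have lim': "L2_tendsto lebesgue ?s (ft g)"
    by (subst (asm) L2_tendsto_lborel_iff) simp_all
  obtain h where h: "L2_tendsto lebesgue (\<lambda>n. fourier_integral (?s n)) h"
    using L2_tendsto_fourier_integral[OF sint' lim'] by auto
  obtain h' where h': "h' \<in> borel_measurable borel" "AE x in lebesgue. h x = h' x"
    using borel_representative[OF L2_space_measurable[OF L2_tendsto_D(2)[OF h]]] by metis
  have "L2_tendsto lebesgue (\<lambda>n. ft (?s n)) h'"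
    using L2_tendsto_cong_AE[OF h h'(2)] h'(1) unfolding ft_s by (simp add: measurable_completion)
  then have "L2_tendsto lborel (\<lambda>n. ft (?s n)) h'"
    by (subst L2_tendsto_lborel_iff) (use h' in simp_all)
  then have "AE x in lborel. h' x = g (- x)" by (rule ft_inversion[OF g(1)])
  then have 1: "AE x in lebesgue. h' x = g (- x)" by (rule AE_completion)
  have "AE x in distr lebesgue lebesgue uminus. f x = g x"
    unfolding distr_lebesgue_uminus by (rule g(2))
  then have 2: "AE x in lebesgue. f (- x) = g (- x)"
    by (rule AE_distrD[OF measurable_lebesgue_uminus])
  have "AE x in lebesgue. h x = f (- x)"
    using h'(2) 1 2 by eventually_elim simp
  then have "L2_tendsto lebesgue (\<lambda>n. fourier_integral (?s n)) (\<lambda>x. f (- x))"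
    by (rule L2_tendsto_cong_AE[OF h]) (rule measurable_lebesgue_reflect[OF L2_space_measurable[OF f(2)]])
  then show ?thesis
    unfolding fourier_pair_def g(3) by (intro exI[of _ ?s] conjI allI sint' lim')
qed

text \<open>
  Both sides of the integrable case are \<open>L\<^sup>2\<close> continuous.  As the relation is total and
  single-valued, one application of this rule gives injectivity and three give surjectivity.
\<close>

theorem fourier_pair_inversion:
  fixes f g :: "real^'d \<Rightarrow> complex"
  assumes "fourier_pair f g"
  shows "fourier_pair g (\<lambda>x. f (- x))"
proof -
  obtain s where s: "\<And>n. integrable lebesgue (s n)" "L2_tendsto lebesgue s f"
    "L2_tendsto lebesgue (\<lambda>n. fourier_integral (s n)) g"
    using assms(1) unfolding fourier_pair_def by metis
  show ?thesis
    by (rule fourier_pair_closed[OF fourier_pair_inversion_integrable[OF s(1) L2_tendsto_D(1)[OF s(2)]] s(3)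
        L2_tendsto_reflect[OF s(2)]])
qed

lemma fourier_pair_fourier:
  assumes "f \<in> L2_space lebesgue" shows "fourier_pair f (fourier f)"
  using someI_ex[OF fourier_pair_exists[OF assms]] unfolding fourier_def fourier_pair_def .

lemma fourier_L2: "f \<in> L2_space lebesgue \<Longrightarrow> fourier f \<in> L2_space lebesgue"
  by (rule fourier_pair_L2(2)[OF fourier_pair_fourier])

lemma fourier_eqI: "fourier_pair f g \<Longrightarrow> AE x in lebesgue. fourier f x = g x"
  by (rule fourier_pair_unique[OF fourier_pair_fourier[OF fourier_pair_L2(1)]]) auto

lemma fourier_add:
  assumes "f \<in> L2_space lebesgue" "g \<in> L2_space lebesgue"
  shows "AE x in lebesgue. fourier (\<lambda>x. f x + g x) x = fourier f x + fourier g x"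
  by (rule fourier_eqI) (intro fourier_pair_add fourier_pair_fourier assms)

lemma fourier_cong_AE:
  assumes "f \<in> L2_space lebesgue" "g \<in> L2_space lebesgue" "AE x in lebesgue. f x = g x"
  shows "AE x in lebesgue. fourier f x = fourier g x"
  by (rule fourier_pair_unique[OF fourier_pair_fourier fourier_pair_fourier]) (use assms in auto)

lemma fourier_zero: "AE x in lebesgue. fourier (\<lambda>x. 0) x = 0"
  by (rule fourier_pair_zero[OF fourier_pair_fourier[OF L2_space_zero]]) simp

lemma fourier_sum:
  assumes "\<And>i. i \<in> I \<Longrightarrow> f i \<in> L2_space lebesgue"
  shows "AE x in lebesgue. fourier (\<lambda>x. \<Sum>i\<in>I. f i x) x = (\<Sum>i\<in>I. fourier (f i) x)"
  using assms
proof (induction I rule: infinite_finite_induct)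
  case (insert i I)
  have "AE x in lebesgue. fourier (\<lambda>x. \<Sum>i\<in>I. f i x) x = (\<Sum>i\<in>I. fourier (f i) x)"
    using insert by simp
  moreover have "AE x in lebesgue. fourier (\<lambda>x. f i x + (\<Sum>i\<in>I. f i x)) x = fourier (f i) x + fourier (\<lambda>x. \<Sum>i\<in>I. f i x) x"
    by (rule fourier_add) (use insert.prems in \<open>auto intro!: L2_space_sum\<close>)
  ultimately have "AE x in lebesgue. fourier (\<lambda>x. f i x + (\<Sum>i\<in>I. f i x)) x = fourier (f i) x + (\<Sum>i\<in>I. fourier (f i) x)"
    by eventually_elim simp
  then show ?case using insert.hyps by simp
qed (simp_all add: fourier_zero)

theorem fourier_injective:
  assumes "f \<in> L2_space lebesgue" "g \<in> L2_space lebesgue" "AE x in lebesgue. fourier f x = fourier g x"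
  shows "AE x in lebesgue. f x = g x"
proof -
  have "AE x in lebesgue. f (- x) = g (- x)"
    by (rule fourier_pair_unique[OF fourier_pair_inversion[OF fourier_pair_fourier[OF assms(1)]]
         fourier_pair_inversion[OF fourier_pair_fourier[OF assms(2)]] assms(3)])
  then have "AE x in distr lebesgue lebesgue uminus. f (- x) = g (- x)"
    unfolding distr_lebesgue_uminus .
  then have "AE x in lebesgue. f (- (- x)) = g (- (- x))"
    by (rule AE_distrD[OF measurable_lebesgue_uminus])
  then show ?thesis by simp
qed

text \<open>
  If \<open>h\<close> is the transform of \<open>g\<close>, then the reflection of \<open>h\<close> has the transform \<open>g\<close>.
\<close>

theorem fourier_surjective:
  assumes "g \<in> L2_space lebesgue"
  obtains f where "f \<in> L2_space lebesgue" "AE x in lebesgue. fourier f x = g x"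
proof -
  obtain h where "fourier_pair g h" using fourier_pair_exists[OF assms] by blast
  from fourier_pair_inversion[OF fourier_pair_inversion[OF fourier_pair_inversion[OF this]]]
  have "fourier_pair (\<lambda>x. h (- x)) g" by simp
  then show ?thesis by (intro that[of "\<lambda>x. h (- x)"] fourier_pair_L2(1) fourier_eqI)
qed

section \<open>Trigonometric sums on the unit cube\<close>

definition fourier_char :: "int^'d \<Rightarrow> real^'d \<Rightarrow> complex" where
  "fourier_char k \<omega> = cis (- (2 * pi * (\<omega> \<bullet> of_zvec k)))"

lemma fourier_char_measurable [measurable]: "fourier_char k \<in> borel_measurable borel"
  unfolding fourier_char_def by measurable

lemma cmod_fourier_char [simp]: "cmod (fourier_char k \<omega>) = 1"
  by (simp add: fourier_char_def)

lemma of_zvec_add: "of_zvec (k + l) = of_zvec k + of_zvec l"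
  by (simp add: of_zvec_def vec_eq_iff)

lemma of_zvec_uminus: "of_zvec (- k) = - of_zvec k"
  by (simp add: of_zvec_def vec_eq_iff)

lemma of_zvec_zero: "of_zvec 0 = 0"
  by (simp add: of_zvec_def vec_eq_iff)

lemma fourier_char_mult: "fourier_char k \<omega> * fourier_char l \<omega> = fourier_char (k + l) \<omega>"
  by (simp add: fourier_char_def cis_mult of_zvec_add inner_add_right distrib_left)

lemma fourier_char_zero: "fourier_char 0 \<omega> = 1"
  by (simp add: fourier_char_def of_zvec_zero)

lemma cnj_fourier_char: "cnj (fourier_char k \<omega>) = fourier_char (- k) \<omega>"
  by (simp add: fourier_char_def cis_cnj of_zvec_uminus)

lemma unit_cube_borel [measurable]: "unit_cube \<in> sets (borel :: (real^'d) measure)"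
  unfolding unit_cube_def by measurable

lemma unit_cube_lebesgue [measurable]: "unit_cube \<in> sets (lebesgue :: (real^'d) measure)"
  using unit_cube_borel by simp

lemma indicator_unit_cube: "indicat_real unit_cube (\<omega> :: real^'d) = (\<Prod>i\<in>UNIV. indicat_real {0..<1} (\<omega> $ i))"
proof (cases "\<omega> \<in> unit_cube")
  case True
  then show ?thesis by (simp add: unit_cube_def)
next
  case False
  then obtain i where "\<omega> $ i \<notin> {0..<1}" by (auto simp: unit_cube_def not_le not_less)
  then have "indicat_real {0..<1} (\<omega> $ i) = 0" by simp
  then have "(\<Prod>i\<in>UNIV. indicat_real {0..<1} (\<omega> $ i)) = 0" by (intro prod_zero) auto
  then show ?thesis using False by simp
qed

lemma
  fixes n :: int
  shows integrable_char_1: "integrable lborel (\<lambda>u. complex_of_real (indicat_real {0..<1} u) * cis (2 * pi * (real_of_int n * u)))"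
    and integral_char_1: "(\<integral>u. complex_of_real (indicat_real {0..<1} u) * cis (2 * pi * (real_of_int n * u)) \<partial>lborel) = (if n = 0 then 1 else 0)"
proof -
  let ?c = "\<lambda>u::real. cis (2 * pi * (real_of_int n * u))"
  have ind: "integrable lborel (\<lambda>u. complex_of_real (indicat_real {0..<1::real} u))"
    by (intro integrable_of_real integrable_real_indicator) simp_all
  then show "integrable lborel (\<lambda>u. complex_of_real (indicat_real {0..<1} u) * ?c u)"
    by (rule integrable_times_cis) measurable
  have "AE u in lborel. (u::real) \<noteq> 1" by (rule AE_lborel_singleton)
  then have AE: "AE u in lborel. complex_of_real (indicat_real {0..<1} u) * ?c u = indicat_real {0..1} u *\<^sub>R ?c u"
    by eventually_elim (auto simp: indicator_def)
  have eq: "(\<integral>u. complex_of_real (indicat_real {0..<1} u) * ?c u \<partial>lborel) = (\<integral>u. indicat_real {0..1} u *\<^sub>R ?c u \<partial>lborel)"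
    by (rule integral_cong_AE[OF _ _ AE]) measurable
  show "(\<integral>u. complex_of_real (indicat_real {0..<1} u) * ?c u \<partial>lborel) = (if n = 0 then 1 else 0)"
  proof (cases "n = 0")
    case True
    then show ?thesis unfolding eq by (simp add: scaleR_conv_of_real)
  next
    case False
    let ?F = "\<lambda>u. ?c u / (2 * pi * n * \<i>)"
    have nz: "complex_of_real (2 * pi * n) * \<i> \<noteq> 0" using False by simp
    have deriv: "(?F has_vector_derivative ?c u) (at u within {0..1})" for u :: real
    proof -
      have "((\<lambda>u. exp (\<i> * complex_of_real (2 * pi * (real_of_int n * u))) / (2 * pi * n * \<i>)) has_vector_derivative
         exp (\<i> * complex_of_real (2 * pi * (real_of_int n * u)))) (at u within {0..1})"
        using nz by (auto intro!: derivative_eq_intros has_vector_derivative_real_field simp: field_simps)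
      then show ?thesis by (simp add: cis_conv_exp)
    qed
    have "(\<integral>u. indicat_real {0..1} u *\<^sub>R ?c u \<partial>lborel) = ?F 1 - ?F 0"
      by (rule integral_FTC_Icc) (use deriv in \<open>auto intro!: continuous_intros\<close>)
    also have "\<dots> = 0"
      using cis_multiple_2pi[of "real_of_int n"] by (simp add: mult_ac)
    finally show ?thesis using False unfolding eq by simp
  qed
qed

lemma integral_fourier_char:
  "(\<integral>\<omega>. indicat_real unit_cube \<omega> *\<^sub>R fourier_char k \<omega> \<partial>(lborel :: (real^'d) measure)) = (if k = 0 then 1 else 0)"
proof -
  let ?f = "\<lambda>i u. complex_of_real (indicat_real {0..<1} u) * cis (2 * pi * (real_of_int (- (k $ i)) * u))"
  have cis_sum: "cis (\<Sum>i\<in>A. h i) = (\<Prod>i\<in>A. cis (h i))" if "finite A" for A :: "'d set" and h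
    using that by (induction A) (auto simp: cis_mult[symmetric])
  have "indicat_real unit_cube \<omega> *\<^sub>R fourier_char k \<omega> = (\<Prod>i\<in>UNIV. ?f i (\<omega> $ i))" for \<omega>
  proof -
    have "fourier_char k \<omega> = cis (\<Sum>i\<in>UNIV. 2 * pi * (real_of_int (- (k $ i)) * \<omega> $ i))"
      unfolding fourier_char_def inner_vec_def of_zvec_def
      by (simp add: sum_distrib_left sum_negf[symmetric] mult_ac)
    also have "\<dots> = (\<Prod>i\<in>UNIV. cis (2 * pi * (real_of_int (- (k $ i)) * \<omega> $ i)))"
      by (rule cis_sum) simp
    finally show ?thesis
      unfolding indicator_unit_cube by (simp add: scaleR_conv_of_real prod.distrib)
  qed
  then have "(\<integral>\<omega>. indicat_real unit_cube \<omega> *\<^sub>R fourier_char k \<omega> \<partial>(lborel :: (real^'d) measure)) = (\<Prod>i\<in>UNIV. integral\<^sup>L lborel (?f i))"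
    using integral_prod_vec[of ?f, OF integrable_char_1] by (simp only:)
  also have "\<dots> = (\<Prod>i\<in>UNIV. if k $ i = 0 then 1 else 0)"
    unfolding integral_char_1 by simp
  also have "\<dots> = (if k = 0 then 1 else 0)"
  proof (cases "k = 0")
    case False
    then obtain i where "k $ i \<noteq> 0" by (auto simp: vec_eq_iff)
    then have "(\<Prod>i\<in>UNIV. if k $ i = 0 then 1 else (0::complex)) = 0" by (intro prod_zero) auto
    then show ?thesis using False by simp
  qed simp
  finally show ?thesis .
qed

abbreviation cube :: "(real^'d) measure" where
  "cube \<equiv> lebesgue_on unit_cube"

lemma integral_cube: "(\<integral>\<omega>. f \<omega> \<partial>cube) = (\<integral>\<omega>. indicat_real unit_cube \<omega> *\<^sub>R (f \<omega> :: complex) \<partial>lebesgue)"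
  by (rule integral_restrict_space) simp

lemma integral_cube_borel:
  assumes [measurable]: "f \<in> borel_measurable borel"
  shows "(\<integral>\<omega>. f \<omega> \<partial>cube) = (\<integral>\<omega>. indicat_real unit_cube \<omega> *\<^sub>R (f \<omega> :: complex) \<partial>lborel)"
  unfolding integral_cube by (rule integral_completion) measurable

lemma measurable_cube: "f \<in> borel_measurable borel \<Longrightarrow> f \<in> borel_measurable cube"
  by (intro measurable_restrict_space1 measurable_completion) simp

lemma fourier_char_measurable_cube [measurable]: "fourier_char k \<in> borel_measurable cube"
  by (intro measurable_cube fourier_char_measurable)

lemma emeasure_cube: "emeasure (cube :: (real^'d) measure) (space (cube :: (real^'d) measure)) = emeasure lborel (unit_cube :: (real^'d) set)"
  by (simp add: emeasure_restrict_space)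

lemma emeasure_unit_cube_finite: "emeasure lborel (unit_cube :: (real^'d) set) < \<infinity>"
proof -
  have "unit_cube \<subseteq> cbox (0 :: real^'d) (\<chi> i. 1)"
    by (auto simp: unit_cube_def mem_box_cart less_imp_le)
  then have "emeasure lborel (unit_cube :: (real^'d) set) \<le> emeasure lborel (cbox (0 :: real^'d) (\<chi> i. 1))"
    by (intro emeasure_mono) auto
  also have "\<dots> < \<infinity>" by (rule emeasure_lborel_cbox_finite)
  finally show ?thesis .
qed

lemma finite_cube_measure: "finite_measure (cube :: (real^'d) measure)"
proof (rule finite_measureI)
  show "emeasure (cube :: (real^'d) measure) (space (cube :: (real^'d) measure)) \<noteq> \<infinity>"
    unfolding emeasure_cube using emeasure_unit_cube_finite[where 'd='d] by simp
qed

lemma integral_fourier_char_cube: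
  "(\<integral>\<omega>. fourier_char k \<omega> \<partial>cube) = (if k = 0 then 1 else 0)"
  by (simp only: integral_cube_borel[OF fourier_char_measurable] integral_fourier_char)

lemma bounded_in_L2_cube:
  assumes [measurable]: "f \<in> borel_measurable cube" and "AE \<omega> in cube. cmod (f \<omega>) \<le> C"
  shows "f \<in> L2_space cube"
proof -
  interpret finite_measure cube by (rule finite_cube_measure)
  have "integrable cube (\<lambda>\<omega>. (cmod (f \<omega>))\<^sup>2)"
  proof (rule integrable_const_bound[where B="C\<^sup>2"])
    show "AE \<omega> in cube. norm ((cmod (f \<omega>))\<^sup>2) \<le> C\<^sup>2"
      using assms(2) by eventually_elim (simp add: power_mono)
  qed measurable
  then show ?thesis by (simp add: L2_space_def)
qed

lemma L2_cube_integrable: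
  assumes "f \<in> L2_space cube"
  shows "integrable cube f"
proof -
  interpret finite_measure cube by (rule finite_cube_measure)
  have "set_integrable cube (space cube) f"
    by (rule L2_set_integrable[OF assms]) (auto simp: less_top[symmetric])
  then show ?thesis
    unfolding set_integrable_def
    by (rule integrable_cong_AE_imp) (use L2_space_measurable[OF assms] in auto)
qed

definition trig_sum :: "(int^'d \<Rightarrow> complex) \<Rightarrow> (int^'d) set \<Rightarrow> real^'d \<Rightarrow> complex" where
  "trig_sum a F \<omega> = (\<Sum>k\<in>F. a k * fourier_char k \<omega>)"

lemma trig_sum_measurable [measurable]: "trig_sum a F \<in> borel_measurable borel"
  unfolding trig_sum_def by measurable

lemma trig_sum_measurable_cube [measurable]: "trig_sum a F \<in> borel_measurable cube"
  by (intro measurable_cube trig_sum_measurable)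

lemma trig_sum_L2: "trig_sum a F \<in> L2_space cube"
proof (rule bounded_in_L2_cube[where C="\<Sum>k\<in>F. cmod (a k)"])
  show "AE \<omega> in cube. cmod (trig_sum a F \<omega>) \<le> (\<Sum>k\<in>F. cmod (a k))"
    unfolding trig_sum_def by (intro AE_I2 order_trans[OF norm_sum]) (simp add: norm_mult)
qed measurable

lemma fourier_char_L2: "fourier_char k \<in> L2_space cube"
  by (rule bounded_in_L2_cube[where C=1]) auto

lemma integrable_mult_char:
  assumes "integrable cube f" shows "integrable cube (\<lambda>\<omega>. f \<omega> * fourier_char k \<omega>)"
  by (rule Bochner_Integration.integrable_bound[OF assms])
     (use borel_measurable_integrable[OF assms] in \<open>auto simp: norm_mult\<close>)

text \<open>
  Orthonormality of the characters.
\<close>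

lemma trig_sum_coefficient:
  assumes "finite F"
  shows "(\<integral>\<omega>. trig_sum a F \<omega> * cnj (fourier_char l \<omega>) \<partial>cube) = (if l \<in> F then a l else 0)"
proof -
  have int: "integrable cube (fourier_char k)" for k
    by (rule L2_cube_integrable[OF fourier_char_L2])
  have "(\<integral>\<omega>. trig_sum a F \<omega> * cnj (fourier_char l \<omega>) \<partial>cube) = (\<integral>\<omega>. (\<Sum>k\<in>F. a k * fourier_char (k - l) \<omega>) \<partial>cube)"
    unfolding trig_sum_def sum_distrib_right cnj_fourier_char mult.assoc fourier_char_mult by simp
  also have "\<dots> = (\<Sum>k\<in>F. a k * (\<integral>\<omega>. fourier_char (k - l) \<omega> \<partial>cube))"
    by (subst Bochner_Integration.integral_sum) (auto intro!: int integrable_mult_right)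
  also have "\<dots> = (\<Sum>k\<in>F. if k = l then a l else 0)"
    unfolding integral_fourier_char_cube by (intro sum.cong) auto
  finally show ?thesis using assms by simp
qed

lemma energy_trig_sum:
  assumes "finite F"
  shows "energy cube (trig_sum a F) = ennreal (\<Sum>k\<in>F. (cmod (a k))\<^sup>2)"
proof -
  let ?M = "cube :: (real^'a) measure"
  have int: "integrable ?M (trig_sum a F)" by (rule L2_cube_integrable[OF trig_sum_L2])
  have "complex_of_real (\<integral>\<omega>. (cmod (trig_sum a F \<omega>))\<^sup>2 \<partial>?M) = (\<integral>\<omega>. complex_of_real ((cmod (trig_sum a F \<omega>))\<^sup>2) \<partial>?M)"
    by (simp only: integral_complex_of_real)
  also have "\<dots> = (\<integral>\<omega>. (\<Sum>k\<in>F. cnj (a k) * (trig_sum a F \<omega> * cnj (fourier_char k \<omega>))) \<partial>?M)"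
  proof (intro Bochner_Integration.integral_cong refl)
    fix \<omega>
    have "complex_of_real ((cmod (trig_sum a F \<omega>))\<^sup>2) = trig_sum a F \<omega> * cnj (trig_sum a F \<omega>)"
      by (rule complex_norm_square)
    also have "cnj (trig_sum a F \<omega>) = (\<Sum>k\<in>F. cnj (a k) * cnj (fourier_char k \<omega>))"
      by (simp add: trig_sum_def)
    finally show "complex_of_real ((cmod (trig_sum a F \<omega>))\<^sup>2) = (\<Sum>k\<in>F. cnj (a k) * (trig_sum a F \<omega> * cnj (fourier_char k \<omega>)))"
      by (simp add: sum_distrib_left mult_ac)
  qed
  also have "\<dots> = (\<Sum>k\<in>F. cnj (a k) * (\<integral>\<omega>. trig_sum a F \<omega> * cnj (fourier_char k \<omega>) \<partial>?M))"
    by (subst Bochner_Integration.integral_sum)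
       (auto simp: cnj_fourier_char intro!: integrable_mult_right integrable_mult_char int)
  also have "\<dots> = (\<Sum>k\<in>F. complex_of_real ((cmod (a k))\<^sup>2))"
    unfolding trig_sum_coefficient[OF assms] by (intro sum.cong refl) (simp add: complex_norm_square[symmetric] mult.commute)
  finally have "(\<integral>\<omega>. (cmod (trig_sum a F \<omega>))\<^sup>2 \<partial>?M) = (\<Sum>k\<in>F. (cmod (a k))\<^sup>2)"
    unfolding of_real_sum[symmetric] of_real_eq_iff .
  then show ?thesis
    using L2_norm_energy(1)[OF trig_sum_L2[of a F]] by (simp only: L2_norm_power2)
qed

section \<open>Convergence of Fourier series\<close>

lemma ell2_finite_sum_le:
  fixes a :: "'k \<Rightarrow> complex"
  assumes "finite F"
  shows "ennreal (\<Sum>k\<in>F. (cmod (a k))\<^sup>2) \<le> energy (count_space UNIV) a"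
proof -
  have "ennreal (\<Sum>k\<in>F. (cmod (a k))\<^sup>2) = (\<Sum>k\<in>F. ennreal ((cmod (a k))\<^sup>2))"
    by (rule sum_ennreal[symmetric]) simp
  also have "\<dots> = (\<integral>\<^sup>+k. ennreal ((cmod (a k))\<^sup>2) \<partial>count_space F)"
    by (rule nn_integral_count_space_finite[OF assms, symmetric])
  also have "\<dots> = (\<integral>\<^sup>+k. ennreal ((cmod (a k))\<^sup>2) * indicator F k \<partial>count_space UNIV)"
    by (simp add: nn_integral_count_space_indicator)
  also have "\<dots> \<le> energy (count_space UNIV) a"
    unfolding energy_def by (intro nn_integral_mono) (auto simp: indicator_def)
  finally show ?thesis .
qed

lemma ell2_iff_energy: "a \<in> ell2 \<longleftrightarrow> energy (count_space UNIV) a < \<infinity>"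
  by (simp add: L2_space_iff_energy)

text \<open>
  An increasing exhaustion of a countable type by finite sets, along which unconditional limits
  can be replaced by limits of sequences.
\<close>

definition enum_below :: "nat \<Rightarrow> 'k::countable set" where
  "enum_below n = {k. to_nat k < n}"

lemma finite_enum_below: "finite (enum_below n)"
proof -
  have "enum_below n \<subseteq> from_nat ` {..<n}"
    by (auto simp: enum_below_def) (metis from_nat_to_nat image_eqI lessThan_iff)
  then show ?thesis by (rule finite_subset) simp
qed

lemma ell2_tail:
  fixes a :: "'k::countable \<Rightarrow> complex"
  assumes "a \<in> ell2"
  shows "(\<lambda>n. energy (count_space UNIV) (\<lambda>k. a k * indicator (- enum_below n) k)) \<longlonglongrightarrow> 0"
proof -
  have "(\<lambda>n. energy (count_space UNIV) (\<lambda>k. a k * indicator (- enum_below n) k)) \<longlonglongrightarrow> (\<integral>\<^sup>+k. 0 \<partial>(count_space (UNIV::'k set)))"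
    unfolding energy_def
  proof (rule nn_integral_dominated_convergence[where w="\<lambda>k. ennreal ((cmod (a k))\<^sup>2)"])
    show "(\<integral>\<^sup>+k. ennreal ((cmod (a k))\<^sup>2) \<partial>count_space UNIV) < \<infinity>"
      using assms by (simp add: ell2_iff_energy energy_def)
    show "AE k in count_space UNIV. (\<lambda>n. ennreal ((cmod (a k * indicator (- enum_below n) k))\<^sup>2)) \<longlonglongrightarrow> 0"
    proof (rule AE_I2)
      fix k :: 'k
      have "\<forall>\<^sub>F n in sequentially. ennreal ((cmod (a k * indicator (- enum_below n) k))\<^sup>2) = 0"
        unfolding eventually_sequentially
        by (rule exI[of _ "Suc (to_nat k)"]) (auto simp: enum_below_def indicator_def)
      then show "(\<lambda>n. ennreal ((cmod (a k * indicator (- enum_below n) k))\<^sup>2)) \<longlonglongrightarrow> 0" by (rule tendsto_eventually)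
    qed
  qed (auto simp: indicator_def)
  then show ?thesis by simp
qed

lemma trig_sum_diff:
  assumes "finite F" "G \<subseteq> F"
  shows "trig_sum a F \<omega> - trig_sum a G \<omega> = trig_sum a (F - G) \<omega>"
  unfolding trig_sum_def using sum_diff[OF assms, of "\<lambda>k. a k * fourier_char k \<omega>"] by simp

lemma energy_trig_sum_diff_le:
  assumes "finite F" "enum_below n \<subseteq> F"
  shows "energy cube (\<lambda>\<omega>. trig_sum a F \<omega> - trig_sum a (enum_below n) \<omega>) \<le>
    energy (count_space UNIV) (\<lambda>k. a k * indicator (- enum_below n) k)"
proof -
  have "energy cube (\<lambda>\<omega>. trig_sum a F \<omega> - trig_sum a (enum_below n) \<omega>) =
      ennreal (\<Sum>k\<in>F - enum_below n. (cmod (a k))\<^sup>2)"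
    unfolding trig_sum_diff[OF assms] using assms(1) by (intro energy_trig_sum) simp
  also have "(\<Sum>k\<in>F - enum_below n. (cmod (a k))\<^sup>2) = (\<Sum>k\<in>F - enum_below n. (cmod (a k * indicator (- enum_below n) k))\<^sup>2)"
    by (intro sum.cong refl) auto
  also have "ennreal \<dots> \<le> energy (count_space UNIV) (\<lambda>k. a k * indicator (- enum_below n) k)"
    by (rule ell2_finite_sum_le) (use assms(1) in simp)
  finally show ?thesis .
qed

text \<open>
  The property by which \<open>fourier_series\<close> is chosen, with the energy in place of the norm.
\<close>

definition is_fourier_series :: "(int^'d \<Rightarrow> complex) \<Rightarrow> (real^'d \<Rightarrow> complex) \<Rightarrow> bool" where
  "is_fourier_series a h \<longleftrightarrow> h \<in> L2_space cube \<and>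
     ((\<lambda>F. energy cube (\<lambda>\<omega>. trig_sum a F \<omega> - h \<omega>)) \<longlongrightarrow> 0) (finite_subsets_at_top UNIV)"

lemma is_fourier_series_iff:
  "is_fourier_series a h \<longleftrightarrow> h \<in> L2_space (lebesgue_on unit_cube) \<and>
     ((\<lambda>F. L2_norm (lebesgue_on unit_cube)
        (\<lambda>\<omega>. (\<Sum>k\<in>F. a k * cis (- (2 * pi * (\<omega> \<bullet> of_zvec k)))) - h \<omega>)) \<longlongrightarrow> 0)
       (finite_subsets_at_top UNIV)"
proof (cases "h \<in> L2_space cube")
  case True
  let ?d = "\<lambda>F \<omega>. trig_sum a F \<omega> - h \<omega>"
  have d: "?d F \<in> L2_space cube" for F
    by (rule L2_space_diff[OF trig_sum_L2 True])
  show ?thesis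
    using tendsto_L2_norm_iff_energy[of ?d, OF d, of "finite_subsets_at_top UNIV"] True
    unfolding is_fourier_series_def trig_sum_def fourier_char_def by simp
next
  case False
  then show ?thesis unfolding is_fourier_series_def by simp
qed

text \<open>
  The partial sums along the exhaustion are Cauchy, as the energy of a trigonometric sum is the
  sum of the squares of its coefficients; every finite set that contains a late member of the
  exhaustion differs from it by a part of a small tail.
\<close>

theorem is_fourier_series_exists:
  fixes a :: "int^'d \<Rightarrow> complex"
  assumes a: "a \<in> ell2"
  shows "\<exists>h. is_fourier_series a h"
proof -
  let ?t = "\<lambda>n. energy (count_space UNIV) (\<lambda>k. a k * indicator (- enum_below n) k)"
  let ?S = "\<lambda>n. trig_sum a (enum_below n)"
  have tail: "energy cube (\<lambda>\<omega>. trig_sum a F \<omega> - ?S N \<omega>) \<le> ?t N" if "finite F" "enum_below N \<subseteq> F" for F N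
    by (rule energy_trig_sum_diff_le[OF that])
  have lim2: "(\<lambda>n. 2 * (2 * ?t n)) \<longlonglongrightarrow> 0"
  proof -
    have "(\<lambda>n. 2 * (2 * ?t n)) \<longlonglongrightarrow> 2 * (2 * 0)"
      by (intro ennreal_tendsto_cmult ell2_tail[OF a]) simp_all
    then show ?thesis by (simp only: mult_zero_right)
  qed
  have mono: "enum_below N \<subseteq> enum_below n" if "N \<le> n" for N n
    using that by (auto simp: enum_below_def)
  have "\<exists>h. L2_tendsto cube ?S h"
  proof (rule L2_complete[OF trig_sum_L2])
    fix e :: ennreal assume "0 < e"
    then obtain N where N: "2 * (2 * ?t N) < e" using ennreal_tendsto_0D[OF lim2] by blast
    show "\<exists>N. \<forall>m\<ge>N. \<forall>n\<ge>N. energy cube (\<lambda>\<omega>. ?S m \<omega> - ?S n \<omega>) < e"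
    proof (intro exI allI impI)
      fix m n assume mn: "N \<le> m" "N \<le> n"
      have "energy cube (\<lambda>\<omega>. ?S m \<omega> - ?S n \<omega>) \<le>
          2 * energy cube (\<lambda>\<omega>. ?S m \<omega> - ?S N \<omega>) + 2 * energy cube (\<lambda>\<omega>. ?S N \<omega> - ?S n \<omega>)"
        by (rule energy_triangle) measurable
      also have "\<dots> \<le> 2 * ?t N + 2 * ?t N"
        unfolding energy_minus_commute[of _ "?S N" "?S n"]
        by (intro add_mono mult_left_mono tail mono mn finite_enum_below) simp_all
      also have "\<dots> < e" using N by (simp add: mult_2)
      finally show "energy cube (\<lambda>\<omega>. ?S m \<omega> - ?S n \<omega>) < e" .
    qed
  qed
  then obtain h where h: "L2_tendsto cube ?S h" by blast
  have hL2: "h \<in> L2_space cube" by (rule L2_tendsto_D(2)[OF h])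
  have lim: "(\<lambda>n. 2 * ?t n + 2 * energy cube (\<lambda>\<omega>. ?S n \<omega> - h \<omega>)) \<longlonglongrightarrow> 0"
    by (rule tendsto_0_double_sum_ennreal[OF ell2_tail[OF a] L2_tendsto_D(3)[OF h]])
  have "((\<lambda>F. energy cube (\<lambda>\<omega>. trig_sum a F \<omega> - h \<omega>)) \<longlongrightarrow> 0) (finite_subsets_at_top UNIV)"
  proof (rule order_tendstoI)
    fix e :: ennreal assume "0 < e"
    then obtain N where N: "2 * ?t N + 2 * energy cube (\<lambda>\<omega>. ?S N \<omega> - h \<omega>) < e"
      using ennreal_tendsto_0D[OF lim] by blast
    have "energy cube (\<lambda>\<omega>. trig_sum a F \<omega> - h \<omega>) < e" if "finite F" "enum_below N \<subseteq> F" for F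
    proof -
      have "energy cube (\<lambda>\<omega>. trig_sum a F \<omega> - h \<omega>) \<le>
         2 * energy cube (\<lambda>\<omega>. trig_sum a F \<omega> - ?S N \<omega>) + 2 * energy cube (\<lambda>\<omega>. ?S N \<omega> - h \<omega>)"
        by (rule energy_triangle) (auto intro: L2_space_measurable hL2)
      also have "\<dots> \<le> 2 * ?t N + 2 * energy cube (\<lambda>\<omega>. ?S N \<omega> - h \<omega>)"
        by (intro add_right_mono mult_left_mono tail that) simp
      finally show ?thesis using N by (rule le_less_trans)
    qed
    then show "\<forall>\<^sub>F F in finite_subsets_at_top UNIV. energy cube (\<lambda>\<omega>. trig_sum a F \<omega> - h \<omega>) < e"
      unfolding eventually_finite_subsets_at_top
      by (intro exI[of _ "enum_below N"]) (auto simp: finite_enum_below)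
  qed simp
  then show ?thesis using hL2 unfolding is_fourier_series_def by blast
qed

lemma is_fourier_series_fourier_series:
  assumes "a \<in> ell2" shows "is_fourier_series a (fourier_series a)"
proof -
  have "\<exists>h. h \<in> L2_space (lebesgue_on unit_cube) \<and>
     ((\<lambda>F. L2_norm (lebesgue_on unit_cube)
        (\<lambda>\<omega>. (\<Sum>k\<in>F. a k * cis (- (2 * pi * (\<omega> \<bullet> of_zvec k)))) - h \<omega>)) \<longlongrightarrow> 0)
       (finite_subsets_at_top UNIV)"
    using is_fourier_series_exists[OF assms] unfolding is_fourier_series_iff .
  from someI_ex[OF this] show ?thesis unfolding is_fourier_series_iff fourier_series_def .
qed

lemma L2_tendsto_mult_char:
  assumes "L2_tendsto cube s h"
  shows "L2_tendsto cube (\<lambda>n \<omega>. fourier_char k \<omega> * s n \<omega>) (\<lambda>\<omega>. fourier_char k \<omega> * h \<omega>)"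
proof -
  note s = L2_tendsto_D[OF assms]
  have L2: "(\<lambda>\<omega>. fourier_char k \<omega> * f \<omega>) \<in> L2_space cube" if "f \<in> L2_space cube" for f :: "real^'a \<Rightarrow> complex"
    by (rule L2_space_bounded_mult[where C=1]) (use that in auto)
  have "energy cube (\<lambda>\<omega>. fourier_char k \<omega> * s n \<omega> - fourier_char k \<omega> * h \<omega>) = energy cube (\<lambda>\<omega>. s n \<omega> - h \<omega>)" for n
    unfolding right_diff_distrib[symmetric] by (simp add: energy_def norm_mult)
  then show ?thesis using s L2 unfolding L2_tendsto_iff_energy by simp
qed

lemma L2_tendsto_integral_cube:
  assumes "L2_tendsto cube s h"
  shows "(\<lambda>n. \<integral>\<omega>. s n \<omega> \<partial>cube) \<longlonglongrightarrow> (\<integral>\<omega>. h \<omega> \<partial>cube)"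
proof -
  interpret finite_measure cube by (rule finite_cube_measure)
  note s = L2_tendsto_D[OF assms]
  have "(\<lambda>n. set_lebesgue_integral cube (space cube) (s n)) \<longlonglongrightarrow> set_lebesgue_integral cube (space cube) h"
    by (rule L2_tendsto_set_integral[OF assms]) (auto simp: less_top[symmetric])
  then show ?thesis
    by (simp only: set_integral_space[OF L2_cube_integrable[OF s(1)]] set_integral_space[OF L2_cube_integrable[OF s(2)]])
qed

lemma is_fourier_series_coefficient:
  assumes "is_fourier_series a h"
  shows "(\<integral>\<omega>. fourier_char (- l) \<omega> * h \<omega> \<partial>cube) = a l"
proof -
  have hL2: "h \<in> L2_space cube" using assms by (simp add: is_fourier_series_def)
  have lim: "((\<lambda>F. energy cube (\<lambda>\<omega>. trig_sum a F \<omega> - h \<omega>)) \<longlongrightarrow> 0) (finite_subsets_at_top UNIV)"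
    using assms by (simp add: is_fourier_series_def)
  have fl: "filterlim enum_below (finite_subsets_at_top (UNIV :: (int^'a) set)) sequentially"
    unfolding filterlim_finite_subsets_at_top
  proof (intro allI impI)
    fix X :: "(int^'a) set" assume X: "finite X \<and> X \<subseteq> UNIV"
    have "finite (enum_below n) \<and> X \<subseteq> enum_below n \<and> enum_below n \<subseteq> UNIV"
      if n: "Suc (Max (insert 0 (to_nat ` X))) \<le> n" for n
    proof (intro conjI finite_enum_below subset_UNIV subsetI)
      fix k assume "k \<in> X"
      then have "to_nat k \<le> Max (insert 0 (to_nat ` X))" using X by (intro Max_ge) auto
      then show "k \<in> enum_below n" using n by (simp add: enum_below_def)
    qed
    then show "\<forall>\<^sub>F n in sequentially. finite (enum_below n) \<and> X \<subseteq> enum_below n \<and> enum_below n \<subseteq> UNIV"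
      unfolding eventually_sequentially by blast
  qed
  have "L2_tendsto cube (\<lambda>n. trig_sum a (enum_below n)) h"
    unfolding L2_tendsto_iff_energy using filterlim_compose[OF lim fl] hL2 trig_sum_L2 by auto
  from L2_tendsto_integral_cube[OF L2_tendsto_mult_char[OF this, of "- l"]]
  have "(\<lambda>n. \<integral>\<omega>. fourier_char (- l) \<omega> * trig_sum a (enum_below n) \<omega> \<partial>cube) \<longlonglongrightarrow> (\<integral>\<omega>. fourier_char (- l) \<omega> * h \<omega> \<partial>cube)" .
  moreover have "(\<integral>\<omega>. fourier_char (- l) \<omega> * trig_sum a (enum_below n) \<omega> \<partial>cube) = (if l \<in> enum_below n then a l else 0)" for n
    using trig_sum_coefficient[OF finite_enum_below[of n], of a l] by (simp only: cnj_fourier_char mult.commute)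
  ultimately have "(\<lambda>n. if l \<in> enum_below n then a l else 0) \<longlonglongrightarrow> (\<integral>\<omega>. fourier_char (- l) \<omega> * h \<omega> \<partial>cube)"
    by (simp only:)
  moreover have "(\<lambda>n. if l \<in> enum_below n then a l else 0) \<longlonglongrightarrow> a l"
    by (rule tendsto_eventually, unfold eventually_sequentially, rule exI[of _ "Suc (to_nat l)"])
       (auto simp: enum_below_def)
  ultimately show ?thesis by (rule LIMSEQ_unique)
qed

lemma bessel_inequality:
  fixes h :: "real^'d \<Rightarrow> complex"
  assumes h: "h \<in> L2_space cube" and "finite F"
  defines "a \<equiv> \<lambda>k. \<integral>\<omega>. fourier_char (- k) \<omega> * h \<omega> \<partial>cube"
  shows "(\<Sum>k\<in>F. (cmod (a k))\<^sup>2) \<le> (\<integral>\<omega>. (cmod (h \<omega>))\<^sup>2 \<partial>cube)"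
proof -
  let ?M = "cube :: (real^'d) measure"
  let ?S = "trig_sum a F"
  have hi: "integrable ?M (\<lambda>\<omega>. (cmod (h \<omega>))\<^sup>2)" using h by (simp add: L2_space_def)
  have Si: "integrable ?M (\<lambda>\<omega>. (cmod (?S \<omega>))\<^sup>2)" using trig_sum_L2[of a F] by (simp add: L2_space_def)
  have hint: "integrable ?M (\<lambda>\<omega>. fourier_char (- k) \<omega> * h \<omega>)" for k
    using integrable_mult_char[OF L2_cube_integrable[OF h], of "- k"] by (simp add: mult.commute)
  have hS_eq: "h \<omega> * cnj (?S \<omega>) = (\<Sum>k\<in>F. cnj (a k) * (fourier_char (- k) \<omega> * h \<omega>))" for \<omega>
    by (simp add: trig_sum_def cnj_fourier_char sum_distrib_left mult_ac)
  have hSi: "integrable ?M (\<lambda>\<omega>. h \<omega> * cnj (?S \<omega>))"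
    unfolding hS_eq by (intro Bochner_Integration.integrable_sum integrable_mult_right hint)
  have "(\<integral>\<omega>. h \<omega> * cnj (?S \<omega>) \<partial>?M) = (\<Sum>k\<in>F. cnj (a k) * (\<integral>\<omega>. fourier_char (- k) \<omega> * h \<omega> \<partial>?M))"
    unfolding hS_eq by (subst Bochner_Integration.integral_sum) (auto intro!: integrable_mult_right hint)
  also have "\<dots> = (\<Sum>k\<in>F. cnj (a k) * a k)" unfolding a_def ..
  also have "\<dots> = complex_of_real (\<Sum>k\<in>F. (cmod (a k))\<^sup>2)"
    unfolding of_real_sum by (intro sum.cong refl) (simp add: complex_norm_square[symmetric] mult.commute)
  finally have hS: "(\<integral>\<omega>. h \<omega> * cnj (?S \<omega>) \<partial>?M) = complex_of_real (\<Sum>k\<in>F. (cmod (a k))\<^sup>2)" .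
  have SS: "(\<integral>\<omega>. (cmod (?S \<omega>))\<^sup>2 \<partial>?M) = (\<Sum>k\<in>F. (cmod (a k))\<^sup>2)"
  proof -
    have "ennreal (\<integral>\<omega>. (cmod (?S \<omega>))\<^sup>2 \<partial>?M) = ennreal (\<Sum>k\<in>F. (cmod (a k))\<^sup>2)"
      using L2_norm_energy(1)[OF trig_sum_L2[of a F]] energy_trig_sum[OF assms(2), of a] by (simp only: L2_norm_power2)
    then show ?thesis by (subst (asm) ennreal_inj) (auto intro!: sum_nonneg)
  qed
  have expand: "(cmod (h \<omega> - ?S \<omega>))\<^sup>2 = (cmod (h \<omega>))\<^sup>2 - 2 * Re (h \<omega> * cnj (?S \<omega>)) + (cmod (?S \<omega>))\<^sup>2" for \<omega>
    unfolding cmod_power2 by (simp add: power2_eq_square algebra_simps)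
  have "0 \<le> (\<integral>\<omega>. (cmod (h \<omega> - ?S \<omega>))\<^sup>2 \<partial>?M)" by (rule integral_nonneg_AE) simp
  also have "\<dots> = (\<integral>\<omega>. (cmod (h \<omega>))\<^sup>2 \<partial>?M) - 2 * Re (\<integral>\<omega>. h \<omega> * cnj (?S \<omega>) \<partial>?M) + (\<integral>\<omega>. (cmod (?S \<omega>))\<^sup>2 \<partial>?M)"
  proof -
    have Re: "integrable ?M (\<lambda>\<omega>. 2 * Re (h \<omega> * cnj (?S \<omega>)))"
      by (intro integrable_mult_right integrable_Re hSi)
    have "(\<integral>\<omega>. 2 * Re (h \<omega> * cnj (?S \<omega>)) \<partial>?M) = 2 * Re (\<integral>\<omega>. h \<omega> * cnj (?S \<omega>) \<partial>?M)"
      by (simp only: integral_mult_right_zero integral_Re[OF hSi])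
    then show ?thesis
      unfolding expand
      by (simp only: Bochner_Integration.integral_add[OF Bochner_Integration.integrable_diff[OF hi Re] Si]
          Bochner_Integration.integral_diff[OF hi Re])
  qed
  also have "\<dots> = (\<integral>\<omega>. (cmod (h \<omega>))\<^sup>2 \<partial>?M) - (\<Sum>k\<in>F. (cmod (a k))\<^sup>2)"
    unfolding hS SS by simp
  finally show ?thesis by simp
qed

section \<open>Completeness of the trigonometric system\<close>

definition torus_map :: "real^'d \<Rightarrow> complex^'d" where
  "torus_map \<omega> = (\<chi> i. cis (2 * pi * \<omega> $ i))"

text \<open>
  The clamping of the real part to \<open>[-1, 1]\<close> only serves to make the function Borel on the
  whole space.
\<close>

definition torus_inverse :: "complex^'d \<Rightarrow> real^'d" where
  "torus_inverse z = (\<chi> i. let t = arccos (max (- 1) (min 1 (Re (z $ i)))) / (2 * pi) in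
     if 0 \<le> Im (z $ i) then t else 1 - t)"

text \<open>
  The torus map is injective on the cube, with a Borel inverse.  So every Borel subset of the cube
  is the preimage of a Borel subset of the torus, although the inverse is not continuous.
\<close>

lemma torus_inverse_torus_map:
  assumes "\<omega> \<in> unit_cube" shows "torus_inverse (torus_map \<omega>) = \<omega>"
proof (subst vec_eq_iff, intro allI)
  fix i
  let ?x = "\<omega> $ i"
  have x: "0 \<le> ?x" "?x < 1" using assms by (auto simp: unit_cube_def)
  have clamp: "max (- 1) (min 1 (cos t)) = cos t" for t :: real by simp
  show "torus_inverse (torus_map \<omega>) $ i = ?x"
  proof (cases "?x \<le> 1 / 2")
    case True
    have "2 * pi * ?x \<le> 2 * pi * (1 / 2)" using True by (intro mult_left_mono) auto
    then have le: "2 * pi * ?x \<le> pi" by simp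
    have "0 \<le> sin (2 * pi * ?x)" using x le by (intro sin_ge_zero) auto
    moreover have "arccos (cos (2 * pi * ?x)) = 2 * pi * ?x" using x le by (intro arccos_cos) auto
    ultimately show ?thesis by (simp add: torus_inverse_def torus_map_def clamp Let_def)
  next
    case False
    have "2 * pi * (1 / 2) < 2 * pi * ?x" using False by (intro mult_strict_left_mono) auto
    then have gt: "pi < 2 * pi * ?x" by simp
    have lt: "2 * pi * ?x < 2 * pi" using x by simp
    have "sin (2 * pi * ?x) < 0" using gt lt by (intro sin_lt_zero) auto
    moreover have "arccos (cos (2 * pi * ?x)) = 2 * pi - 2 * pi * ?x"
    proof -
      have "cos (2 * pi * ?x) = cos (2 * pi - 2 * pi * ?x)" by (simp add: cos_diff)
      moreover have "arccos (cos (2 * pi - 2 * pi * ?x)) = 2 * pi - 2 * pi * ?x"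
        using gt lt by (intro arccos_cos) auto
      ultimately show ?thesis by (simp only:)
    qed
    moreover have "1 - (2 * pi - 2 * pi * ?x) / (2 * pi) = ?x" by (simp add: diff_divide_distrib)
    ultimately show ?thesis by (simp add: torus_inverse_def torus_map_def clamp Let_def not_le)
  qed
qed

lemma torus_map_continuous: "continuous_on S torus_map"
  unfolding torus_map_def by (intro continuous_intros)

lemma torus_map_measurable [measurable]: "torus_map \<in> borel_measurable borel"
  by (intro borel_measurable_continuous_onI torus_map_continuous)

lemma borel_measurable_vec_lambda:
  fixes f :: "'a \<Rightarrow> 'd::finite \<Rightarrow> real"
  assumes [measurable]: "\<And>i. (\<lambda>x. f x i) \<in> borel_measurable M"
  shows "(\<lambda>x. \<chi> i. f x i) \<in> borel_measurable M"
proof -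
  have "(\<lambda>x. (\<chi> i. f x i) \<bullet> b) \<in> borel_measurable M" if "b \<in> Basis" for b :: "real^'d"
    using that by (auto simp: Basis_vec_def inner_axis)
  then show ?thesis by (subst borel_measurable_euclidean_space) blast
qed

lemma torus_inverse_measurable [measurable]: "torus_inverse \<in> borel_measurable borel"
proof -
  have [measurable]: "(\<lambda>x. arccos (max (- 1) (min 1 x))) \<in> borel_measurable borel"
    by (intro borel_measurable_continuous_onI continuous_intros) auto
  have [measurable]: "(\<lambda>z::complex^'a. z $ i) \<in> borel_measurable borel" for i
    by (intro borel_measurable_continuous_onI continuous_intros)
  have [measurable]: "Re \<in> borel_measurable borel" "Im \<in> borel_measurable borel"
    by (intro borel_measurable_continuous_onI continuous_intros)+
  show ?thesis
    unfolding torus_inverse_def[abs_def] Let_def by (rule borel_measurable_vec_lambda) measurable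
qed

lemma norm_torus_map_le: "norm (torus_map (\<omega> :: real^'d)) \<le> CARD('d)"
proof -
  have "norm (torus_map \<omega>) \<le> (\<Sum>i\<in>UNIV. norm (torus_map \<omega> $ i))"
    unfolding norm_vec_def by (rule L2_set_le_sum) simp
  then show ?thesis by (simp add: torus_map_def)
qed

inductive trig_poly :: "(real^'d \<Rightarrow> complex) \<Rightarrow> bool" where
  char: "trig_poly (\<lambda>\<omega>. c * fourier_char k \<omega>)"
| add: "trig_poly f \<Longrightarrow> trig_poly g \<Longrightarrow> trig_poly (\<lambda>\<omega>. f \<omega> + g \<omega>)"

lemma trig_poly_const: "trig_poly (\<lambda>\<omega>. c)"
  using trig_poly.char[of c 0] by (simp add: fourier_char_zero)

lemma trig_poly_sum:
  assumes "\<And>i. i \<in> I \<Longrightarrow> trig_poly (f i)"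
  shows "trig_poly (\<lambda>\<omega>. \<Sum>i\<in>I. f i \<omega>)"
  using assms
proof (induction I rule: infinite_finite_induct)
  case (insert i I)
  have "trig_poly (\<lambda>\<omega>. f i \<omega> + (\<Sum>j\<in>I. f j \<omega>))"
    by (rule trig_poly.add) (use insert in auto)
  then show ?case using insert.hyps by simp
qed (simp_all add: trig_poly_const)

lemma trig_poly_char_mult: "trig_poly f \<Longrightarrow> trig_poly (\<lambda>\<omega>. c * fourier_char k \<omega> * f \<omega>)"
proof (induction rule: trig_poly.induct)
  case (char c' l)
  have "c * fourier_char k \<omega> * (c' * fourier_char l \<omega>) = (c * c') * fourier_char (k + l) \<omega>" for \<omega>
    unfolding fourier_char_mult[symmetric] by (simp add: mult_ac)
  then show ?case by (simp only: trig_poly.char)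
next
  case (add f g)
  then show ?case unfolding distrib_left by (intro trig_poly.add)
qed

lemma trig_poly_mult: "trig_poly f \<Longrightarrow> trig_poly g \<Longrightarrow> trig_poly (\<lambda>\<omega>. f \<omega> * g \<omega>)"
proof (induction rule: trig_poly.induct)
  case (char c k)
  then show ?case by (rule trig_poly_char_mult)
next
  case (add f f')
  then show ?case unfolding distrib_right by (intro trig_poly.add)
qed

text \<open>
  A real-linear form in \<open>cis t\<close> is a combination of \<open>cos t\<close> and \<open>sin t\<close>, hence of \<open>cis t\<close> and
  \<open>cis (- t)\<close>.
\<close>

lemma trig_poly_linear:
  fixes f :: "complex^'d \<Rightarrow> real"
  assumes "bounded_linear f"
  shows "trig_poly (\<lambda>\<omega>. complex_of_real (f (torus_map \<omega>)))"
proof -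
  interpret bounded_linear f by fact
  have axis: "axis i w = Re w *\<^sub>R axis i 1 + Im w *\<^sub>R axis i \<i>" for i :: 'd and w :: complex
    by (simp add: vec_eq_iff axis_def complex_eq_iff)
  have decomp: "z = (\<Sum>i\<in>UNIV. Re (z $ i) *\<^sub>R axis i 1 + Im (z $ i) *\<^sub>R axis i \<i>)" for z :: "complex^'d"
    unfolding axis[symmetric] by (simp add: vec_eq_iff axis_def sum.delta)
  have char1: "fourier_char (axis i 1) \<omega> = cis (- (2 * pi * \<omega> $ i))" for i :: 'd and \<omega>
  proof -
    have "of_zvec (axis i 1) = (axis i 1 :: real^'d)" by (simp add: of_zvec_def vec_eq_iff axis_def)
    then show ?thesis by (simp add: fourier_char_def inner_axis)
  qed
  have char2: "fourier_char (- axis i 1) \<omega> = cis (2 * pi * \<omega> $ i)" for i :: 'd and \<omega>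
    by (simp add: cnj_fourier_char[symmetric] char1 cis_cnj)
  have "complex_of_real (f (torus_map \<omega>)) =
    (\<Sum>i\<in>UNIV. ((complex_of_real (f (axis i 1)) + complex_of_real (f (axis i \<i>)) * \<i>) / 2) * fourier_char (axis i 1) \<omega> +
              ((complex_of_real (f (axis i 1)) - complex_of_real (f (axis i \<i>)) * \<i>) / 2) * fourier_char (- axis i 1) \<omega>)" for \<omega>
  proof -
    have "f (torus_map \<omega>) = (\<Sum>i\<in>UNIV. cos (2 * pi * \<omega> $ i) * f (axis i 1) + sin (2 * pi * \<omega> $ i) * f (axis i \<i>))"
      by (subst decomp) (simp add: sum add scaleR torus_map_def)
    then have "complex_of_real (f (torus_map \<omega>)) = (\<Sum>i\<in>UNIV. complex_of_real (cos (2 * pi * \<omega> $ i) * f (axis i 1) + sin (2 * pi * \<omega> $ i) * f (axis i \<i>)))"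
      by simp
    also have "\<dots> = (\<Sum>i\<in>UNIV. ((complex_of_real (f (axis i 1)) + complex_of_real (f (axis i \<i>)) * \<i>) / 2) * fourier_char (axis i 1) \<omega> +
              ((complex_of_real (f (axis i 1)) - complex_of_real (f (axis i \<i>)) * \<i>) / 2) * fourier_char (- axis i 1) \<omega>)"
      unfolding char1 char2 by (intro sum.cong refl) (simp add: complex_eq_iff field_simps)
    finally show ?thesis .
  qed
  then show ?thesis
    by (simp only:) (intro trig_poly_sum trig_poly.add trig_poly.char)
qed

lemma trig_poly_real_polynomial:
  fixes p :: "complex^'d \<Rightarrow> real"
  assumes "real_polynomial_function p"
  shows "trig_poly (\<lambda>\<omega>. complex_of_real (p (torus_map \<omega>)))"
  using assms
proof (induction rule: real_polynomial_function.induct)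
  case (linear f) then show ?case by (rule trig_poly_linear)
next
  case (const c) show ?case by (rule trig_poly_const)
next
  case (add f g) then show ?case unfolding of_real_add by (intro trig_poly.add)
next
  case (mult f g) then show ?case unfolding of_real_mult by (intro trig_poly_mult)
qed

lemma integrable_char_mult:
  assumes "integrable lborel P" shows "integrable lborel (\<lambda>\<omega>. fourier_char k \<omega> * P \<omega>)"
  by (rule Bochner_Integration.integrable_bound[OF assms])
     (use borel_measurable_integrable[OF assms] in \<open>auto simp: norm_mult\<close>)

lemma trig_poly_integral_0:
  assumes P: "integrable lborel P" and zero: "\<And>k. (\<integral>\<omega>. fourier_char k \<omega> * P \<omega> \<partial>lborel) = 0"
    and "trig_poly q"
  shows "integrable lborel (\<lambda>\<omega>. q \<omega> * P \<omega>) \<and> (\<integral>\<omega>. q \<omega> * P \<omega> \<partial>lborel) = 0"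
  using \<open>trig_poly q\<close>
proof (induction rule: trig_poly.induct)
  case (char c k)
  then show ?case using integrable_char_mult[OF P, of k] zero[of k] by (simp add: mult.assoc)
next
  case (add f g)
  then show ?case by (simp add: distrib_right)
qed

text \<open>
  Stone--Weierstrass: on a ball that contains the torus, \<open>F\<close> is a uniform limit of real
  polynomials, and a polynomial in the coordinates of the torus map is a trigonometric polynomial.
\<close>

lemma continuous_on_torus_integral_0:
  fixes P :: "real^'d \<Rightarrow> complex" and F :: "complex^'d \<Rightarrow> real"
  assumes P: "integrable lborel P" and zero: "\<And>k. (\<integral>\<omega>. fourier_char k \<omega> * P \<omega> \<partial>lborel) = 0"
    and F: "continuous_on UNIV F"
  shows "(\<integral>\<omega>. complex_of_real (F (torus_map \<omega>)) * P \<omega> \<partial>lborel) = 0"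
proof -
  have Pm [measurable]: "P \<in> borel_measurable borel" using P by auto
  have Fm [measurable]: "F \<in> borel_measurable borel" by (rule borel_measurable_continuous_onI[OF F])
  let ?T = "cball (0 :: complex^'d) (real CARD('d))"
  let ?I = "\<integral>\<omega>. complex_of_real (F (torus_map \<omega>)) * P \<omega> \<partial>lborel"
  have T: "torus_map \<omega> \<in> ?T" for \<omega> :: "real^'d" using norm_torus_map_le[of \<omega>] by simp
  have cF: "continuous_on ?T F" using F by (rule continuous_on_subset) simp
  have "cmod ?I \<le> e * (\<integral>\<omega>. cmod (P \<omega>) \<partial>lborel)" if "0 < e" for e
  proof -
    obtain p where p: "real_polynomial_function p" "\<And>z. z \<in> ?T \<Longrightarrow> \<bar>F z - p z\<bar> < e"
      using Stone_Weierstrass_real_polynomial_function[OF compact_cball cF \<open>0 < e\<close>] by metis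
    have q: "integrable lborel (\<lambda>\<omega>. complex_of_real (p (torus_map \<omega>)) * P \<omega>)"
       "(\<integral>\<omega>. complex_of_real (p (torus_map \<omega>)) * P \<omega> \<partial>lborel) = 0"
      using trig_poly_integral_0[OF P zero trig_poly_real_polynomial[OF p(1)]] by auto
    have pm [measurable]: "p \<in> borel_measurable borel"
      by (intro borel_measurable_continuous_onI continuous_on_polymonial_function) (use p(1) real_polynomial_function_eq in auto)
    have bound: "cmod (complex_of_real (F (torus_map \<omega>) - p (torus_map \<omega>)) * P \<omega>) \<le> e * cmod (P \<omega>)" for \<omega>
    proof -
      have "\<bar>F (torus_map \<omega>) - p (torus_map \<omega>)\<bar> \<le> e" using p(2)[OF T, of \<omega>] by simp
      then show ?thesis unfolding norm_mult norm_of_real by (intro mult_right_mono) auto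
    qed
    have ePi: "integrable lborel (\<lambda>\<omega>. e * cmod (P \<omega>))" using P by (intro integrable_mult_right integrable_norm)
    have d: "integrable lborel (\<lambda>\<omega>. complex_of_real (F (torus_map \<omega>) - p (torus_map \<omega>)) * P \<omega>)"
    proof (rule Bochner_Integration.integrable_bound[OF ePi])
      show "AE \<omega> in lborel. norm (complex_of_real (F (torus_map \<omega>) - p (torus_map \<omega>)) * P \<omega>) \<le> norm (e * cmod (P \<omega>))"
      proof (rule AE_I2)
        fix \<omega>
        show "norm (complex_of_real (F (torus_map \<omega>) - p (torus_map \<omega>)) * P \<omega>) \<le> norm (e * cmod (P \<omega>))"
          using bound[of \<omega>] by (rule order_trans) simp
      qed
    qed measurable
    have "?I = (\<integral>\<omega>. complex_of_real (F (torus_map \<omega>) - p (torus_map \<omega>)) * P \<omega> + complex_of_real (p (torus_map \<omega>)) * P \<omega> \<partial>lborel)"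
      by (intro Bochner_Integration.integral_cong refl) (simp add: algebra_simps)
    also have "\<dots> = (\<integral>\<omega>. complex_of_real (F (torus_map \<omega>) - p (torus_map \<omega>)) * P \<omega> \<partial>lborel)"
      using Bochner_Integration.integral_add[OF d q(1)] q(2) by simp
    finally have "cmod ?I \<le> (\<integral>\<omega>. cmod (complex_of_real (F (torus_map \<omega>) - p (torus_map \<omega>)) * P \<omega>) \<partial>lborel)"
      by (simp only: integral_norm_bound)
    also have "\<dots> \<le> (\<integral>\<omega>. e * cmod (P \<omega>) \<partial>lborel)"
      using d ePi by (intro integral_mono bound integrable_norm)
    finally show ?thesis by simp
  qed
  then have le: "cmod ?I \<le> e * (\<integral>\<omega>. cmod (P \<omega>) \<partial>lborel)" if "0 < e" for e using that by blast
  have "((\<lambda>e. e * (\<integral>\<omega>. cmod (P \<omega>) \<partial>lborel)) \<longlongrightarrow> 0 * (\<integral>\<omega>. cmod (P \<omega>) \<partial>lborel)) (at_right 0)"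
    by (intro tendsto_mult tendsto_const tendsto_ident_at)
  moreover have "\<forall>\<^sub>F e in at_right 0. cmod ?I \<le> e * (\<integral>\<omega>. cmod (P \<omega>) \<partial>lborel)"
    unfolding eventually_at_right_field using le by (intro exI[of _ 1]) auto
  ultimately have "cmod ?I \<le> 0 * (\<integral>\<omega>. cmod (P \<omega>) \<partial>lborel)"
    by (intro tendsto_lowerbound[where F="at_right (0::real)"]) auto
  then show ?thesis by simp
qed

text \<open>
  The indicator of an open set is an increasing limit of continuous functions of the distance to
  its complement.
\<close>

lemma open_on_torus_integral_0:
  fixes P :: "real^'d \<Rightarrow> complex"
  assumes P: "integrable lborel P" and zero: "\<And>k. (\<integral>\<omega>. fourier_char k \<omega> * P \<omega> \<partial>lborel) = 0"
    and A: "open A"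
  shows "set_lebesgue_integral lborel (torus_map -` A) P = 0"
proof (cases "A = UNIV")
  case True
  have "(\<integral>\<omega>. P \<omega> \<partial>lborel) = 0" using zero[of 0] by (simp add: fourier_char_zero)
  then show ?thesis using True by (simp add: set_lebesgue_integral_def)
next
  case False
  have Pm [measurable]: "P \<in> borel_measurable borel" using P by auto
  have [measurable]: "A \<in> sets borel" using A by simp
  let ?F = "\<lambda>n z. min 1 (real n * infdist z (- A))"
  have cF: "continuous_on UNIV (?F n)" for n by (intro continuous_intros)
  have [measurable]: "?F n \<in> borel_measurable borel" for n by (rule borel_measurable_continuous_onI[OF cF])
  have lim: "(\<lambda>n. ?F n z) \<longlonglongrightarrow> indicat_real A z" for z
  proof (cases "z \<in> A")
    case True
    have "infdist z (- A) \<noteq> 0"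
      using in_closed_iff_infdist_zero[of "- A" z] A False True by auto
    then have pos: "0 < infdist z (- A)" using infdist_nonneg[of z "- A"] by simp
    then obtain N where N: "1 < real N * infdist z (- A)" using reals_Archimedean3 by blast
    have "?F n z = 1" if "N \<le> n" for n
    proof -
      have "real N * infdist z (- A) \<le> real n * infdist z (- A)" using that pos by (intro mult_right_mono) auto
      then show ?thesis using N by simp
    qed
    then show ?thesis using True by (intro tendsto_eventually) (auto simp: eventually_sequentially)
  next
    case False
    then have "infdist z (- A) = 0" by simp
    then show ?thesis using False by simp
  qed
  have "(\<lambda>n. \<integral>\<omega>. complex_of_real (?F n (torus_map \<omega>)) * P \<omega> \<partial>lborel) \<longlonglongrightarrow>
     (\<integral>\<omega>. complex_of_real (indicat_real A (torus_map \<omega>)) * P \<omega> \<partial>lborel)"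
  proof (rule integral_dominated_convergence[where w="\<lambda>\<omega>. cmod (P \<omega>)"])
    show "integrable lborel (\<lambda>\<omega>. cmod (P \<omega>))" using P by simp
    show "AE \<omega> in lborel. (\<lambda>n. complex_of_real (?F n (torus_map \<omega>)) * P \<omega>) \<longlonglongrightarrow> complex_of_real (indicat_real A (torus_map \<omega>)) * P \<omega>"
      by (intro AE_I2 tendsto_mult tendsto_const tendsto_of_real lim)
    show "AE \<omega> in lborel. norm (complex_of_real (?F n (torus_map \<omega>)) * P \<omega>) \<le> cmod (P \<omega>)" for n
    proof (rule AE_I2)
      fix \<omega>
      have "\<bar>?F n (torus_map \<omega>)\<bar> \<le> 1" by (simp add: infdist_nonneg)
      then have "\<bar>?F n (torus_map \<omega>)\<bar> * cmod (P \<omega>) \<le> 1 * cmod (P \<omega>)" by (intro mult_right_mono) auto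
      then show "norm (complex_of_real (?F n (torus_map \<omega>)) * P \<omega>) \<le> cmod (P \<omega>)"
        by (simp only: norm_mult norm_of_real mult_1)
    qed
  qed measurable
  then have "(\<integral>\<omega>. complex_of_real (indicat_real A (torus_map \<omega>)) * P \<omega> \<partial>lborel) = 0"
    unfolding continuous_on_torus_integral_0[OF P zero cF] by (simp add: LIMSEQ_const_iff)
  moreover have "indicat_real A (torus_map \<omega>) = indicat_real (torus_map -` A) \<omega>" for \<omega> :: "real^'d"
    by (simp add: indicator_def)
  ultimately show ?thesis by (simp add: set_lebesgue_integral_def scaleR_conv_of_real)
qed

text \<open>
  The integrals of \<open>H\<close> over preimages of open subsets of the torus vanish, hence over preimages of
  Borel sets, and these are all Borel sets as far as \<open>H\<close> can see.
\<close>

theorem trigonometric_completeness: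
  fixes H :: "real^'d \<Rightarrow> complex"
  assumes P: "integrable lborel H" and supp: "\<And>\<omega>. \<omega> \<notin> unit_cube \<Longrightarrow> H \<omega> = 0"
    and zero: "\<And>k. (\<integral>\<omega>. fourier_char k \<omega> * H \<omega> \<partial>lborel) = 0"
  shows "AE \<omega> in lborel. H \<omega> = 0"
proof (rule sigma_finite_measure.density_zero[OF sigma_finite_lborel P])
  fix B :: "(real^'d) set" assume "B \<in> sets lborel"
  then have B [measurable]: "B \<in> sets borel" by simp
  let ?A = "torus_inverse -` B \<inter> space borel"
  have A: "?A \<in> sets borel" by (rule measurable_sets[OF torus_inverse_measurable B])
  have "set_lebesgue_integral lborel (torus_map -` ?A \<inter> space lborel) H = 0"
  proof (rule set_integral_vimage_eq_0[OF P, where N=borel and G="{S. open S}"])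
    show "torus_map \<in> measurable lborel borel" by measurable
    show "Int_stable {S :: (complex^'d) set. open S}" by (auto intro!: Int_stableI)
    show "sets borel = sigma_sets (space borel) {S :: (complex^'d) set. open S}"
      by (simp add: borel_def)
    show "(\<integral>\<omega>. H \<omega> \<partial>lborel) = 0" using zero[of 0] by (simp add: fourier_char_zero)
    show "set_lebesgue_integral lborel (torus_map -` S \<inter> space lborel) H = 0" if "S \<in> {S. open S}" for S
      using open_on_torus_integral_0[OF P zero, of S] that by simp
    show "?A \<in> sets borel" by (rule A)
  qed simp
  also have "set_lebesgue_integral lborel (torus_map -` ?A \<inter> space lborel) H = set_lebesgue_integral lborel B H"
    unfolding set_lebesgue_integral_def
  proof (intro Bochner_Integration.integral_cong refl)
    fix \<omega> :: "real^'d"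
    show "indicat_real (torus_map -` ?A \<inter> space lborel) \<omega> *\<^sub>R H \<omega> = indicat_real B \<omega> *\<^sub>R H \<omega>"
      using supp[of \<omega>] torus_inverse_torus_map[of \<omega>] by (cases "\<omega> \<in> unit_cube") (auto simp: indicator_def)
  qed
  finally show "set_lebesgue_integral lborel B H = 0" .
qed

lemma cube_extension_measurable:
  fixes h :: "real^'d \<Rightarrow> complex"
  assumes "h \<in> borel_measurable cube"
  shows "(\<lambda>\<omega>. indicat_real unit_cube \<omega> *\<^sub>R h \<omega>) \<in> borel_measurable lebesgue"
  using assms by (subst (asm) borel_measurable_restrict_space_iff) auto

lemma AE_cube_iff: "(AE \<omega> in cube. Q \<omega>) \<longleftrightarrow> (AE \<omega> in lebesgue. \<omega> \<in> unit_cube \<longrightarrow> Q \<omega>)"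
  by (rule AE_restrict_space_iff) simp

theorem L2_cube_zero_coefficients:
  fixes h :: "real^'d \<Rightarrow> complex"
  assumes h: "h \<in> L2_space cube"
    and zero: "\<And>k. (\<integral>\<omega>. fourier_char k \<omega> * h \<omega> \<partial>cube) = 0"
  shows "AE \<omega> in cube. h \<omega> = 0"
proof -
  let ?h = "\<lambda>\<omega>. indicat_real unit_cube \<omega> *\<^sub>R h \<omega>"
  have hm: "?h \<in> borel_measurable lebesgue"
    by (rule cube_extension_measurable[OF L2_space_measurable[OF h]])
  have hi: "integrable lebesgue ?h"
    using L2_cube_integrable[OF h] by (subst (asm) integrable_restrict_space) auto
  obtain g where g: "g \<in> borel_measurable borel" "AE \<omega> in lebesgue. ?h \<omega> = g \<omega>"
    using borel_representative[OF hm] by metis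
  note [measurable] = g(1)
  \<comment> \<open>cutting off again makes the Borel representative vanish everywhere outside the cube\<close>
  define H where "H \<omega> = indicat_real unit_cube \<omega> *\<^sub>R g \<omega>" for \<omega>
  have Hb [measurable]: "H \<in> borel_measurable borel" unfolding H_def by measurable
  have Hl: "H \<in> borel_measurable lebesgue" by (rule measurable_completion) simp
  have hH: "AE \<omega> in lebesgue. ?h \<omega> = H \<omega>"
    using g(2)
  proof eventually_elim
    case (elim \<omega>)
    then show ?case unfolding H_def by (cases "\<omega> \<in> unit_cube") auto
  qed
  have Hi: "integrable lborel H"
    using integrable_cong_AE_imp[OF hi Hl hH] integrable_completion[of H lborel] by simp
  have "(\<integral>\<omega>. fourier_char k \<omega> * H \<omega> \<partial>lborel) = 0" for k
  proof -
    have [measurable]: "fourier_char k \<in> borel_measurable (lebesgue :: (real^'d) measure)"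
      by (rule measurable_completion) simp
    have "(\<integral>\<omega>. fourier_char k \<omega> * H \<omega> \<partial>lborel) = (\<integral>\<omega>. fourier_char k \<omega> * H \<omega> \<partial>lebesgue)"
      by (rule integral_completion[symmetric]) measurable
    also have "\<dots> = (\<integral>\<omega>. fourier_char k \<omega> * ?h \<omega> \<partial>lebesgue)"
    proof (rule integral_cong_AE)
      show "AE \<omega> in lebesgue. fourier_char k \<omega> * H \<omega> = fourier_char k \<omega> * ?h \<omega>"
        using hH by eventually_elim simp
    qed (use hm Hl in measurable)
    also have "\<dots> = (\<integral>\<omega>. fourier_char k \<omega> * h \<omega> \<partial>cube)"
      unfolding integral_cube by (simp only: mult_scaleR_right)
    finally show ?thesis by (simp only: zero)
  qed
  then have "AE \<omega> in lborel. H \<omega> = 0"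
    by (intro trigonometric_completeness Hi) (simp_all add: H_def)
  then have "AE \<omega> in lebesgue. H \<omega> = 0" by (rule AE_completion)
  then show ?thesis
    unfolding AE_cube_iff using hH by eventually_elim auto
qed

lemma energy_count_space_le:
  fixes a :: "'k::countable \<Rightarrow> complex"
  assumes "\<And>n. ennreal (\<Sum>k\<in>enum_below n. (cmod (a k))\<^sup>2) \<le> c"
  shows "energy (count_space UNIV) a \<le> c"
proof -
  let ?u = "\<lambda>n k. ennreal ((cmod (a k))\<^sup>2) * indicator (enum_below n) k"
  have "energy (count_space UNIV) a = (\<integral>\<^sup>+k. liminf (\<lambda>n. ?u n k) \<partial>count_space UNIV)"
    unfolding energy_def
  proof (intro nn_integral_cong lim_imp_Liminf[symmetric] tendsto_eventually)
    fix k :: 'k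
    show "\<forall>\<^sub>F n in sequentially. ?u n k = ennreal ((cmod (a k))\<^sup>2)"
      unfolding eventually_sequentially
      by (rule exI[of _ "Suc (to_nat k)"]) (auto simp: enum_below_def)
  qed simp
  also have "\<dots> \<le> liminf (\<lambda>n. \<integral>\<^sup>+k. ?u n k \<partial>count_space UNIV)"
    by (rule nn_integral_liminf) simp
  also have "\<dots> \<le> c"
  proof (rule Liminf_le)
    have "(\<integral>\<^sup>+k. ?u n k \<partial>count_space UNIV) = ennreal (\<Sum>k\<in>enum_below n. (cmod (a k))\<^sup>2)" for n
    proof -
      have "(\<integral>\<^sup>+k. ?u n k \<partial>count_space UNIV) = (\<integral>\<^sup>+k. ennreal ((cmod (a k))\<^sup>2) \<partial>count_space (enum_below n))"
        by (simp add: nn_integral_count_space_indicator)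
      also have "\<dots> = (\<Sum>k\<in>enum_below n. ennreal ((cmod (a k))\<^sup>2))"
        by (rule nn_integral_count_space_finite[OF finite_enum_below])
      also have "\<dots> = ennreal (\<Sum>k\<in>enum_below n. (cmod (a k))\<^sup>2)"
        by (rule sum_ennreal) simp
      finally show ?thesis .
    qed
    then show "\<forall>\<^sub>F n in sequentially. (\<integral>\<^sup>+k. ?u n k \<partial>count_space UNIV) \<le> c"
      using assms by simp
  qed simp
  finally show ?thesis .
qed

text \<open>
  The coefficients are square-summable by Bessel's inequality; their Fourier series has the same
  coefficients as \<open>h\<close>, so it equals \<open>h\<close> by completeness.  This is how a prescribed
  bounded field of scalars becomes an operator \<open>\<Lambda>\<^sub>a\<close>.
\<close>

theorem fourier_series_surjective:
  fixes h :: "real^'d \<Rightarrow> complex"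
  assumes hm: "h \<in> borel_measurable cube" and bound: "AE \<omega> in cube. cmod (h \<omega>) \<le> C"
  obtains a where "bounded_spectrum a" "AE \<omega> in cube. fourier_series a \<omega> = h \<omega>"
proof -
  have h: "h \<in> L2_space cube" by (rule bounded_in_L2_cube[OF hm bound])
  define a where "a k = (\<integral>\<omega>. fourier_char (- k) \<omega> * h \<omega> \<partial>cube)" for k
  have a: "a \<in> ell2"
  proof -
    have "energy (count_space UNIV) a \<le> ennreal (\<integral>\<omega>. (cmod (h \<omega>))\<^sup>2 \<partial>cube)"
      by (intro energy_count_space_le ennreal_leI)
         (use bessel_inequality[OF h finite_enum_below] in \<open>simp add: a_def\<close>)
    then show ?thesis by (auto simp: ell2_iff_energy intro: le_less_trans)
  qed
  have s: "is_fourier_series a (fourier_series a)" by (rule is_fourier_series_fourier_series[OF a])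
  then have sL2: "fourier_series a \<in> L2_space cube" by (simp add: is_fourier_series_def)
  have "AE \<omega> in cube. fourier_series a \<omega> - h \<omega> = 0"
  proof (rule L2_cube_zero_coefficients[OF L2_space_diff[OF sL2 h]])
    fix k
    have i: "integrable cube (\<lambda>\<omega>. fourier_char k \<omega> * f \<omega>)" if "f \<in> L2_space cube" for f :: "real^'d \<Rightarrow> complex"
      using integrable_mult_char[OF L2_cube_integrable[OF that], of k] by (simp add: mult.commute)
    have "(\<integral>\<omega>. fourier_char k \<omega> * (fourier_series a \<omega> - h \<omega>) \<partial>cube) =
        (\<integral>\<omega>. fourier_char k \<omega> * fourier_series a \<omega> \<partial>cube) - (\<integral>\<omega>. fourier_char k \<omega> * h \<omega> \<partial>cube)"
      unfolding right_diff_distrib by (rule Bochner_Integration.integral_diff[OF i[OF sL2] i[OF h]])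
    also have "\<dots> = 0"
      using is_fourier_series_coefficient[OF s, of "- k"] by (simp add: a_def)
    finally show "(\<integral>\<omega>. fourier_char k \<omega> * (fourier_series a \<omega> - h \<omega>) \<partial>cube) = 0" .
  qed
  then have eq: "AE \<omega> in cube. fourier_series a \<omega> = h \<omega>" by simp
  have "AE \<omega> in cube. cmod (fourier_series a \<omega>) \<le> C"
    using eq bound by eventually_elim simp
  then have "bounded_spectrum a" using a unfolding bounded_spectrum_def by blast
  then show ?thesis using eq by (rule that)
qed

section \<open>Fiberization\<close>

definition zfloor :: "real^'d \<Rightarrow> int^'d" where
  "zfloor x = (\<chi> i. \<lfloor>x $ i\<rfloor>)"

definition zfrac :: "real^'d \<Rightarrow> real^'d" where
  "zfrac x = x - of_zvec (zfloor x)"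

lemma zfrac_in_cube: "zfrac x \<in> unit_cube"
proof -
  have "zfrac x $ i = frac (x $ i)" for i
    by (simp add: zfrac_def zfloor_def of_zvec_def frac_def)
  then show ?thesis by (simp add: unit_cube_def frac_ge_0 frac_lt_1)
qed

lemma zfloor_cube:
  assumes "\<omega> \<in> unit_cube" shows "zfloor (\<omega> + of_zvec k) = k"
  using assms unfolding unit_cube_def zfloor_def of_zvec_def
  by (simp add: vec_eq_iff floor_eq_iff)

lemma zfrac_cube:
  assumes "\<omega> \<in> unit_cube" shows "zfrac (\<omega> + of_zvec k) = \<omega>"
  using assms by (simp add: zfrac_def zfloor_cube)

lemma zfloor_measurable: "zfloor \<in> measurable (lebesgue :: (real^'d) measure) (count_space UNIV)"
proof (subst measurable_count_space_eq2_countable, intro conjI allI ballI)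
  fix k :: "int^'d"
  have "zfloor -` {k} \<inter> space lebesgue = {x. \<forall>i. real_of_int (k $ i) \<le> x $ i \<and> x $ i < real_of_int (k $ i) + 1}"
    by (auto simp: zfloor_def vec_eq_iff floor_eq_iff)
  also have "\<dots> \<in> sets borel" by measurable
  finally show "zfloor -` {k} \<inter> space lebesgue \<in> sets (lebesgue :: (real^'d) measure)" by simp
qed auto

lemma AE_lebesgue_translate:
  fixes t :: "'a::euclidean_space"
  assumes "AE x in lebesgue. Q x" shows "AE x in lebesgue. Q (x + t)"
proof -
  have "AE x in distr lebesgue lebesgue (\<lambda>x. t + x). Q x"
    unfolding distr_lebesgue_translation by (rule assms)
  from AE_distrD[OF measurable_lebesgue_translation this] show ?thesis by (simp add: add.commute)
qed

text \<open>
  The translates of the cube by integer vectors tile the space, and there are countably many.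
\<close>

lemma AE_lebesgue_iff_AE_cube:
  fixes Q :: "real^'d \<Rightarrow> bool"
  shows "(AE x in lebesgue. Q x) \<longleftrightarrow> (AE \<omega> in cube. \<forall>k. Q (\<omega> + of_zvec k))"
proof
  assume "AE x in lebesgue. Q x"
  then have "AE x in lebesgue. \<forall>k. Q (x + of_zvec k)"
    unfolding AE_all_countable by (intro allI AE_lebesgue_translate)
  then show "AE \<omega> in cube. \<forall>k. Q (\<omega> + of_zvec k)"
    unfolding AE_cube_iff by eventually_elim simp
next
  assume "AE \<omega> in cube. \<forall>k. Q (\<omega> + of_zvec k)"
  then have "AE x in lebesgue. x \<in> unit_cube \<longrightarrow> (\<forall>k. Q (x + of_zvec k))"
    unfolding AE_cube_iff .
  then have "AE x in lebesgue. x + - of_zvec l \<in> unit_cube \<longrightarrow> (\<forall>k. Q (x + - of_zvec l + of_zvec k))" for l :: "int^'d"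
    by (rule AE_lebesgue_translate)
  then have "AE x in lebesgue. \<forall>l::int^'d. x + - of_zvec l \<in> unit_cube \<longrightarrow> (\<forall>k. Q (x + - of_zvec l + of_zvec k))"
    unfolding AE_all_countable by (intro allI)
  then show "AE x in lebesgue. Q x"
  proof eventually_elim
    case (elim x)
    have "x + - of_zvec (zfloor x) \<in> unit_cube" using zfrac_in_cube[of x] by (simp add: zfrac_def)
    with elim have "Q (x + - of_zvec (zfloor x) + of_zvec (zfloor x))" by blast
    then show ?case by simp
  qed
qed

text \<open>
  \<open>x \<mapsto> h (zfrac x) (zfloor x)\<close> is the function on the whole space whose values on the
  translates of the cube are the coordinates of the field \<open>h\<close>.  It is measurable on each of
  countably many tiles.
\<close>

lemma unfold_field_measurable:
  fixes h :: "real^'d \<Rightarrow> int^'d \<Rightarrow> complex"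
  assumes "\<And>k. (\<lambda>\<omega>. h \<omega> k) \<in> borel_measurable cube"
  shows "(\<lambda>x. h (zfrac x) (zfloor x)) \<in> borel_measurable lebesgue"
proof -
  let ?e = "\<lambda>k \<omega>. indicat_real unit_cube \<omega> *\<^sub>R h \<omega> k"
  have e: "?e k \<in> borel_measurable lebesgue" for k by (rule cube_extension_measurable[OF assms])
  have "(\<lambda>x. ?e k (- of_zvec k + x)) \<in> borel_measurable lebesgue" for k
    by (rule measurable_compose[OF measurable_lebesgue_translation e])
  then have "(\<lambda>x. ?e (zfloor x) (- of_zvec (zfloor x) + x)) \<in> borel_measurable lebesgue"
    by (rule measurable_compose_countable[OF _ zfloor_measurable])
  moreover have "?e (zfloor x) (- of_zvec (zfloor x) + x) = h (zfrac x) (zfloor x)" for x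
    using zfrac_in_cube[of x] by (simp add: zfrac_def)
  ultimately show ?thesis by (simp only:)
qed

lemma nn_integral_lebesgue_translate:
  fixes f :: "'a::euclidean_space \<Rightarrow> ennreal"
  assumes "f \<in> borel_measurable lebesgue"
  shows "(\<integral>\<^sup>+x. f (t + x) \<partial>lebesgue) = (\<integral>\<^sup>+x. f x \<partial>lebesgue)"
  using nn_integral_distr[OF measurable_lebesgue_translation, of f t] assms
  unfolding distr_lebesgue_translation by simp

lemma nn_integral_lebesgue_tiles:
  fixes f :: "real^'d \<Rightarrow> ennreal"
  assumes f [measurable]: "f \<in> borel_measurable lebesgue"
  shows "(\<integral>\<^sup>+x. f x \<partial>lebesgue) =
    (\<integral>\<^sup>+\<omega>. (\<integral>\<^sup>+k. f (of_zvec k + \<omega>) \<partial>count_space UNIV) * indicator unit_cube \<omega> \<partial>lebesgue)"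
proof -
  have [measurable]: "(\<lambda>x. f (of_zvec k + x)) \<in> borel_measurable lebesgue" for k
    by (rule measurable_compose[OF measurable_lebesgue_translation f])
  have [measurable]: "(\<lambda>x. indicator unit_cube (- of_zvec k + x) :: ennreal) \<in> borel_measurable (lebesgue :: (real^'d) measure)" for k
    by (rule measurable_compose[OF measurable_lebesgue_translation]) measurable
  have "(\<integral>\<^sup>+x. f x \<partial>lebesgue) = (\<integral>\<^sup>+x. (\<integral>\<^sup>+k. f x * indicator unit_cube (- of_zvec k + x) \<partial>count_space (UNIV :: (int^'d) set)) \<partial>lebesgue)"
  proof (intro nn_integral_cong)
    fix x :: "real^'d"
    have "indicator unit_cube (- of_zvec k + x) = (indicator {zfloor x} k :: ennreal)" for k
    proof -
      have "- of_zvec k + x \<in> unit_cube \<longleftrightarrow> k = zfloor x"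
      proof
        assume "- of_zvec k + x \<in> unit_cube"
        from zfloor_cube[OF this, of k] show "k = zfloor x" by simp
      next
        assume "k = zfloor x"
        then show "- of_zvec k + x \<in> unit_cube" using zfrac_in_cube[of x] by (simp add: zfrac_def)
      qed
      then show ?thesis by (simp add: indicator_def)
    qed
    then have "(\<integral>\<^sup>+k. f x * indicator unit_cube (- of_zvec k + x) \<partial>count_space (UNIV :: (int^'d) set)) =
       (\<integral>\<^sup>+k. f x * indicator {zfloor x} k \<partial>count_space (UNIV :: (int^'d) set))" by (simp only:)
    also have "\<dots> = f x" by (simp add: nn_integral_cmult)
    finally show "f x = (\<integral>\<^sup>+k. f x * indicator unit_cube (- of_zvec k + x) \<partial>count_space (UNIV :: (int^'d) set))" ..
  qed
  also have "\<dots> = (\<integral>\<^sup>+k. (\<integral>\<^sup>+x. f x * indicator unit_cube (- of_zvec k + x) \<partial>lebesgue) \<partial>count_space (UNIV :: (int^'d) set))"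
    by (rule nn_integral_count_space_nn_integral) measurable
  also have "\<dots> = (\<integral>\<^sup>+k. (\<integral>\<^sup>+x. f (of_zvec k + x) * indicator unit_cube x \<partial>lebesgue) \<partial>count_space (UNIV :: (int^'d) set))"
  proof (rule nn_integral_cong)
    fix k :: "int^'d"
    have "(\<lambda>x. f x * indicator unit_cube (- of_zvec k + x)) \<in> borel_measurable lebesgue" by measurable
    from nn_integral_lebesgue_translate[OF this, of "of_zvec k"]
    show "(\<integral>\<^sup>+x. f x * indicator unit_cube (- of_zvec k + x) \<partial>lebesgue) = (\<integral>\<^sup>+x. f (of_zvec k + x) * indicator unit_cube x \<partial>lebesgue)"
      by simp
  qed
  also have "\<dots> = (\<integral>\<^sup>+x. (\<integral>\<^sup>+k. f (of_zvec k + x) * indicator unit_cube x \<partial>count_space (UNIV :: (int^'d) set)) \<partial>lebesgue)"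
    by (rule nn_integral_count_space_nn_integral[symmetric]) measurable
  also have "\<dots> = (\<integral>\<^sup>+x. (\<integral>\<^sup>+k. f (of_zvec k + x) \<partial>count_space UNIV) * indicator unit_cube x \<partial>lebesgue)"
    by (intro nn_integral_cong nn_integral_multc) simp
  finally show ?thesis .
qed

lemma unfold_field_L2:
  fixes h :: "real^'d \<Rightarrow> int^'d \<Rightarrow> complex"
  assumes m: "\<And>k. (\<lambda>\<omega>. h \<omega> k) \<in> borel_measurable cube"
    and bound: "AE \<omega> in cube. energy (count_space UNIV) (h \<omega>) \<le> ennreal C"
  shows "(\<lambda>x. h (zfrac x) (zfloor x)) \<in> L2_space lebesgue"
proof -
  have [measurable]: "(\<lambda>x. h (zfrac x) (zfloor x)) \<in> borel_measurable lebesgue"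
    by (rule unfold_field_measurable[OF m])
  have "energy lebesgue (\<lambda>x. h (zfrac x) (zfloor x)) =
     (\<integral>\<^sup>+\<omega>. (\<integral>\<^sup>+k. ennreal ((cmod (h (zfrac (of_zvec k + \<omega>)) (zfloor (of_zvec k + \<omega>))))\<^sup>2) \<partial>count_space UNIV) * indicator unit_cube \<omega> \<partial>lebesgue)"
    unfolding energy_def by (rule nn_integral_lebesgue_tiles) measurable
  also have "\<dots> = (\<integral>\<^sup>+\<omega>. energy (count_space UNIV) (h \<omega>) * indicator unit_cube \<omega> \<partial>lebesgue)"
  proof (intro nn_integral_cong)
    fix \<omega> :: "real^'d"
    show "(\<integral>\<^sup>+k. ennreal ((cmod (h (zfrac (of_zvec k + \<omega>)) (zfloor (of_zvec k + \<omega>))))\<^sup>2) \<partial>count_space UNIV) * indicator unit_cube \<omega>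
       = energy (count_space UNIV) (h \<omega>) * indicator unit_cube \<omega>"
    proof (cases "\<omega> \<in> unit_cube")
      case True
      then have "zfrac (of_zvec k + \<omega>) = \<omega>" "zfloor (of_zvec k + \<omega>) = k" for k
        using zfrac_cube[OF True, of k] zfloor_cube[OF True, of k] by (simp_all only: add.commute)
      then show ?thesis by (simp only: energy_def)
    qed simp
  qed
  also have "\<dots> \<le> (\<integral>\<^sup>+\<omega>. ennreal C * indicator unit_cube \<omega> \<partial>(lebesgue :: (real^'d) measure))"
  proof (rule nn_integral_mono_AE)
    show "AE \<omega> in lebesgue. energy (count_space UNIV) (h \<omega>) * indicator unit_cube \<omega> \<le> ennreal C * indicator unit_cube \<omega>"
      using bound unfolding AE_cube_iff by eventually_elim (auto simp: indicator_def)
  qed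
  also have "\<dots> = ennreal C * emeasure lborel (unit_cube :: (real^'d) set)"
    by (simp add: nn_integral_cmult)
  also have "\<dots> < \<infinity>" using emeasure_unit_cube_finite[where 'd='d] by (simp add: ennreal_mult_less_top)
  finally show ?thesis unfolding L2_space_iff_energy by simp
qed

lemma fiberization_eqI:
  assumes "AE x in lebesgue. fourier f x = G x"
  shows "AE \<omega> in cube. fiberization f \<omega> = (\<lambda>k. G (\<omega> + of_zvec k))"
  using assms unfolding AE_lebesgue_iff_AE_cube fiberization_def by eventually_elim (simp add: fun_eq_iff)

lemma fiberization_injective:
  assumes "f \<in> L2_space lebesgue" "g \<in> L2_space lebesgue"
    and "AE \<omega> in cube. fiberization f \<omega> = fiberization g \<omega>"
  shows "AE x in lebesgue. f x = g x"
proof (rule fourier_injective[OF assms(1,2)])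
  show "AE x in lebesgue. fourier f x = fourier g x"
    unfolding AE_lebesgue_iff_AE_cube using assms(3)
    by eventually_elim (simp add: fiberization_def fun_eq_iff)
qed

lemma fiberization_cong_AE:
  assumes "f \<in> L2_space lebesgue" "g \<in> L2_space lebesgue" "AE x in lebesgue. f x = g x"
  shows "AE \<omega> in cube. fiberization f \<omega> = fiberization g \<omega>"
  using fiberization_eqI[OF fourier_cong_AE[OF assms]] by (simp add: fiberization_def)

lemma fiberization_sum:
  assumes "\<And>i. i \<in> I \<Longrightarrow> f i \<in> L2_space lebesgue"
  shows "AE \<omega> in cube. fiberization (\<lambda>x. \<Sum>i\<in>I. f i x) \<omega> = (\<lambda>k. \<Sum>i\<in>I. fiberization (f i) \<omega> k)"
  using fiberization_eqI[OF fourier_sum[OF assms]] by (simp add: fiberization_def)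

lemma fiberization_zero: "AE \<omega> in cube. fiberization (\<lambda>x. 0) \<omega> = (\<lambda>k. 0)"
  using fiberization_eqI[OF fourier_zero] by simp

lemma fiberization_measurable:
  fixes f :: "real^'d \<Rightarrow> complex"
  assumes "f \<in> L2_space lebesgue"
  shows "(\<lambda>\<omega>. fiberization f \<omega> k) \<in> borel_measurable cube"
proof -
  have "fourier f \<in> borel_measurable lebesgue" by (rule L2_space_measurable[OF fourier_L2[OF assms]])
  from measurable_compose[OF measurable_lebesgue_translation this, of "of_zvec k"]
  have "(\<lambda>\<omega>. fiberization f \<omega> k) \<in> borel_measurable lebesgue"
    by (simp add: fiberization_def add.commute)
  then show ?thesis by (rule measurable_restrict_space1)
qed

text \<open>
  A uniform bound on the fibers suffices for square-integrability because the cube has finite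
  measure.
\<close>

theorem fiberization_surjective:
  fixes h :: "real^'d \<Rightarrow> int^'d \<Rightarrow> complex"
  assumes m: "\<And>k. (\<lambda>\<omega>. h \<omega> k) \<in> borel_measurable cube"
    and bound: "AE \<omega> in cube. energy (count_space UNIV) (h \<omega>) \<le> ennreal C"
  obtains f where "f \<in> L2_space lebesgue" "AE \<omega> in cube. fiberization f \<omega> = h \<omega>"
proof -
  obtain f where f: "f \<in> L2_space lebesgue" "AE x in lebesgue. fourier f x = h (zfrac x) (zfloor x)"
    using fourier_surjective[OF unfold_field_L2[OF m bound]] by metis
  have "AE \<omega> in cube. fiberization f \<omega> = h \<omega>"
    using fiberization_eqI[OF f(2)] AE_space[of cube]
  proof eventually_elim
    case (elim \<omega>)
    then have "\<omega> \<in> unit_cube" by simp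
    then show ?case using elim(1) by (simp add: zfrac_cube zfloor_cube)
  qed
  then show ?thesis using f(1) by (intro that)
qed

text \<open>
  Multiplying the fibers by \<open>m\<close> means multiplying the Fourier transform by the periodic extension
  of \<open>m\<close>.
\<close>

theorem fiberization_multiplier:
  fixes f :: "real^'d \<Rightarrow> complex"
  assumes f: "f \<in> L2_space lebesgue"
    and m: "m \<in> borel_measurable cube" and bound: "AE \<omega> in cube. cmod (m \<omega>) \<le> C"
  obtains g where "g \<in> L2_space lebesgue" "AE \<omega> in cube. fiberization g \<omega> = (\<lambda>k. m \<omega> * fiberization f \<omega> k)"
proof -
  have mm: "(\<lambda>x. m (zfrac x)) \<in> borel_measurable lebesgue"
    using unfold_field_measurable[of "\<lambda>\<omega> k. m \<omega>"] m by simp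
  have "AE \<omega> in cube. \<forall>k. cmod (m (zfrac (\<omega> + of_zvec k))) \<le> C"
    using bound AE_space[of cube]
  proof eventually_elim
    case (elim \<omega>)
    then show ?case by (simp add: zfrac_cube)
  qed
  then have "AE x in lebesgue. cmod (m (zfrac x)) \<le> C"
    unfolding AE_lebesgue_iff_AE_cube .
  from L2_space_bounded_mult[OF this mm fourier_L2[OF f]]
  obtain g where g: "g \<in> L2_space lebesgue" "AE x in lebesgue. fourier g x = m (zfrac x) * fourier f x"
    using fourier_surjective by metis
  have "AE \<omega> in cube. fiberization g \<omega> = (\<lambda>k. m \<omega> * fiberization f \<omega> k)"
    using fiberization_eqI[OF g(2)] AE_space[of cube]
  proof eventually_elim
    case (elim \<omega>)
    then have "\<omega> \<in> unit_cube" by simp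
    then show ?case using elim(1) by (simp add: zfrac_cube fiberization_def)
  qed
  then show ?thesis using g(1) by (intro that)
qed

lemma bounded_spectrum_measurable:
  "bounded_spectrum a \<Longrightarrow> fourier_series a \<in> borel_measurable cube"
proof -
  assume "bounded_spectrum a"
  then have "is_fourier_series a (fourier_series a)"
    unfolding bounded_spectrum_def by (intro is_fourier_series_fourier_series) (rule conjunct1)
  then show ?thesis unfolding is_fourier_series_def by (intro L2_space_measurable) (rule conjunct1)
qed

lemma Lambda_op:
  assumes a: "bounded_spectrum a" and f: "f \<in> L2_space lebesgue"
  shows "Lambda_op a f \<in> L2_space lebesgue"
    "AE \<omega> in cube. fiberization (Lambda_op a f) \<omega> = (\<lambda>k. fourier_series a \<omega> * fiberization f \<omega> k)"
proof -
  obtain C where C: "AE \<omega> in cube. cmod (fourier_series a \<omega>) \<le> C"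
    using a unfolding bounded_spectrum_def by blast
  have "\<exists>g. g \<in> L2_space lebesgue \<and> (AE \<omega> in cube. fiberization g \<omega> = (\<lambda>k. fourier_series a \<omega> * fiberization f \<omega> k))"
    by (rule fiberization_multiplier[OF f bounded_spectrum_measurable[OF a] C]) (rule exI, rule conjI)
  from someI_ex[OF this]
  have *: "Lambda_op a f \<in> L2_space lebesgue \<and>
    (AE \<omega> in cube. fiberization (Lambda_op a f) \<omega> = (\<lambda>k. fourier_series a \<omega> * fiberization f \<omega> k))"
    unfolding Lambda_op_def .
  show "Lambda_op a f \<in> L2_space lebesgue" using * by (rule conjunct1)
  show "AE \<omega> in cube. fiberization (Lambda_op a f) \<omega> = (\<lambda>k. fourier_series a \<omega> * fiberization f \<omega> k)"
    using * by (rule conjunct2)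
qed

text \<open>
  As fiberization is injective up to null sets, the equation \<open>L f = \<Lambda>\<^sub>a f\<close> may be tested on
  fibers.
\<close>

lemma s_eigenspace_iff_fiberwise:
  assumes a: "bounded_spectrum a" and V: "V \<subseteq> L2_space lebesgue" and L: "\<And>f. f \<in> V \<Longrightarrow> L f \<in> V"
  shows "f \<in> s_eigenspace V L a \<longleftrightarrow> f \<in> V \<and>
    (AE \<omega> in cube. fiberization (L f) \<omega> = (\<lambda>k. fourier_series a \<omega> * fiberization f \<omega> k))"
proof (cases "f \<in> V")
  case True
  then have f: "f \<in> L2_space lebesgue" and Lf: "L f \<in> L2_space lebesgue" using V L by auto
  note \<Lambda> = Lambda_op[OF a f]
  have "(AE x in lebesgue. L f x = Lambda_op a f x) \<longleftrightarrow>
    (AE \<omega> in cube. fiberization (L f) \<omega> = (\<lambda>k. fourier_series a \<omega> * fiberization f \<omega> k))"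
  proof
    assume "AE x in lebesgue. L f x = Lambda_op a f x"
    from fiberization_cong_AE[OF Lf \<Lambda>(1) this] \<Lambda>(2)
    show "AE \<omega> in cube. fiberization (L f) \<omega> = (\<lambda>k. fourier_series a \<omega> * fiberization f \<omega> k)"
      by eventually_elim simp
  next
    assume "AE \<omega> in cube. fiberization (L f) \<omega> = (\<lambda>k. fourier_series a \<omega> * fiberization f \<omega> k)"
    with \<Lambda>(2) have "AE \<omega> in cube. fiberization (L f) \<omega> = fiberization (Lambda_op a f) \<omega>"
      by eventually_elim simp
    then show "AE x in lebesgue. L f x = Lambda_op a f x" by (rule fiberization_injective[OF Lf \<Lambda>(1)])
  qed
  then show ?thesis using True by (simp add: s_eigenspace_def)
next
  case False
  then show ?thesis by (simp add: s_eigenspace_def)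
qed

section \<open>Orthogonal projection onto closed subspaces\<close>

lemma closed_subspaceD:
  assumes "closed_subspace M S"
  shows "f \<in> S \<Longrightarrow> f \<in> L2_space M" "(\<lambda>_. 0) \<in> S"
    "f \<in> S \<Longrightarrow> g \<in> S \<Longrightarrow> (\<lambda>x. f x + g x) \<in> S" "f \<in> S \<Longrightarrow> (\<lambda>x. c * f x) \<in> S"
    "(\<And>n. s n \<in> S) \<Longrightarrow> L2_tendsto M s f \<Longrightarrow> f \<in> S"
proof -
  note * = assms[unfolded closed_subspace_def]
  show "f \<in> S \<Longrightarrow> f \<in> L2_space M" using * by blast
  show "(\<lambda>_. 0) \<in> S" using * by blast
  show "f \<in> S \<Longrightarrow> g \<in> S \<Longrightarrow> (\<lambda>x. f x + g x) \<in> S" using * by simp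
  show "f \<in> S \<Longrightarrow> (\<lambda>x. c * f x) \<in> S" using * by simp
  show "(\<And>n. s n \<in> S) \<Longrightarrow> L2_tendsto M s f \<Longrightarrow> f \<in> S" using * by meson
qed

lemma closed_subspace_diff:
  assumes "closed_subspace M S" "f \<in> S" "g \<in> S" shows "(\<lambda>x. f x - g x) \<in> S"
  using closed_subspaceD(3)[OF assms(1,2) closed_subspaceD(4)[OF assms(1,3), of "-1"]] by simp

lemma closed_subspace_sum:
  assumes "closed_subspace M S" "\<And>i. i \<in> I \<Longrightarrow> f i \<in> S"
  shows "(\<lambda>x. \<Sum>i\<in>I. f i x) \<in> S"
  using assms(2)
proof (induction I rule: infinite_finite_induct)
  case (insert i I)
  have "(\<lambda>x. f i x + (\<Sum>j\<in>I. f j x)) \<in> S"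
    by (rule closed_subspaceD(3)[OF assms(1)]) (use insert in auto)
  then show ?case using insert.hyps by simp
qed (simp_all add: closed_subspaceD(2)[OF assms(1)])

lemma L2_inner_integrable:
  assumes "f \<in> L2_space M" "g \<in> L2_space M"
  shows "integrable M (\<lambda>x. f x * cnj (g x))"
proof (rule Bochner_Integration.integrable_bound)
  have [measurable]: "f \<in> borel_measurable M" "g \<in> borel_measurable M"
    using assms by (auto intro: L2_space_measurable)
  show "integrable M (\<lambda>x. (cmod (f x))\<^sup>2 + (cmod (g x))\<^sup>2)"
    using assms by (intro Bochner_Integration.integrable_add) (simp_all add: L2_space_def)
  show "(\<lambda>x. f x * cnj (g x)) \<in> borel_measurable M" by measurable
  show "AE x in M. norm (f x * cnj (g x)) \<le> norm ((cmod (f x))\<^sup>2 + (cmod (g x))\<^sup>2)"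
  proof (rule AE_I2)
    fix x
    have "2 * (cmod (f x) * cmod (g x)) \<le> (cmod (f x))\<^sup>2 + (cmod (g x))\<^sup>2"
      using sum_squares_bound[of "cmod (f x)" "cmod (g x)"] by (simp add: mult.assoc)
    moreover have "0 \<le> cmod (f x) * cmod (g x)" by simp
    ultimately have "cmod (f x) * cmod (g x) \<le> (cmod (f x))\<^sup>2 + (cmod (g x))\<^sup>2" by linarith
    then show "norm (f x * cnj (g x)) \<le> norm ((cmod (f x))\<^sup>2 + (cmod (g x))\<^sup>2)"
      by (simp add: norm_mult)
  qed
qed

lemma L2_inner_diff_left:
  assumes "f \<in> L2_space M" "g \<in> L2_space M" "v \<in> L2_space M"
  shows "L2_inner M (\<lambda>x. f x - g x) v = L2_inner M f v - L2_inner M g v"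
  unfolding L2_inner_def left_diff_distrib
  by (intro Bochner_Integration.integral_diff L2_inner_integrable assms)

lemma L2_inner_cmult_left: "L2_inner M (\<lambda>x. c * f x) v = c * L2_inner M f v"
  unfolding L2_inner_def mult.assoc by (rule integral_mult_right_zero)

lemma L2_inner_sum_left:
  assumes "\<And>i. i \<in> I \<Longrightarrow> f i \<in> L2_space M" "v \<in> L2_space M"
  shows "L2_inner M (\<lambda>x. \<Sum>i\<in>I. f i x) v = (\<Sum>i\<in>I. L2_inner M (f i) v)"
  unfolding L2_inner_def sum_distrib_right
  by (intro Bochner_Integration.integral_sum L2_inner_integrable assms)

lemma L2_inner_cauchy_schwarz:
  assumes "f \<in> L2_space M" "g \<in> L2_space M"
  shows "ennreal ((cmod (L2_inner M f g))\<^sup>2) \<le> energy M f * energy M g"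
proof -
  have [measurable]: "f \<in> borel_measurable M" "g \<in> borel_measurable M"
    using assms by (auto intro: L2_space_measurable)
  have "ennreal (cmod (L2_inner M f g)) \<le> (\<integral>\<^sup>+x. ennreal (cmod (f x * cnj (g x))) \<partial>M)"
    unfolding L2_inner_def by (rule norm_integral_le_nn_integral)
  also have "\<dots> = (\<integral>\<^sup>+x. ennreal (cmod (f x)) * ennreal (cmod (g x)) \<partial>M)"
    by (intro nn_integral_cong) (simp add: norm_mult ennreal_mult)
  finally have "(ennreal (cmod (L2_inner M f g)))\<^sup>2 \<le> (\<integral>\<^sup>+x. ennreal (cmod (f x)) * ennreal (cmod (g x)) \<partial>M)\<^sup>2"
    by (rule power_mono) simp
  also have "\<dots> \<le> (\<integral>\<^sup>+x. (ennreal (cmod (f x)))\<^sup>2 \<partial>M) * (\<integral>\<^sup>+x. (ennreal (cmod (g x)))\<^sup>2 \<partial>M)"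
    by (rule Cauchy_Schwarz_nn_integral) measurable
  finally show ?thesis by (simp add: ennreal_power energy_def)
qed

text \<open>
  The variation used in the projection theorem: subtract from \<open>f\<close> a multiple of \<open>v\<close> in the
  direction in which the norm decreases fastest.
\<close>

lemma L2_norm_power2_diff_scaled:
  assumes f: "f \<in> L2_space M" and v: "v \<in> L2_space M"
  shows "(L2_norm M (\<lambda>x. f x - (complex_of_real t * L2_inner M f v) * v x))\<^sup>2 =
    (L2_norm M f)\<^sup>2 - 2 * t * (cmod (L2_inner M f v))\<^sup>2 + t\<^sup>2 * (cmod (L2_inner M f v))\<^sup>2 * (L2_norm M v)\<^sup>2"
proof -
  let ?w = "L2_inner M f v"
  let ?c = "complex_of_real t * ?w"
  have fi: "integrable M (\<lambda>x. (cmod (f x))\<^sup>2)" and vi: "integrable M (\<lambda>x. (cmod (v x))\<^sup>2)"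
    using f v by (simp_all add: L2_space_def)
  have fvi: "integrable M (\<lambda>x. f x * cnj (v x))" by (rule L2_inner_integrable[OF f v])
  have expand: "(cmod (f x - ?c * v x))\<^sup>2 = (cmod (f x))\<^sup>2 - 2 * Re (cnj ?c * (f x * cnj (v x))) + (cmod ?c)\<^sup>2 * (cmod (v x))\<^sup>2" for x
  proof -
    have "(cmod (a - b))\<^sup>2 = (cmod a)\<^sup>2 - 2 * Re (a * cnj b) + (cmod b)\<^sup>2" for a b
      unfolding cmod_power2 by (simp add: power2_eq_square algebra_simps)
    then have "(cmod (f x - ?c * v x))\<^sup>2 = (cmod (f x))\<^sup>2 - 2 * Re (f x * cnj (?c * v x)) + (cmod (?c * v x))\<^sup>2" .
    also have "f x * cnj (?c * v x) = cnj ?c * (f x * cnj (v x))" by (simp add: mult_ac)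
    finally show ?thesis by (simp only: norm_mult power_mult_distrib)
  qed
  have i2: "integrable M (\<lambda>x. 2 * Re (cnj ?c * (f x * cnj (v x))))"
    by (intro integrable_mult_right integrable_Re fvi)
  have i3: "integrable M (\<lambda>x. (cmod ?c)\<^sup>2 * (cmod (v x))\<^sup>2)" by (intro integrable_mult_right vi)
  have "(L2_norm M (\<lambda>x. f x - ?c * v x))\<^sup>2 = (\<integral>x. (cmod (f x))\<^sup>2 \<partial>M) - (\<integral>x. 2 * Re (cnj ?c * (f x * cnj (v x))) \<partial>M) + (\<integral>x. (cmod ?c)\<^sup>2 * (cmod (v x))\<^sup>2 \<partial>M)"
    unfolding L2_norm_power2 expand
    by (simp only: Bochner_Integration.integral_add[OF Bochner_Integration.integrable_diff[OF fi i2] i3]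
          Bochner_Integration.integral_diff[OF fi i2])
  also have "(\<integral>x. 2 * Re (cnj ?c * (f x * cnj (v x))) \<partial>M) = 2 * Re (cnj ?c * ?w)"
    unfolding L2_inner_def[of M f v] integral_mult_right_zero
    by (subst integral_Re) (auto intro!: integrable_mult_right fvi)
  also have "Re (cnj ?c * ?w) = t * (cmod ?w)\<^sup>2"
    unfolding cmod_power2 by (simp add: power2_eq_square algebra_simps)
  also have "(\<integral>x. (cmod ?c)\<^sup>2 * (cmod (v x))\<^sup>2 \<partial>M) = t\<^sup>2 * (cmod ?w)\<^sup>2 * (L2_norm M v)\<^sup>2"
    by (simp add: L2_norm_power2 norm_mult power_mult_distrib)
  finally show ?thesis unfolding L2_norm_power2[of M f] by (simp only: mult.assoc)
qed

lemma L2_parallelogram: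
  assumes f: "f \<in> L2_space M" and g: "g \<in> L2_space M"
  shows "(L2_norm M (\<lambda>x. f x - g x))\<^sup>2 = 2 * (L2_norm M f)\<^sup>2 + 2 * (L2_norm M g)\<^sup>2 - (L2_norm M (\<lambda>x. f x + g x))\<^sup>2"
proof -
  have i: "integrable M (\<lambda>x. (cmod (f x))\<^sup>2)" "integrable M (\<lambda>x. (cmod (g x))\<^sup>2)"
      "integrable M (\<lambda>x. (cmod (f x + g x))\<^sup>2)"
    using f g L2_space_add[OF f g] by (simp_all add: L2_space_def)
  have "(cmod (f x - g x))\<^sup>2 = 2 * (cmod (f x))\<^sup>2 + 2 * (cmod (g x))\<^sup>2 - (cmod (f x + g x))\<^sup>2" for x
    unfolding cmod_power2 by (simp add: power2_eq_square algebra_simps)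
  then show ?thesis unfolding L2_norm_power2 using i by simp
qed

text \<open>
  A minimizing sequence for the distance from \<open>u\<close> to \<open>S\<close> is Cauchy by the parallelogram law.
  Near-minimality makes the inner products of \<open>u - s\<^sub>n\<close> with elements of \<open>S\<close> small, so in the limit
  they vanish.
\<close>

theorem L2_projection_exists:
  assumes S: "closed_subspace M S" and u: "u \<in> L2_space M"
  shows "\<exists>p\<in>S. \<forall>v\<in>S. L2_inner M (\<lambda>x. u x - p x) v = 0"
proof -
  define Q where "Q v = (L2_norm M (\<lambda>x. u x - v x))\<^sup>2" for v
  define d where "d = (INF v\<in>S. Q v)"
  have ne: "S \<noteq> {}" using closed_subspaceD(2)[OF S] by blast
  have bdd: "bdd_below (Q ` S)" by (rule bdd_belowI[of _ 0]) (auto simp: Q_def)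
  have d_le: "d \<le> Q v" if "v \<in> S" for v unfolding d_def by (rule cINF_lower[OF bdd that])
  have SL: "f \<in> L2_space M" if "f \<in> S" for f by (rule closed_subspaceD(1)[OF S that])
  have "\<exists>v\<in>S. Q v < d + inverse (real (Suc n))" for n
  proof -
    have "(INF v\<in>S. Q v) < d + inverse (real (Suc n))" unfolding d_def by simp
    then show ?thesis using cINF_less_iff[OF ne bdd] by blast
  qed
  then obtain s where s: "\<And>n. s n \<in> S" "\<And>n. Q (s n) < d + inverse (real (Suc n))" by metis
  have us: "(\<lambda>x. u x - s n x) \<in> L2_space M" for n by (rule L2_space_diff[OF u SL[OF s(1)]])
  have cauchy: "(L2_norm M (\<lambda>x. s m x - s n x))\<^sup>2 \<le> 2 * inverse (real (Suc m)) + 2 * inverse (real (Suc n))" for m n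
  proof -
    \<comment> \<open>the midpoint lies in \<open>S\<close>, so its distance to \<open>u\<close> is not below the infimum\<close>
    let ?mid = "\<lambda>x. (1/2) * (s m x + s n x)"
    have mid: "?mid \<in> S"
      by (rule closed_subspaceD(4)[OF S closed_subspaceD(3)[OF S s(1) s(1)]])
    have "(L2_norm M (\<lambda>x. s m x - s n x))\<^sup>2 = (L2_norm M (\<lambda>x. (u x - s n x) - (u x - s m x)))\<^sup>2"
      by simp
    also have "\<dots> = 2 * Q (s n) + 2 * Q (s m) - (L2_norm M (\<lambda>x. (u x - s n x) + (u x - s m x)))\<^sup>2"
      unfolding Q_def by (rule L2_parallelogram[OF us us])
    also have "(L2_norm M (\<lambda>x. (u x - s n x) + (u x - s m x)))\<^sup>2 = 4 * Q ?mid"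
    proof -
      have "cmod ((u x - s n x) + (u x - s m x)) = 2 * cmod (u x - ?mid x)" for x
      proof -
        have "(u x - s n x) + (u x - s m x) = 2 * (u x - ?mid x)" by (simp add: algebra_simps)
        then show ?thesis by (simp only: norm_mult) simp
      qed
      then show ?thesis unfolding Q_def L2_norm_power2 by (simp add: power_mult_distrib)
    qed
    finally show ?thesis using d_le[OF mid] s(2)[of m] s(2)[of n] by linarith
  qed
  have "\<exists>p. L2_tendsto M s p"
  proof (rule L2_complete[OF SL[OF s(1)]])
    fix e :: ennreal assume "0 < e"
    have "(\<lambda>n. ennreal (4 * inverse (real (Suc n)))) \<longlonglongrightarrow> ennreal (4 * 0)"
      by (intro tendsto_intros LIMSEQ_inverse_real_of_nat)
    then obtain N where N: "ennreal (4 * inverse (real (Suc N))) < e"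
      using ennreal_tendsto_0D[of "\<lambda>n. ennreal (4 * inverse (real (Suc n)))" e] \<open>0 < e\<close> by auto
    show "\<exists>N. \<forall>m\<ge>N. \<forall>n\<ge>N. energy M (\<lambda>x. s m x - s n x) < e"
    proof (intro exI allI impI)
      fix m n assume mn: "N \<le> m" "N \<le> n"
      have "energy M (\<lambda>x. s m x - s n x) = ennreal ((L2_norm M (\<lambda>x. s m x - s n x))\<^sup>2)"
        by (rule L2_norm_energy(1)[OF L2_space_diff[OF SL[OF s(1)] SL[OF s(1)]], symmetric])
      also have "\<dots> \<le> ennreal (4 * inverse (real (Suc N)))"
      proof (rule ennreal_leI)
        have "inverse (real (Suc m)) \<le> inverse (real (Suc N))" "inverse (real (Suc n)) \<le> inverse (real (Suc N))"
          using mn by (auto intro!: le_imp_inverse_le)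
        then show "(L2_norm M (\<lambda>x. s m x - s n x))\<^sup>2 \<le> 4 * inverse (real (Suc N))"
          using cauchy[of m n] by linarith
      qed
      finally show "energy M (\<lambda>x. s m x - s n x) < e" using N by (rule le_less_trans)
    qed
  qed
  then obtain p where p: "L2_tendsto M s p" by blast
  have pS: "p \<in> S" by (rule closed_subspaceD(5)[OF S s(1) p])
  show ?thesis
  proof (intro bexI[OF _ pS] ballI)
    fix v assume v: "v \<in> S"
    have vL: "v \<in> L2_space M" and pL: "p \<in> L2_space M" by (rule SL[OF v], rule SL[OF pS])
    let ?w = "\<lambda>n. L2_inner M (\<lambda>x. u x - s n x) v"
    \<comment> \<open>adding 1 avoids a case distinction on \<open>v = 0\<close> in the choice of the step \<open>1 / B\<close>\<close>
    let ?B = "1 + (L2_norm M v)\<^sup>2"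
    have B: "1 \<le> ?B" by simp
    have small: "(cmod (?w n))\<^sup>2 \<le> ?B * inverse (real (Suc n))" for n
    proof -
      let ?t = "inverse ?B"
      have t: "0 < ?t" using B by (intro positive_imp_inverse_positive) linarith
      have "(\<lambda>x. s n x + (complex_of_real ?t * ?w n) * v x) \<in> S"
        by (rule closed_subspaceD(3)[OF S s(1) closed_subspaceD(4)[OF S v]])
      from d_le[OF this] have "d \<le> (L2_norm M (\<lambda>x. (u x - s n x) - (complex_of_real ?t * ?w n) * v x))\<^sup>2"
        unfolding Q_def by (simp only: diff_diff_eq)
      also have "\<dots> = Q (s n) - 2 * ?t * (cmod (?w n))\<^sup>2 + ?t\<^sup>2 * (cmod (?w n))\<^sup>2 * (L2_norm M v)\<^sup>2"
        unfolding L2_norm_power2_diff_scaled[OF us vL] Q_def ..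
      finally have 1: "2 * ?t * (cmod (?w n))\<^sup>2 - ?t\<^sup>2 * (cmod (?w n))\<^sup>2 * (L2_norm M v)\<^sup>2 \<le> inverse (real (Suc n))"
        using s(2)[of n] by linarith
      have "?t * (L2_norm M v)\<^sup>2 \<le> ?t * ?B" using t by (intro mult_left_mono) auto
      also have "\<dots> = 1" using B by (intro left_inverse) linarith
      finally have "?t * (cmod (?w n))\<^sup>2 * (?t * (L2_norm M v)\<^sup>2) \<le> ?t * (cmod (?w n))\<^sup>2 * 1"
        using t by (intro mult_left_mono) auto
      then have "?t\<^sup>2 * (cmod (?w n))\<^sup>2 * (L2_norm M v)\<^sup>2 \<le> ?t * (cmod (?w n))\<^sup>2"
        by (simp only: power2_eq_square mult_ac mult_1)
      with 1 have "?t * (cmod (?w n))\<^sup>2 \<le> inverse (real (Suc n))" by linarith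
      then have "?B * (?t * (cmod (?w n))\<^sup>2) \<le> ?B * inverse (real (Suc n))" using B by (intro mult_left_mono) auto
      moreover have "?B * (?t * (cmod (?w n))\<^sup>2) = (cmod (?w n))\<^sup>2"
      proof -
        have "?B * ?t = 1" using B by (intro right_inverse) linarith
        then show ?thesis by (simp only: mult.assoc[symmetric] mult_1)
      qed
      ultimately show ?thesis by simp
    qed
    have "(\<lambda>n. (cmod (?w n))\<^sup>2) \<longlonglongrightarrow> 0"
    proof (rule tendsto_sandwich[OF _ _ tendsto_const])
      have "(\<lambda>n. ?B * inverse (real (Suc n))) \<longlonglongrightarrow> ?B * 0"
        by (intro tendsto_mult tendsto_const LIMSEQ_inverse_real_of_nat)
      then show "(\<lambda>n. ?B * inverse (real (Suc n))) \<longlonglongrightarrow> 0" by simp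
      show "\<forall>\<^sub>F n in sequentially. (cmod (?w n))\<^sup>2 \<le> ?B * inverse (real (Suc n))"
        by (intro always_eventually allI small)
    qed simp
    from tendsto_real_sqrt[OF this] have w0: "?w \<longlonglongrightarrow> 0"
      by (simp add: tendsto_norm_zero_iff)
    have diff: "?w n - L2_inner M (\<lambda>x. u x - p x) v = L2_inner M (\<lambda>x. p x - s n x) v" for n
    proof -
      have "?w n - L2_inner M (\<lambda>x. u x - p x) v = L2_inner M (\<lambda>x. (u x - s n x) - (u x - p x)) v"
        by (rule L2_inner_diff_left[symmetric, OF us L2_space_diff[OF u pL] vL])
      then show ?thesis by simp
    qed
    have "(\<lambda>n. energy M v * energy M (\<lambda>x. s n x - p x)) \<longlonglongrightarrow> energy M v * 0"
      using vL by (intro ennreal_tendsto_cmult L2_tendsto_D(3)[OF p]) (simp add: L2_space_iff_energy)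
    then have e0: "(\<lambda>n. energy M v * energy M (\<lambda>x. s n x - p x)) \<longlonglongrightarrow> 0" by (simp only: mult_zero_right)
    have "(\<lambda>n. ennreal ((cmod (L2_inner M (\<lambda>x. p x - s n x) v))\<^sup>2)) \<longlonglongrightarrow> 0"
    proof (rule tendsto_0_le_ennreal[OF e0], intro always_eventually allI)
      fix n
      have "ennreal ((cmod (L2_inner M (\<lambda>x. p x - s n x) v))\<^sup>2) \<le> energy M (\<lambda>x. p x - s n x) * energy M v"
        by (rule L2_inner_cauchy_schwarz[OF L2_space_diff[OF pL SL[OF s(1)]] vL])
      then show "ennreal ((cmod (L2_inner M (\<lambda>x. p x - s n x) v))\<^sup>2) \<le> energy M v * energy M (\<lambda>x. s n x - p x)"
        by (simp only: energy_minus_commute[of M p] mult.commute)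
    qed
    then have "(\<lambda>n. cmod (L2_inner M (\<lambda>x. p x - s n x) v)) \<longlonglongrightarrow> 0"
      by (rule tendsto_0_of_square) simp
    then have "(\<lambda>n. L2_inner M (\<lambda>x. p x - s n x) v) \<longlonglongrightarrow> 0"
      by (simp only: tendsto_norm_zero_iff)
    then have "(\<lambda>n. ?w n - L2_inner M (\<lambda>x. u x - p x) v) \<longlonglongrightarrow> 0" by (simp only: diff)
    from tendsto_diff[OF w0 this] have "(\<lambda>n::nat. L2_inner M (\<lambda>x. u x - p x) v) \<longlonglongrightarrow> 0" by simp
    then show "L2_inner M (\<lambda>x. u x - p x) v = 0" by (simp add: LIMSEQ_const_iff)
  qed
qed

section \<open>Orthogonal projection in sequence spaces\<close>

lemma AE_count_space_UNIV: "(AE x in count_space UNIV. Q x) \<longleftrightarrow> (\<forall>x. Q x)"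
  by (simp add: AE_count_space)

lemma ell2_inner_self_0:
  assumes "f \<in> ell2" "ell2_inner f f = 0"
  shows "f = (\<lambda>_. 0)"
proof -
  have "complex_of_real (\<integral>x. (cmod (f x))\<^sup>2 \<partial>count_space UNIV) = (\<integral>x. complex_of_real ((cmod (f x))\<^sup>2) \<partial>count_space UNIV)"
    by (simp only: integral_complex_of_real)
  also have "\<dots> = ell2_inner f f"
    unfolding L2_inner_def complex_norm_square ..
  finally have "(L2_norm (count_space UNIV) f)\<^sup>2 = 0"
    unfolding assms(2) L2_norm_power2 by (simp only: of_real_eq_0_iff)
  then have "energy (count_space UNIV) f = 0"
    using L2_norm_energy(1)[OF assms(1)] by simp
  then have "AE x in count_space UNIV. f x = 0"
    using energy_eq_0_iff[of f "count_space UNIV"] by simp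
  then show ?thesis unfolding AE_count_space_UNIV by (intro ext) blast
qed

lemma ell2_proj_unique:
  assumes S: "closed_subspace (count_space UNIV) S" and u: "u \<in> ell2"
    and p: "p \<in> S" "\<And>v. v \<in> S \<Longrightarrow> ell2_inner (\<lambda>k. u k - p k) v = 0"
    and q: "q \<in> S" "\<And>v. v \<in> S \<Longrightarrow> ell2_inner (\<lambda>k. u k - q k) v = 0"
  shows "p = q"
proof -
  have L: "p \<in> ell2" "q \<in> ell2" using closed_subspaceD(1)[OF S] p(1) q(1) by auto
  have d: "(\<lambda>k. p k - q k) \<in> S" by (rule closed_subspace_diff[OF S p(1) q(1)])
  have dL: "(\<lambda>k. p k - q k) \<in> ell2" by (rule closed_subspaceD(1)[OF S d])
  have "ell2_inner (\<lambda>k. (u k - q k) - (u k - p k)) (\<lambda>k. p k - q k) = 0"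
    unfolding L2_inner_diff_left[OF L2_space_diff[OF u L(2)] L2_space_diff[OF u L(1)] dL]
    by (simp only: p(2)[OF d] q(2)[OF d] diff_self)
  then have "ell2_inner (\<lambda>k. p k - q k) (\<lambda>k. p k - q k) = 0" by simp
  from ell2_inner_self_0[OF dL this] show ?thesis by (simp add: fun_eq_iff)
qed

lemma
  assumes S: "closed_subspace (count_space UNIV) S" and u: "u \<in> ell2"
  shows ell2_proj_mem: "ell2_proj S u \<in> S"
    and ell2_proj_orthogonal: "v \<in> S \<Longrightarrow> ell2_inner (\<lambda>k. u k - ell2_proj S u k) v = 0"
proof -
  obtain p where p: "p \<in> S" "\<forall>v\<in>S. ell2_inner (\<lambda>k. u k - p k) v = 0"
    using L2_projection_exists[OF S u] by blast
  have "ell2_proj S u = p"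
    unfolding ell2_proj_def
  proof (rule the_equality)
    fix q assume q: "q \<in> S \<and> (\<forall>v\<in>S. ell2_inner (\<lambda>k. u k - q k) v = 0)"
    show "q = p"
      by (rule ell2_proj_unique[OF S u]) (use p q in auto)
  qed (use p in simp)
  then show "ell2_proj S u \<in> S" "v \<in> S \<Longrightarrow> ell2_inner (\<lambda>k. u k - ell2_proj S u k) v = 0"
    using p by auto
qed

lemma ell2_proj_eqI:
  assumes S: "closed_subspace (count_space UNIV) S" and u: "u \<in> ell2"
    and p: "p \<in> S" "\<And>v. v \<in> S \<Longrightarrow> ell2_inner (\<lambda>k. u k - p k) v = 0"
  shows "ell2_proj S u = p"
  by (rule ell2_proj_unique[OF S u ell2_proj_mem[OF S u] ell2_proj_orthogonal[OF S u] p])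

lemma ell2_proj_id:
  assumes S: "closed_subspace (count_space UNIV) S" and u: "u \<in> S"
  shows "ell2_proj S u = u"
  by (rule ell2_proj_eqI[OF S closed_subspaceD(1)[OF S u] u]) (simp add: L2_inner_def)

lemma ell2_proj_sum:
  assumes S: "closed_subspace (count_space UNIV) S" and u: "\<And>i. i \<in> I \<Longrightarrow> u i \<in> ell2"
  shows "ell2_proj S (\<lambda>k. \<Sum>i\<in>I. c i * u i k) = (\<lambda>k. \<Sum>i\<in>I. c i * ell2_proj S (u i) k)"
proof (rule ell2_proj_eqI[OF S])
  show "(\<lambda>k. \<Sum>i\<in>I. c i * u i k) \<in> ell2" by (intro L2_space_sum L2_space_cmult u)
  show "(\<lambda>k. \<Sum>i\<in>I. c i * ell2_proj S (u i) k) \<in> S"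
    by (intro closed_subspace_sum[OF S] closed_subspaceD(4)[OF S] ell2_proj_mem[OF S] u)
  fix v assume v: "v \<in> S"
  have vL: "v \<in> ell2" by (rule closed_subspaceD(1)[OF S v])
  have "(\<Sum>i\<in>I. c i * u i k) - (\<Sum>i\<in>I. c i * ell2_proj S (u i) k) = (\<Sum>i\<in>I. c i * (u i k - ell2_proj S (u i) k))" for k
    by (simp only: right_diff_distrib sum_subtractf)
  then have "ell2_inner (\<lambda>k. (\<Sum>i\<in>I. c i * u i k) - (\<Sum>i\<in>I. c i * ell2_proj S (u i) k)) v =
     ell2_inner (\<lambda>k. \<Sum>i\<in>I. c i * (u i k - ell2_proj S (u i) k)) v" by (simp only:)
  also have "\<dots> = (\<Sum>i\<in>I. ell2_inner (\<lambda>k. c i * (u i k - ell2_proj S (u i) k)) v)"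
    by (intro L2_inner_sum_left L2_space_cmult L2_space_diff u vL closed_subspaceD(1)[OF S] ell2_proj_mem[OF S])
  also have "\<dots> = 0"
    unfolding L2_inner_cmult_left by (intro sum.neutral ballI) (simp add: ell2_proj_orthogonal[OF S u v])
  finally show "ell2_inner (\<lambda>k. (\<Sum>i\<in>I. c i * u i k) - (\<Sum>i\<in>I. c i * ell2_proj S (u i) k)) v = 0" .
qed

lemma energy_ell2_proj_le:
  assumes S: "closed_subspace (count_space UNIV) S" and u: "u \<in> ell2"
  shows "energy (count_space UNIV) (ell2_proj S u) \<le> energy (count_space UNIV) u"
proof -
  let ?p = "ell2_proj S u"
  have p: "?p \<in> S" by (rule ell2_proj_mem[OF S u])
  have pL: "?p \<in> ell2" by (rule closed_subspaceD(1)[OF S p])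
  have dL: "(\<lambda>k. u k - ?p k) \<in> ell2" by (rule L2_space_diff[OF u pL])
  have i: "integrable (count_space UNIV) (\<lambda>k. (cmod (u k - ?p k))\<^sup>2)" "integrable (count_space UNIV) (\<lambda>k. (cmod (?p k))\<^sup>2)"
    using pL dL by (simp_all add: L2_space_def)
  have ri: "integrable (count_space UNIV) (\<lambda>k. (u k - ?p k) * cnj (?p k))" by (rule L2_inner_integrable[OF dL pL])
  have "(cmod (u k))\<^sup>2 = (cmod (u k - ?p k))\<^sup>2 + (cmod (?p k))\<^sup>2 + 2 * Re ((u k - ?p k) * cnj (?p k))" for k
    unfolding cmod_power2 by (simp add: power2_eq_square algebra_simps)
  then have "(L2_norm (count_space UNIV) u)\<^sup>2 = (\<integral>k. (cmod (u k - ?p k))\<^sup>2 + (cmod (?p k))\<^sup>2 + 2 * Re ((u k - ?p k) * cnj (?p k)) \<partial>count_space UNIV)"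
    unfolding L2_norm_power2 by (simp only:)
  also have "\<dots> = (\<integral>k. (cmod (u k - ?p k))\<^sup>2 \<partial>count_space UNIV) + (\<integral>k. (cmod (?p k))\<^sup>2 \<partial>count_space UNIV) + (\<integral>k. 2 * Re ((u k - ?p k) * cnj (?p k)) \<partial>count_space UNIV)"
    by (simp only: Bochner_Integration.integral_add[OF Bochner_Integration.integrable_add[OF i] integrable_mult_right[OF integrable_Re[OF ri]]]
       Bochner_Integration.integral_add[OF i])
  also have "(\<integral>k. 2 * Re ((u k - ?p k) * cnj (?p k)) \<partial>count_space UNIV) = 2 * Re (ell2_inner (\<lambda>k. u k - ?p k) ?p)"
    unfolding L2_inner_def by (simp only: integral_mult_right_zero integral_Re[OF ri])
  also have "\<dots> = 0" unfolding ell2_proj_orthogonal[OF S u p] by simp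
  finally have "(L2_norm (count_space UNIV) u)\<^sup>2 = (L2_norm (count_space UNIV) (\<lambda>k. u k - ?p k))\<^sup>2 + (L2_norm (count_space UNIV) ?p)\<^sup>2"
    unfolding L2_norm_power2 by simp
  then have "(L2_norm (count_space UNIV) ?p)\<^sup>2 \<le> (L2_norm (count_space UNIV) u)\<^sup>2" by simp
  then show ?thesis
    unfolding L2_norm_energy(1)[OF u, symmetric] L2_norm_energy(1)[OF pL, symmetric] by (rule ennreal_leI)
qed

definition unit_vec :: "'k \<Rightarrow> 'k \<Rightarrow> complex" where
  "unit_vec n = (\<lambda>k. if k = n then 1 else 0)"

lemma energy_unit_vec: "energy (count_space UNIV) (unit_vec n) = 1"
proof -
  have "energy (count_space UNIV) (unit_vec n) = (\<integral>\<^sup>+k. 1 * indicator {n} k \<partial>count_space UNIV)"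
    unfolding energy_def unit_vec_def by (intro nn_integral_cong) (simp add: indicator_def)
  then show ?thesis by (subst (asm) nn_integral_cmult_indicator) simp_all
qed

lemma unit_vec_ell2: "unit_vec n \<in> ell2"
  by (simp add: ell2_iff_energy energy_unit_vec)

lemma ell2_inner_unit_vec: "ell2_inner f (unit_vec n) = f n"
proof -
  have "ell2_inner f (unit_vec n) = (\<integral>k. f n * complex_of_real (indicat_real {n} k) \<partial>count_space UNIV)"
    unfolding L2_inner_def by (intro Bochner_Integration.integral_cong refl) (simp add: unit_vec_def)
  also have "\<dots> = f n" by simp
  finally show ?thesis .
qed

text \<open>
  The projection of \<open>v = \<Sum>\<^sub>i v\<^sub>i e\<^sub>i\<close> is \<open>v\<close> itself, so the projections of the unit vectors
  span a dense subspace of \<open>S\<close>, with explicit coefficients.  In the proof the remainder of the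
  expansion enters the finite sum as an additional term, indexed by \<open>None\<close>.
\<close>

lemma ell2_proj_partial_sums:
  fixes v :: "'k::countable \<Rightarrow> complex"
  assumes S: "closed_subspace (count_space UNIV) S" and v: "v \<in> S"
  shows "L2_tendsto (count_space UNIV) (\<lambda>n k. \<Sum>i\<in>enum_below n. v i * ell2_proj S (unit_vec i) k) v"
proof -
  have vL: "v \<in> ell2" by (rule closed_subspaceD(1)[OF S v])
  let ?s = "\<lambda>n k. \<Sum>i\<in>enum_below n. v i * ell2_proj S (unit_vec i) k"
  have sS: "?s n \<in> S" for n
    by (intro closed_subspace_sum[OF S] closed_subspaceD(4)[OF S] ell2_proj_mem[OF S] unit_vec_ell2)
  have "energy (count_space UNIV) (\<lambda>k. ?s n k - v k) \<le> energy (count_space UNIV) (\<lambda>k. v k * indicator (- enum_below n) k)" for n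
  proof -
    let ?r = "\<lambda>k. v k * indicator (- enum_below n) k"
    have rL: "?r \<in> ell2"
    proof -
      have "energy (count_space UNIV) ?r \<le> energy (count_space UNIV) v"
        unfolding energy_def by (intro nn_integral_mono) (auto simp: indicator_def)
      then show ?thesis using vL by (auto simp: ell2_iff_energy intro: le_less_trans)
    qed
    let ?u = "\<lambda>i. if i = None then ?r else unit_vec (the i)"
    let ?c = "\<lambda>i. if i = None then 1 else v (the i)"
    let ?I = "insert None (Some ` enum_below n)"
    have fin: "finite (Some ` enum_below n :: 'k option set)" by (simp add: finite_enum_below)
    have split: "(\<Sum>i\<in>?I. ?c i * g i) = g None + (\<Sum>i\<in>enum_below n. v i * g (Some i))" for g :: "'k option \<Rightarrow> complex"
      using fin by (subst sum.insert) (auto simp: sum.reindex)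
    have "(\<Sum>i\<in>enum_below n. v i * unit_vec i k) = (if k \<in> enum_below n then v k else 0)" for k
    proof -
      have "(\<Sum>i\<in>enum_below n. v i * unit_vec i k) = (\<Sum>i\<in>enum_below n. if k = i then v i else 0)"
        by (intro sum.cong refl) (simp add: unit_vec_def)
      then show ?thesis by (simp add: finite_enum_below)
    qed
    then have vsum: "v = (\<lambda>k. \<Sum>i\<in>?I. ?c i * ?u i k)"
      unfolding split by (auto simp: fun_eq_iff indicator_def)
    have "ell2_proj S (\<lambda>k. \<Sum>i\<in>?I. ?c i * ?u i k) = (\<lambda>k. \<Sum>i\<in>?I. ?c i * ell2_proj S (?u i) k)"
      by (rule ell2_proj_sum[OF S]) (auto simp: unit_vec_ell2 rL)
    with arg_cong[OF vsum, of "ell2_proj S"] have "ell2_proj S v = (\<lambda>k. \<Sum>i\<in>?I. ?c i * ell2_proj S (?u i) k)"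
      by (rule trans)
    then have eq: "v = (\<lambda>k. \<Sum>i\<in>?I. ?c i * ell2_proj S (?u i) k)"
      unfolding ell2_proj_id[OF S v] .
    have "v k = ell2_proj S ?r k + ?s n k" for k
    proof -
      have "v k = (\<Sum>i\<in>?I. ?c i * ell2_proj S (?u i) k)" by (rule fun_cong[OF eq])
      also have "\<dots> = ell2_proj S ?r k + ?s n k" unfolding split by simp
      finally show ?thesis .
    qed
    then have "v k - ?s n k = ell2_proj S ?r k" for k by (rule diff_eq_eq[THEN iffD2])
    then have "energy (count_space UNIV) (\<lambda>k. v k - ?s n k) = energy (count_space UNIV) (ell2_proj S ?r)"
      by (simp only:)
    also have "\<dots> \<le> energy (count_space UNIV) ?r" by (rule energy_ell2_proj_le[OF S rL])
    finally show ?thesis unfolding energy_minus_commute[of _ "?s n"] .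
  qed
  then have "(\<lambda>n. energy (count_space UNIV) (\<lambda>k. ?s n k - v k)) \<longlonglongrightarrow> 0"
    by (intro tendsto_0_le_ennreal[OF ell2_tail[OF vL]] always_eventually allI)
  then show ?thesis
    unfolding L2_tendsto_iff_energy using closed_subspaceD(1)[OF S sS] vL by blast
qed

section \<open>Eigenvectors of bounded operators on sequence spaces\<close>

lemma
  assumes "bounded_operator_on (count_space UNIV) S A"
  shows bounded_operator_mem: "f \<in> S \<Longrightarrow> A f \<in> S"
    and bounded_operator_add: "f \<in> S \<Longrightarrow> g \<in> S \<Longrightarrow> A (\<lambda>x. f x + g x) = (\<lambda>x. A f x + A g x)"
    and bounded_operator_cmult: "f \<in> S \<Longrightarrow> A (\<lambda>x. c * f x) = (\<lambda>x. c * A f x)"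
  using assms unfolding bounded_operator_on_def AE_count_space_UNIV fun_eq_iff by blast+

lemma bounded_operator_zero:
  assumes "closed_subspace (count_space UNIV) S" "bounded_operator_on (count_space UNIV) S A"
  shows "A (\<lambda>_. 0) = (\<lambda>_. 0)"
  using bounded_operator_cmult[OF assms(2) closed_subspaceD(2)[OF assms(1)], of 0] by simp

lemma bounded_operator_sum:
  assumes S: "closed_subspace (count_space UNIV) S" and A: "bounded_operator_on (count_space UNIV) S A"
    and f: "\<And>i. i \<in> I \<Longrightarrow> f i \<in> S"
  shows "A (\<lambda>x. \<Sum>i\<in>I. f i x) = (\<lambda>x. \<Sum>i\<in>I. A (f i) x)"
  using f
proof (induction I rule: infinite_finite_induct)
  case (insert i I)
  have "A (\<lambda>x. f i x + (\<Sum>j\<in>I. f j x)) = (\<lambda>x. A (f i) x + A (\<lambda>x. \<Sum>j\<in>I. f j x) x)"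
    by (rule bounded_operator_add[OF A]) (use insert.prems in \<open>auto intro!: closed_subspace_sum[OF S]\<close>)
  then show ?case using insert by simp
qed (simp_all add: bounded_operator_zero[OF S A])

lemma bounded_operator_tendsto:
  assumes S: "closed_subspace (count_space UNIV) S" and A: "bounded_operator_on (count_space UNIV) S A"
    and s: "\<And>n. s n \<in> S" and f: "f \<in> S" and lim: "L2_tendsto (count_space UNIV) s f"
  shows "L2_tendsto (count_space UNIV) (\<lambda>n. A (s n)) (A f)"
  unfolding L2_tendsto_def
proof (intro conjI allI)
  show "A (s n) \<in> ell2" for n by (rule closed_subspaceD(1)[OF S bounded_operator_mem[OF A s]])
  show "A f \<in> ell2" by (rule closed_subspaceD(1)[OF S bounded_operator_mem[OF A f]])
  obtain C where C: "\<And>g. g \<in> S \<Longrightarrow> L2_norm (count_space UNIV) (A g) \<le> C * L2_norm (count_space UNIV) g"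
    using A unfolding bounded_operator_on_def by blast
  have l: "(\<lambda>n. L2_norm (count_space UNIV) (\<lambda>x. s n x - f x)) \<longlonglongrightarrow> 0" using lim unfolding L2_tendsto_def by blast
  show "(\<lambda>n. L2_norm (count_space UNIV) (\<lambda>x. A (s n) x - A f x)) \<longlonglongrightarrow> 0"
  proof (rule tendsto_sandwich[OF _ _ tendsto_const])
    show "(\<lambda>n. C * L2_norm (count_space UNIV) (\<lambda>x. s n x - f x)) \<longlonglongrightarrow> 0"
      using tendsto_mult[OF tendsto_const l, of C] by simp
    have "L2_norm (count_space UNIV) (\<lambda>x. A (s n) x - A f x) \<le> C * L2_norm (count_space UNIV) (\<lambda>x. s n x - f x)" for n
    proof -
      have mf: "(\<lambda>x. (-1) * f x) \<in> S" by (rule closed_subspaceD(4)[OF S f])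
      have "A (\<lambda>x. s n x + (-1) * f x) = (\<lambda>x. A (s n) x + (-1) * A f x)"
        unfolding bounded_operator_add[OF A s mf] bounded_operator_cmult[OF A f] ..
      then have "A (\<lambda>x. s n x - f x) = (\<lambda>x. A (s n) x - A f x)" by simp
      then show ?thesis using C[OF closed_subspace_diff[OF S s[of n] f]] by simp
    qed
    then show "\<forall>\<^sub>F n in sequentially. L2_norm (count_space UNIV) (\<lambda>x. A (s n) x - A f x) \<le> C * L2_norm (count_space UNIV) (\<lambda>x. s n x - f x)"
      by simp
  qed (simp add: L2_norm_nonneg)
qed

text \<open>
  The product of the operators \<open>A - l\<close> over the entries \<open>l\<close> of a list.  It is a bounded operator that
  kills the eigenvectors with eigenvalue in the list and scales those with another eigenvalue by a
  nonzero factor.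
\<close>

fun annihilator :: "(('k \<Rightarrow> complex) \<Rightarrow> 'k \<Rightarrow> complex) \<Rightarrow> complex list \<Rightarrow> ('k \<Rightarrow> complex) \<Rightarrow> 'k \<Rightarrow> complex" where
  "annihilator A [] v = v"
| "annihilator A (l # ls) v = (\<lambda>k. A (annihilator A ls v) k - l * annihilator A ls v k)"

lemma annihilator_mem:
  assumes S: "closed_subspace (count_space UNIV) S" and A: "bounded_operator_on (count_space UNIV) S A" and v: "v \<in> S"
  shows "annihilator A ls v \<in> S"
proof (induction ls)
  case (Cons l ls)
  then show ?case
    unfolding annihilator.simps
    by (intro closed_subspace_diff[OF S] bounded_operator_mem[OF A] closed_subspaceD(4)[OF S])
qed (simp add: v)

lemma annihilator_sum:
  assumes S: "closed_subspace (count_space UNIV) S" and A: "bounded_operator_on (count_space UNIV) S A"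
    and f: "\<And>i. i \<in> I \<Longrightarrow> f i \<in> S"
  shows "annihilator A ls (\<lambda>x. \<Sum>i\<in>I. f i x) = (\<lambda>x. \<Sum>i\<in>I. annihilator A ls (f i) x)"
proof (induction ls)
  case (Cons l ls)
  then show ?case
    by (simp add: bounded_operator_sum[OF S A annihilator_mem[OF S A f]] sum_distrib_left sum_subtractf)
qed simp

lemma annihilator_cmult:
  assumes S: "closed_subspace (count_space UNIV) S" and A: "bounded_operator_on (count_space UNIV) S A" and v: "v \<in> S"
  shows "annihilator A ls (\<lambda>x. c * v x) = (\<lambda>x. c * annihilator A ls v x)"
proof (induction ls)
  case (Cons l ls)
  then show ?case
    by (simp add: bounded_operator_cmult[OF A annihilator_mem[OF S A v]] right_diff_distrib mult.left_commute)
qed simp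

lemma annihilator_tendsto:
  assumes S: "closed_subspace (count_space UNIV) S" and A: "bounded_operator_on (count_space UNIV) S A"
    and s: "\<And>n. s n \<in> S" and f: "f \<in> S" and lim: "L2_tendsto (count_space UNIV) s f"
  shows "L2_tendsto (count_space UNIV) (\<lambda>n. annihilator A ls (s n)) (annihilator A ls f)"
proof (induction ls)
  case (Cons l ls)
  have "L2_tendsto (count_space UNIV) (\<lambda>n. A (annihilator A ls (s n))) (A (annihilator A ls f))"
    by (rule bounded_operator_tendsto[OF S A annihilator_mem[OF S A s] annihilator_mem[OF S A f] Cons.IH])
  from L2_tendsto_add[OF this L2_tendsto_cmult[OF Cons.IH, of "- l"]]
  show ?case by simp
qed (simp add: lim)

lemma annihilator_eigenvector:
  assumes A: "bounded_operator_on (count_space UNIV) S A" and v: "v \<in> S" and eig: "A v = (\<lambda>k. \<mu> * v k)"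
  shows "annihilator A ls v = (\<lambda>k. (\<Prod>l\<leftarrow>ls. \<mu> - l) * v k)"
proof (induction ls)
  case (Cons l ls)
  then show ?case
    by (simp add: bounded_operator_cmult[OF A v] eig) (simp add: fun_eq_iff algebra_simps)
qed simp

text \<open>
  The projected unit vectors are sums of eigenvectors \<open>w n j\<close>.  If \<open>\<mu>\<close> differs from the eigenvalues of
  all nonzero \<open>w n j\<close>, then the product of \<open>A - \<lambda>\<^sub>j\<close> over \<open>\<lambda>\<^sub>j \<noteq> \<mu>\<close> vanishes on the projected unit
  vectors, hence on \<open>S\<close> by density and continuity; but it is nonzero on an eigenvector for
  \<open>\<mu>\<close>.  In particular all eigenvalues are visible from countably many vectors, which makes them
  measurable when \<open>S\<close> and \<open>A\<close> vary.
\<close>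

lemma eigenvalues_of_decomposition:
  fixes S :: "('k::countable \<Rightarrow> complex) set" and m :: nat
  assumes S: "closed_subspace (count_space UNIV) S" and A: "bounded_operator_on (count_space UNIV) S A"
    and w: "\<And>n j. j < m \<Longrightarrow> w n j \<in> S" "\<And>n j. j < m \<Longrightarrow> A (w n j) = (\<lambda>k. lam j * w n j k)"
    and sum: "\<And>n. ell2_proj S (unit_vec n) = (\<lambda>k. \<Sum>j<m. w n j k)"
  shows "eigenvalues_on S A = lam ` {j. j < m \<and> (\<exists>n. w n j \<noteq> (\<lambda>_. 0))}"
proof
  show "lam ` {j. j < m \<and> (\<exists>n. w n j \<noteq> (\<lambda>_. 0))} \<subseteq> eigenvalues_on S A"
    unfolding eigenvalues_on_def using w by blast
  show "eigenvalues_on S A \<subseteq> lam ` {j. j < m \<and> (\<exists>n. w n j \<noteq> (\<lambda>_. 0))}"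
  proof (rule ccontr)
    assume "\<not> ?thesis"
    then obtain \<mu> v where v: "v \<in> S" "v \<noteq> (\<lambda>_. 0)" "A v = (\<lambda>k. \<mu> * v k)"
      and \<mu>: "\<mu> \<notin> lam ` {j. j < m \<and> (\<exists>n. w n j \<noteq> (\<lambda>_. 0))}"
      unfolding eigenvalues_on_def by blast
    \<comment> \<open>all possible eigenvalues except \<open>\<mu>\<close>\<close>
    let ?ls = "filter (\<lambda>l. l \<noteq> \<mu>) (map lam [0..<m])"
    have w0: "annihilator A ?ls (w n j) = (\<lambda>_. 0)" if j: "j < m" for n j
    proof (cases "lam j = \<mu>")
      case True
      then have "w n j = (\<lambda>_. 0)" using \<mu> j by blast
      then show ?thesis
        unfolding annihilator_eigenvector[OF A w(1)[OF j] w(2)[OF j]] by simp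
    next
      case False
      then have "lam j \<in> set ?ls" using j by auto
      then have "0 \<in> set (map (\<lambda>l. lam j - l) ?ls)" by force
      then have "(\<Prod>l\<leftarrow>?ls. lam j - l) = 0" by (simp only: prod_list_zero_iff)
      then show ?thesis unfolding annihilator_eigenvector[OF A w(1)[OF j] w(2)[OF j]] by simp
    qed
    have p0: "annihilator A ?ls (ell2_proj S (unit_vec n)) = (\<lambda>_. 0)" for n
      unfolding sum using w0 by (subst annihilator_sum[OF S A]) (auto simp: w)
    let ?s = "\<lambda>n k. \<Sum>i\<in>enum_below n. v i * ell2_proj S (unit_vec i) k"
    have pm: "ell2_proj S (unit_vec i) \<in> S" for i by (rule ell2_proj_mem[OF S unit_vec_ell2])
    have sS: "?s n \<in> S" for n
      by (intro closed_subspace_sum[OF S] closed_subspaceD(4)[OF S] pm)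
    have s0: "annihilator A ?ls (?s n) = (\<lambda>_. 0)" for n
    proof -
      have "annihilator A ?ls (?s n) = (\<lambda>x. \<Sum>i\<in>enum_below n. annihilator A ?ls (\<lambda>k. v i * ell2_proj S (unit_vec i) k) x)"
        by (rule annihilator_sum[OF S A]) (rule closed_subspaceD(4)[OF S pm])
      also have "\<dots> = (\<lambda>_. 0)"
        unfolding annihilator_cmult[OF S A pm] p0 by simp
      finally show ?thesis .
    qed
    have "L2_tendsto (count_space UNIV) (\<lambda>n. annihilator A ?ls (?s n)) (annihilator A ?ls v)"
      by (rule annihilator_tendsto[OF S A sS v(1) ell2_proj_partial_sums[OF S v(1)]])
    then have "L2_tendsto (count_space UNIV) (\<lambda>n. \<lambda>_::'k. 0) (annihilator A ?ls v)" unfolding s0 .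
    moreover have "L2_tendsto (count_space UNIV) (\<lambda>n. \<lambda>_::'k. 0) (\<lambda>_. 0)"
      unfolding L2_tendsto_iff_energy by (simp add: L2_space_zero energy_def)
    ultimately have "AE x in count_space UNIV. annihilator A ?ls v x = 0" by (rule L2_tendsto_unique)
    then have "(\<Prod>l\<leftarrow>?ls. \<mu> - l) * v k = 0" for k
      unfolding annihilator_eigenvector[OF A v(1) v(3)] AE_count_space_UNIV by blast
    moreover have "(\<Prod>l\<leftarrow>?ls. \<mu> - l) \<noteq> 0" by (auto simp: prod_list_zero_iff)
    ultimately have "v = (\<lambda>_. 0)" by (auto simp: fun_eq_iff)
    then show False using v(2) by simp
  qed
qed

lemma eigenvectors_independent:
  fixes m :: nat
  assumes S: "closed_subspace (count_space UNIV) S" and A: "bounded_operator_on (count_space UNIV) S A"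
    and g: "\<And>j. j < m \<Longrightarrow> g j \<in> S" "\<And>j. j < m \<Longrightarrow> A (g j) = (\<lambda>k. lam j * g j k)"
    and inj: "inj_on lam {..<m}" and sum: "(\<lambda>k. \<Sum>j<m. g j k) = (\<lambda>_. 0)" and i: "i < m"
  shows "g i = (\<lambda>_. 0)"
proof -
  let ?ls = "filter (\<lambda>l. l \<noteq> lam i) (map lam [0..<m])"
  have other: "annihilator A ?ls (g j) k = 0" if j: "j < m" "j \<noteq> i" for j k
  proof -
    have "lam j \<noteq> lam i" by (rule inj_on_contraD[OF inj j(2)]) (simp_all add: i j(1))
    then have "lam j \<in> set ?ls" using j(1) by simp
    then have "0 \<in> set (map (\<lambda>l. lam j - l) ?ls)" by force
    then have "(\<Prod>l\<leftarrow>?ls. lam j - l) = 0" by (simp only: prod_list_zero_iff)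
    then show ?thesis unfolding annihilator_eigenvector[OF A g(1)[OF j(1)] g(2)[OF j(1)]] by simp
  qed
  have "annihilator A ?ls (\<lambda>_. 0) = (\<lambda>_. 0)"
    using annihilator_cmult[OF S A closed_subspaceD(2)[OF S], of ?ls 0] by simp
  moreover have "annihilator A ?ls (\<lambda>k. \<Sum>j<m. g j k) = (\<lambda>k. \<Sum>j<m. annihilator A ?ls (g j) k)"
    by (rule annihilator_sum[OF S A]) (rule g(1), simp)
  ultimately have "(\<lambda>k. \<Sum>j<m. annihilator A ?ls (g j) k) = (\<lambda>_. 0)"
    unfolding sum by (simp only:)
  then have "(\<Sum>j<m. annihilator A ?ls (g j) k) = 0" for k by (rule fun_cong)
  moreover have "(\<Sum>j<m. annihilator A ?ls (g j) k) = annihilator A ?ls (g i) k" for k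
  proof -
    have "(\<Sum>j<m. annihilator A ?ls (g j) k) = annihilator A ?ls (g i) k + (\<Sum>j\<in>{..<m} - {i}. annihilator A ?ls (g j) k)"
      by (rule sum.remove) (simp_all add: i)
    also have "(\<Sum>j\<in>{..<m} - {i}. annihilator A ?ls (g j) k) = 0"
      by (rule sum.neutral) (simp add: other)
    finally show ?thesis by simp
  qed
  ultimately have z: "(\<Prod>l\<leftarrow>?ls. lam i - l) * g i k = 0" for k
    unfolding annihilator_eigenvector[OF A g(1)[OF i] g(2)[OF i]] by metis
  have nz: "(\<Prod>l\<leftarrow>?ls. lam i - l) \<noteq> 0" by (auto simp: prod_list_zero_iff)
  show ?thesis
  proof
    fix k show "g i k = 0" using z[of k] nz unfolding mult_eq_0_iff by blast
  qed
qed

section \<open>Eigenspaces and fibers\<close>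

text \<open>
  The situation as seen on the fibers: \<open>L\<close> acts as a field of bounded operators \<open>R \<omega>\<close> on the closed
  subspaces \<open>J \<omega>\<close>.
\<close>

locale fibered_operator =
  fixes V :: "(real ^ 'd \<Rightarrow> complex) set"
    and L :: "(real ^ 'd \<Rightarrow> complex) \<Rightarrow> real ^ 'd \<Rightarrow> complex"
    and J :: "real ^ 'd \<Rightarrow> (int ^ 'd \<Rightarrow> complex) set"
    and R :: "real ^ 'd \<Rightarrow> (int ^ 'd \<Rightarrow> complex) \<Rightarrow> int ^ 'd \<Rightarrow> complex"
  assumes V_closed: "closed_subspace lebesgue V"
    and L_mem: "\<And>f. f \<in> V \<Longrightarrow> L f \<in> V"
    and J: "is_range_function V J"
    and R: "is_range_operator V L J R"
begin

lemma V_L2: "f \<in> V \<Longrightarrow> f \<in> L2_space lebesgue"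
  by (rule closed_subspaceD(1)[OF V_closed])

lemma V_subset: "V \<subseteq> L2_space lebesgue"
  using V_L2 by blast

lemma J_range: "measurable_range_function J"
  using J unfolding is_range_function_def by (rule conjunct1)

lemma J_closed: "\<omega> \<in> unit_cube \<Longrightarrow> closed_subspace (count_space UNIV) (J \<omega>)"
  using J_range unfolding measurable_range_function_def by (elim conjE bspec)

lemma J_measurable:
  "u \<in> ell2 \<Longrightarrow> v \<in> ell2 \<Longrightarrow> (\<lambda>\<omega>. ell2_inner (ell2_proj (J \<omega>) u) v) \<in> borel_measurable cube"
  using J_range[unfolded measurable_range_function_def, THEN conjunct2, rule_format, of u v] .

lemma V_iff: "f \<in> L2_space lebesgue \<Longrightarrow> f \<in> V \<longleftrightarrow> (AE \<omega> in cube. fiberization f \<omega> \<in> J \<omega>)"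
  using J[unfolded is_range_function_def, THEN conjunct2] by (rule bspec)

lemma R_bounded: "\<omega> \<in> unit_cube \<Longrightarrow> bounded_operator_on (count_space UNIV) (J \<omega>) (R \<omega>)"
  using R[unfolded is_range_operator_def, THEN conjunct1] by (rule bspec)

lemma R_eq: "f \<in> V \<Longrightarrow> AE \<omega> in cube. fiberization (L f) \<omega> = R \<omega> (fiberization f \<omega>)"
  using R[unfolded is_range_operator_def, THEN conjunct2, THEN conjunct2] by (rule bspec)

lemma AE_cube: "AE \<omega> in cube. \<omega> \<in> unit_cube"
  using AE_space[of cube] by simp

lemma V_cong_AE:
  assumes "f \<in> V" "g \<in> L2_space lebesgue" "AE x in lebesgue. g x = f x"
  shows "g \<in> V"
proof -
  have "AE \<omega> in cube. fiberization f \<omega> \<in> J \<omega>"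
    using V_iff[OF V_L2[OF assms(1)]] assms(1) by simp
  with fiberization_cong_AE[OF assms(2) V_L2[OF assms(1)] assms(3)]
  have "AE \<omega> in cube. fiberization g \<omega> \<in> J \<omega>" by eventually_elim simp
  then show ?thesis using V_iff[OF assms(2)] by simp
qed

text \<open>
  The zero vector is allowed: a function in an eigenspace may vanish on part of the cube.
\<close>

definition eigen_fiber :: "real^'d \<Rightarrow> complex \<Rightarrow> (int^'d \<Rightarrow> complex) \<Rightarrow> bool" where
  "eigen_fiber \<omega> \<mu> v \<longleftrightarrow> v \<in> J \<omega> \<and> R \<omega> v = (\<lambda>k. \<mu> * v k)"

lemma s_eigenspace_iff:
  assumes b: "bounded_spectrum b"
  shows "f \<in> s_eigenspace V L b \<longleftrightarrow> f \<in> L2_space lebesgue \<and>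
    (AE \<omega> in cube. eigen_fiber \<omega> (fourier_series b \<omega>) (fiberization f \<omega>))"
proof (cases "f \<in> V")
  case True
  then have f: "f \<in> L2_space lebesgue" by (rule V_L2)
  have memb: "AE \<omega> in cube. fiberization f \<omega> \<in> J \<omega>" using V_iff[OF f] True by simp
  have "(AE \<omega> in cube. fiberization (L f) \<omega> = (\<lambda>k. fourier_series b \<omega> * fiberization f \<omega> k)) \<longleftrightarrow>
    (AE \<omega> in cube. eigen_fiber \<omega> (fourier_series b \<omega>) (fiberization f \<omega>))"
  proof
    assume "AE \<omega> in cube. fiberization (L f) \<omega> = (\<lambda>k. fourier_series b \<omega> * fiberization f \<omega> k)"
    with memb R_eq[OF True] show "AE \<omega> in cube. eigen_fiber \<omega> (fourier_series b \<omega>) (fiberization f \<omega>)"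
      by eventually_elim (simp add: eigen_fiber_def)
  next
    assume "AE \<omega> in cube. eigen_fiber \<omega> (fourier_series b \<omega>) (fiberization f \<omega>)"
    with R_eq[OF True] show "AE \<omega> in cube. fiberization (L f) \<omega> = (\<lambda>k. fourier_series b \<omega> * fiberization f \<omega> k)"
      by eventually_elim (simp add: eigen_fiber_def)
  qed
  moreover have "f \<in> s_eigenspace V L b \<longleftrightarrow> f \<in> V \<and>
      (AE \<omega> in cube. fiberization (L f) \<omega> = (\<lambda>k. fourier_series b \<omega> * fiberization f \<omega> k))"
    by (rule s_eigenspace_iff_fiberwise[OF b V_subset L_mem])
  ultimately show ?thesis using True f by (simp only: simp_thms)
next
  case False
  have "\<not> (f \<in> L2_space lebesgue \<and> (AE \<omega> in cube. eigen_fiber \<omega> (fourier_series b \<omega>) (fiberization f \<omega>)))"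
  proof
    assume *: "f \<in> L2_space lebesgue \<and> (AE \<omega> in cube. eigen_fiber \<omega> (fourier_series b \<omega>) (fiberization f \<omega>))"
    then have "AE \<omega> in cube. eigen_fiber \<omega> (fourier_series b \<omega>) (fiberization f \<omega>)" by (rule conjunct2)
    then have "AE \<omega> in cube. fiberization f \<omega> \<in> J \<omega>"
      by eventually_elim (simp add: eigen_fiber_def)
    then show False using V_iff[OF conjunct1[OF *]] False by simp
  qed
  moreover have "f \<notin> s_eigenspace V L b" using False by (simp add: s_eigenspace_def)
  ultimately show ?thesis by simp
qed

lemma s_eigenspace_V: "f \<in> s_eigenspace V L b \<Longrightarrow> f \<in> V"
  by (simp add: s_eigenspace_def)

lemma s_eigenspace_L2: "f \<in> s_eigenspace V L b \<Longrightarrow> f \<in> L2_space lebesgue"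
  by (rule V_L2[OF s_eigenspace_V])

lemma s_eigenspace_fiber:
  assumes "bounded_spectrum b" "f \<in> s_eigenspace V L b"
  shows "AE \<omega> in cube. eigen_fiber \<omega> (fourier_series b \<omega>) (fiberization f \<omega>)"
  using s_eigenspace_iff[OF assms(1), of f] assms(2) by simp

lemma eigen_fiber_zero: "\<omega> \<in> unit_cube \<Longrightarrow> eigen_fiber \<omega> \<mu> (\<lambda>_. 0)"
  using bounded_operator_zero[OF J_closed R_bounded] closed_subspaceD(2)[OF J_closed]
  by (simp add: eigen_fiber_def)

lemma eigen_fiber_sum:
  assumes \<omega>: "\<omega> \<in> unit_cube" and v: "\<And>i. i \<in> I \<Longrightarrow> eigen_fiber \<omega> \<mu> (v i)"
  shows "eigen_fiber \<omega> \<mu> (\<lambda>k. \<Sum>i\<in>I. v i k)"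
proof -
  have mem: "v i \<in> J \<omega>" and eig: "R \<omega> (v i) = (\<lambda>k. \<mu> * v i k)" if "i \<in> I" for i
    using v[OF that] by (simp_all add: eigen_fiber_def)
  have "(\<lambda>k. \<Sum>i\<in>I. v i k) \<in> J \<omega>" by (rule closed_subspace_sum[OF J_closed[OF \<omega>] mem])
  moreover have "R \<omega> (\<lambda>k. \<Sum>i\<in>I. v i k) = (\<lambda>k. \<Sum>i\<in>I. R \<omega> (v i) k)"
    by (rule bounded_operator_sum[OF J_closed[OF \<omega>] R_bounded[OF \<omega>] mem])
  moreover have "(\<Sum>i\<in>I. R \<omega> (v i) k) = \<mu> * (\<Sum>i\<in>I. v i k)" for k
    unfolding sum_distrib_left by (intro sum.cong refl) (simp add: eig)
  ultimately show ?thesis by (simp add: eigen_fiber_def)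
qed

lemma s_eigenspace_sum:
  assumes b: "bounded_spectrum b" and fin: "finite I" and f: "\<And>i. i \<in> I \<Longrightarrow> f i \<in> s_eigenspace V L b"
  shows "(\<lambda>x. \<Sum>i\<in>I. f i x) \<in> s_eigenspace V L b"
  unfolding s_eigenspace_iff[OF b]
proof
  have fL: "f i \<in> L2_space lebesgue" if "i \<in> I" for i by (rule s_eigenspace_L2[OF f[OF that]])
  show "(\<lambda>x. \<Sum>i\<in>I. f i x) \<in> L2_space lebesgue" by (rule L2_space_sum[OF fL])
  have "AE \<omega> in cube. \<forall>i\<in>I. eigen_fiber \<omega> (fourier_series b \<omega>) (fiberization (f i) \<omega>)"
    by (rule AE_finite_allI[OF fin s_eigenspace_fiber[OF b f]])
  moreover have "AE \<omega> in cube. fiberization (\<lambda>x. \<Sum>i\<in>I. f i x) \<omega> = (\<lambda>k. \<Sum>i\<in>I. fiberization (f i) \<omega> k)"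
    by (rule fiberization_sum[OF fL])
  ultimately show "AE \<omega> in cube. eigen_fiber \<omega> (fourier_series b \<omega>) (fiberization (\<lambda>x. \<Sum>i\<in>I. f i x) \<omega>)"
    using AE_cube
  proof eventually_elim
    case (elim \<omega>)
    show ?case unfolding elim(2) by (rule eigen_fiber_sum[OF elim(3)]) (rule bspec[OF elim(1)])
  qed
qed

text \<open>
  Eigenfunctions can be cut along measurable sets of frequencies, and the cut belongs to the
  eigenspace of every sequence with the same symbol on that set.
\<close>

lemma s_eigenspace_restrict:
  assumes a: "bounded_spectrum a" and b: "bounded_spectrum b" and f: "f \<in> s_eigenspace V L a"
    and A: "A \<in> sets cube"
    and eq: "AE \<omega> in cube. \<omega> \<in> A \<longrightarrow> fourier_series a \<omega> = fourier_series b \<omega>"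
  obtains g where "g \<in> s_eigenspace V L b"
    "AE \<omega> in cube. fiberization g \<omega> = (if \<omega> \<in> A then fiberization f \<omega> else (\<lambda>_. 0))"
proof -
  have fL: "f \<in> L2_space lebesgue" by (rule s_eigenspace_L2[OF f])
  have m: "(\<lambda>\<omega>. complex_of_real (indicat_real A \<omega>)) \<in> borel_measurable cube"
    using A by measurable
  obtain g where g: "g \<in> L2_space lebesgue"
    "AE \<omega> in cube. fiberization g \<omega> = (\<lambda>k. complex_of_real (indicat_real A \<omega>) * fiberization f \<omega> k)"
  proof (rule fiberization_multiplier[OF fL m])
    show "AE \<omega> in cube. cmod (complex_of_real (indicat_real A \<omega>)) \<le> 1"
      by (rule AE_I2) (simp add: indicator_def)
  qed
  have g2: "AE \<omega> in cube. fiberization g \<omega> = (if \<omega> \<in> A then fiberization f \<omega> else (\<lambda>_. 0))"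
    using g(2) by eventually_elim (simp add: indicator_def)
  have "AE \<omega> in cube. eigen_fiber \<omega> (fourier_series b \<omega>) (fiberization g \<omega>)"
    using g2 s_eigenspace_fiber[OF a f] eq AE_cube
  proof eventually_elim
    case (elim \<omega>)
    show ?case
    proof (cases "\<omega> \<in> A")
      case True
      then show ?thesis using elim(1-3) by simp
    next
      case False
      then show ?thesis using elim(1) eigen_fiber_zero[OF elim(4)] by simp
    qed
  qed
  then have "g \<in> s_eigenspace V L b" unfolding s_eigenspace_iff[OF b] using g(1) by simp
  then show ?thesis using g2 by (rule that)
qed

text \<open>
  The fields \<open>\<omega> \<mapsto> P\<^sub>J\<^sub>(\<^sub>\<omega>\<^sub>) e\<^sub>n\<close> are measurable and bounded, so they are fibers of functions in
  \<open>V\<close>.  At every frequency they span a dense subspace of \<open>J \<omega>\<close>.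
\<close>

lemma projection_generators:
  obtains F where "\<And>n. F n \<in> V"
    "\<And>n. AE \<omega> in cube. fiberization (F n) \<omega> = ell2_proj (J \<omega>) (unit_vec n)"
proof -
  have "\<exists>f. f \<in> V \<and> (AE \<omega> in cube. fiberization f \<omega> = ell2_proj (J \<omega>) (unit_vec n))" for n
  proof -
    have m: "(\<lambda>\<omega>. ell2_proj (J \<omega>) (unit_vec n) k) \<in> borel_measurable cube" for k
      using J_measurable[OF unit_vec_ell2 unit_vec_ell2, of n k] by (simp only: ell2_inner_unit_vec)
    have "AE \<omega> in cube. energy (count_space UNIV) (ell2_proj (J \<omega>) (unit_vec n)) \<le> ennreal 1"
      using AE_cube
    proof eventually_elim
      case (elim \<omega>)
      show ?case
        using energy_ell2_proj_le[OF J_closed[OF elim] unit_vec_ell2, of n] by (simp add: energy_unit_vec)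
    qed
    from fiberization_surjective[OF m this]
    obtain f where f: "f \<in> L2_space lebesgue" "AE \<omega> in cube. fiberization f \<omega> = ell2_proj (J \<omega>) (unit_vec n)"
      by blast
    have "AE \<omega> in cube. fiberization f \<omega> \<in> J \<omega>"
      using f(2) AE_cube
    proof eventually_elim
      case (elim \<omega>)
      show ?case unfolding elim(1) by (rule ell2_proj_mem[OF J_closed[OF elim(2)] unit_vec_ell2])
    qed
    then have "f \<in> V" by (rule V_iff[OF f(1), THEN iffD2])
    then show ?thesis by (intro exI[of _ f] conjI f(2))
  qed
  then have "\<forall>n. \<exists>f. f \<in> V \<and> (AE \<omega> in cube. fiberization f \<omega> = ell2_proj (J \<omega>) (unit_vec n))"
    by (rule allI)
  from choice[OF this] obtain F where
    F: "\<forall>n. F n \<in> V \<and> (AE \<omega> in cube. fiberization (F n) \<omega> = ell2_proj (J \<omega>) (unit_vec n))" ..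
  show ?thesis
    by (rule that[of F]) (rule F[THEN spec, THEN conjunct1], rule F[THEN spec, THEN conjunct2])
qed

end

section \<open>Counting the eigenvalues of the fibers\<close>

text \<open>
  Measurability of \<open>X\<close> comes for free from completeness of Lebesgue measure.  This covers the
  eigenvalue levels, of which the hypotheses only determine the class up to null sets.
\<close>

lemma emeasure_lebesgue_cong_AE_cube:
  fixes X Y :: "(real^'d) set"
  assumes "X \<subseteq> unit_cube" "Y \<subseteq> unit_cube" and Y: "Y \<in> sets lebesgue"
    and eq: "AE \<omega> in cube. \<omega> \<in> X \<longleftrightarrow> \<omega> \<in> Y"
  shows "emeasure lebesgue X = emeasure lebesgue Y"
proof -
  have AE: "AE \<omega> in lebesgue. \<omega> \<in> X \<longleftrightarrow> \<omega> \<in> Y"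
    using eq unfolding AE_cube_iff
  proof eventually_elim
    case (elim \<omega>)
    then show ?case using assms(1,2) by blast
  qed
  then obtain N where N: "{\<omega> \<in> space lebesgue. \<not> (\<omega> \<in> X \<longleftrightarrow> \<omega> \<in> Y)} \<subseteq> N" "N \<in> null_sets lebesgue"
    unfolding eventually_ae_filter by blast
  have XN: "X \<inter> N \<in> null_sets lebesgue"
    by (rule null_sets_completion_subset[OF Int_lower2 N(2)])
  have "X = (Y - N) \<union> (X \<inter> N)" using N(1) by auto
  moreover have "(Y - N) \<union> (X \<inter> N) \<in> sets lebesgue"
    by (intro sets.Un sets.Diff Y null_setsD2[OF N(2)] null_setsD2[OF XN])
  ultimately have "X \<in> sets lebesgue" by (rule ssubst)
  then show ?thesis by (intro emeasure_eq_AE AE Y)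
qed

text \<open>
  An \<open>s\<close>-diagonalization in terms of fibers: every function in \<open>V\<close> is a sum of \<open>m\<close>
  eigenfunctions, and \<open>W n j\<close> are the components of the functions with fibers
  \<open>P\<^sub>J\<^sub>(\<^sub>\<omega>\<^sub>) e\<^sub>n\<close>.
\<close>

locale eigen_system = fibered_operator V L J R
  for V :: "(real ^ 'd \<Rightarrow> complex) set" and L J R +
  fixes m :: nat and a :: "nat \<Rightarrow> int^'d \<Rightarrow> complex" and W :: "int^'d \<Rightarrow> nat \<Rightarrow> real^'d \<Rightarrow> complex"
  assumes a: "\<And>j. j < m \<Longrightarrow> bounded_spectrum (a j)"
    and W: "\<And>n j. j < m \<Longrightarrow> W n j \<in> s_eigenspace V L (a j)"
    and W_sum: "\<And>n. AE \<omega> in cube. ell2_proj (J \<omega>) (unit_vec n) = (\<lambda>k. \<Sum>j<m. fiberization (W n j) \<omega> k)"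
    and decompose: "\<And>f. f \<in> V \<Longrightarrow> \<exists>g. (\<forall>j<m. g j \<in> s_eigenspace V L (a j)) \<and>
      (AE \<omega> in cube. fiberization f \<omega> = (\<lambda>k. \<Sum>j<m. fiberization (g j) \<omega> k))"
begin

abbreviation lam :: "nat \<Rightarrow> real^'d \<Rightarrow> complex" where
  "lam j \<equiv> fourier_series (a j)"

text \<open>
  The indices whose symbol is an eigenvalue of \<open>R \<omega>\<close> with an eigenvector among the components.
\<close>

definition active :: "real^'d \<Rightarrow> nat set" where
  "active \<omega> = {j. j < m \<and> (\<exists>n. fiberization (W n j) \<omega> \<noteq> (\<lambda>_. 0))}"

text \<open>
  Different active indices may have the same symbol at \<open>\<omega>\<close>; the first of each group represents
  the eigenvalue.
\<close>

definition leading :: "real^'d \<Rightarrow> nat set" where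
  "leading \<omega> = {j \<in> active \<omega>. \<forall>i\<in>active \<omega>. i < j \<longrightarrow> lam i \<omega> \<noteq> lam j \<omega>}"

lemma leading_subset: "leading \<omega> \<subseteq> {..<m}"
  by (auto simp: leading_def active_def)

lemma finite_leading: "finite (leading \<omega>)"
  by (rule finite_subset[OF leading_subset]) simp

lemma card_leading_le: "card (leading \<omega>) \<le> m"
  using card_mono[OF _ leading_subset[of \<omega>]] by simp

lemma leading_inj: "inj_on (\<lambda>j. lam j \<omega>) (leading \<omega>)"
proof (rule inj_onI)
  fix i j assume ij: "i \<in> leading \<omega>" "j \<in> leading \<omega>" "lam i \<omega> = lam j \<omega>"
  then have ac: "i \<in> active \<omega>" "j \<in> active \<omega>" by (simp_all add: leading_def)
  have "\<not> i < j" using ij ac by (auto simp: leading_def)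
  moreover have "\<not> j < i" using ij ac by (auto simp: leading_def)
  ultimately show "i = j" by simp
qed

lemma leading_image: "(\<lambda>j. lam j \<omega>) ` leading \<omega> = (\<lambda>j. lam j \<omega>) ` active \<omega>"
proof
  show "(\<lambda>j. lam j \<omega>) ` leading \<omega> \<subseteq> (\<lambda>j. lam j \<omega>) ` active \<omega>" by (auto simp: leading_def)
  show "(\<lambda>j. lam j \<omega>) ` active \<omega> \<subseteq> (\<lambda>j. lam j \<omega>) ` leading \<omega>"
  proof
    fix z assume "z \<in> (\<lambda>j. lam j \<omega>) ` active \<omega>"
    then have ex: "\<exists>j. j \<in> active \<omega> \<and> lam j \<omega> = z" by blast
    \<comment> \<open>the first active index with symbol \<open>z\<close> is leading\<close>
    define j where "j = (LEAST j. j \<in> active \<omega> \<and> lam j \<omega> = z)"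
    have j: "j \<in> active \<omega> \<and> lam j \<omega> = z" unfolding j_def by (rule LeastI_ex[OF ex])
    have "lam i \<omega> \<noteq> lam j \<omega>" if "i \<in> active \<omega>" "i < j" for i
      using not_less_Least[OF that(2)[unfolded j_def]] that(1) j by simp
    then have "j \<in> leading \<omega>" using j by (simp add: leading_def)
    then show "z \<in> (\<lambda>j. lam j \<omega>) ` leading \<omega>" using j by (intro image_eqI[of _ _ j]) simp_all
  qed
qed

lemma W_fiber: "AE \<omega> in cube. \<forall>n. \<forall>j\<in>{..<m}. eigen_fiber \<omega> (lam j \<omega>) (fiberization (W n j) \<omega>)"
  unfolding AE_all_countable
proof (intro allI AE_finite_allI)
  show "AE \<omega> in cube. eigen_fiber \<omega> (lam j \<omega>) (fiberization (W n j) \<omega>)" if "j \<in> {..<m}" for n j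
    using that by (intro s_eigenspace_fiber a W) simp_all
qed simp

text \<open>
  So the number of eigenvalues is at most \<open>m\<close>, and it is a measurable function of \<open>\<omega>\<close>.
\<close>

lemma eigenvalues_eq: "AE \<omega> in cube. eigenvalues_on (J \<omega>) (R \<omega>) = (\<lambda>j. lam j \<omega>) ` leading \<omega>"
proof -
  have "AE \<omega> in cube. \<forall>n. ell2_proj (J \<omega>) (unit_vec n) = (\<lambda>k. \<Sum>j<m. fiberization (W n j) \<omega> k)"
    unfolding AE_all_countable by (intro allI W_sum)
  with W_fiber AE_cube show ?thesis
  proof eventually_elim
    case (elim \<omega>)
    have w: "fiberization (W n j) \<omega> \<in> J \<omega>" "R \<omega> (fiberization (W n j) \<omega>) = (\<lambda>k. lam j \<omega> * fiberization (W n j) \<omega> k)"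
      if "j < m" for n j
      using elim(1) that by (auto simp: eigen_fiber_def)
    have "eigenvalues_on (J \<omega>) (R \<omega>) = (\<lambda>j. lam j \<omega>) ` {j. j < m \<and> (\<exists>n. fiberization (W n j) \<omega> \<noteq> (\<lambda>_. 0))}"
      by (rule eigenvalues_of_decomposition[OF J_closed[OF elim(2)] R_bounded[OF elim(2)] w elim(3)[rule_format]])
    then show ?case unfolding leading_image active_def .
  qed
qed

lemma card_eigenvalues:
  "AE \<omega> in cube. finite (eigenvalues_on (J \<omega>) (R \<omega>)) \<and> card (eigenvalues_on (J \<omega>) (R \<omega>)) = card (leading \<omega>)"
  using eigenvalues_eq
proof eventually_elim
  case (elim \<omega>)
  show ?case unfolding elim by (simp add: finite_leading card_image[OF leading_inj])
qed

lemma lam_measurable [measurable]: "j < m \<Longrightarrow> lam j \<in> borel_measurable cube"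
  by (rule bounded_spectrum_measurable[OF a])

lemma pred_active: "Measurable.pred cube (\<lambda>\<omega>. j \<in> active \<omega>)"
proof (cases "j < m")
  case True
  have [measurable]: "(\<lambda>\<omega>. fiberization (W n j) \<omega> k) \<in> borel_measurable cube" for n k
    by (rule fiberization_measurable[OF s_eigenspace_L2[OF W[OF True]]])
  have "Measurable.pred cube (\<lambda>\<omega>. \<exists>n k. fiberization (W n j) \<omega> k \<noteq> 0)" by measurable
  moreover have "j \<in> active \<omega> \<longleftrightarrow> (\<exists>n k. fiberization (W n j) \<omega> k \<noteq> 0)" for \<omega>
    using True by (simp add: active_def fun_eq_iff)
  ultimately show ?thesis by simp
next
  case False
  then show ?thesis by (simp add: active_def)
qed

lemma pred_lam_eq:
  assumes "f \<in> borel_measurable cube" "g \<in> borel_measurable cube"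
  shows "Measurable.pred cube (\<lambda>\<omega>. f \<omega> = (g \<omega> :: complex))"
proof -
  note [measurable] = assms
  have "Measurable.pred cube (\<lambda>\<omega>. f \<omega> - g \<omega> = 0)" by measurable
  then show ?thesis by simp
qed

lemma pred_leading: "Measurable.pred cube (\<lambda>\<omega>. j \<in> leading \<omega>)"
proof (cases "j < m")
  case True
  note [measurable] = pred_active
  have [measurable]: "Measurable.pred cube (\<lambda>\<omega>. lam i \<omega> = lam j \<omega>)" if "i < j" for i
    using that True by (intro pred_lam_eq lam_measurable) simp_all
  have "Measurable.pred cube (\<lambda>\<omega>. j \<in> active \<omega> \<and> (\<forall>i\<in>{..<j}. i \<in> active \<omega> \<longrightarrow> \<not> lam i \<omega> = lam j \<omega>))"
    by measurable
  moreover have "j \<in> leading \<omega> \<longleftrightarrow> j \<in> active \<omega> \<and> (\<forall>i\<in>{..<j}. i \<in> active \<omega> \<longrightarrow> \<not> lam i \<omega> = lam j \<omega>)" for \<omega>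
    by (auto simp: leading_def)
  ultimately show ?thesis by simp
next
  case False
  then show ?thesis by (simp add: leading_def active_def)
qed

lemma leading_measurable: "leading \<in> measurable cube (count_space (Pow {..<m}))"
proof -
  have c: "countable (Pow {..<m})" by (intro countable_finite) simp
  show ?thesis
    unfolding measurable_count_space_eq_countable[OF c]
  proof (intro conjI ballI)
  show "leading \<in> space cube \<rightarrow> Pow {..<m}" using leading_subset by auto
  fix N assume N: "N \<in> Pow {..<m}"
  note [measurable] = pred_leading
  have "leading \<omega> = N \<longleftrightarrow> (\<forall>j\<in>{..<m}. j \<in> leading \<omega> \<longleftrightarrow> j \<in> N)" for \<omega>
  proof
    assume all: "\<forall>j\<in>{..<m}. j \<in> leading \<omega> \<longleftrightarrow> j \<in> N"
    show "leading \<omega> = N"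
    proof (rule set_eqI)
      fix j show "j \<in> leading \<omega> \<longleftrightarrow> j \<in> N"
        using all N leading_subset[of \<omega>] by (cases "j \<in> {..<m}") blast+
    qed
  qed simp
  then have "leading -` {N} \<inter> space cube = {\<omega> \<in> space cube. \<forall>j\<in>{..<m}. j \<in> leading \<omega> \<longleftrightarrow> j \<in> N}"
    by (simp only: vimage_def Int_def) (simp add: conj_commute)
  also have "\<dots> \<in> sets cube" by measurable
  finally show "leading -` {N} \<inter> space cube \<in> sets cube" .
qed
qed

text \<open>
  Functions defined by cases on the finite set \<open>leading \<omega>\<close> are measurable because that set takes
  finitely many values, each on a measurable set.
\<close>

lemma measurable_leading_cases:
  assumes "\<And>N. N \<subseteq> {..<m} \<Longrightarrow> f N \<in> borel_measurable cube"
  shows "(\<lambda>\<omega>. f (leading \<omega>) \<omega> :: complex) \<in> borel_measurable cube"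
proof (rule measurable_compose_countable'[OF _ leading_measurable])
  show "f N \<in> borel_measurable cube" if "N \<in> Pow {..<m}" for N using assms that by simp
  show "countable (Pow {..<m})" by (intro countable_finite) simp
qed

lemma card_leading_set: "{\<omega> \<in> unit_cube. card (leading \<omega>) = i} \<in> sets cube"
proof -
  have "(\<lambda>\<omega>. if card (leading \<omega>) = i then 0 else 1 :: complex) \<in> borel_measurable cube"
    by (rule measurable_leading_cases) simp
  then have "{\<omega> \<in> space cube. (if card (leading \<omega>) = i then 0 else 1 :: complex) = 0} \<in> sets cube"
    by measurable
  also have "{\<omega> \<in> space cube. (if card (leading \<omega>) = i then 0 else 1 :: complex) = 0} = {\<omega> \<in> unit_cube. card (leading \<omega>) = i}"
    by auto
  finally show ?thesis .
qed

text \<open>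
  Up to a null set, the level consists of the frequencies with \<open>i\<close> leading indices.  For \<open>i \<ge> 1\<close> such
  a frequency lies in the spectrum, as \<open>J \<omega>\<close> contains an eigenvector.
\<close>

lemma level_positive_iff:
  assumes "1 \<le> i"
  shows "emeasure lebesgue (eigenvalue_level J R i) > 0 \<longleftrightarrow> \<not> (AE \<omega> in cube. card (leading \<omega>) \<noteq> i)"
proof -
  let ?Y = "{\<omega> \<in> unit_cube. card (leading \<omega>) = i}"
  have Y: "?Y \<in> sets lebesgue"
    using card_leading_set[of i] sets_restrict_space_iff[of unit_cube lebesgue ?Y] by simp
  have "emeasure lebesgue (eigenvalue_level J R i) = emeasure lebesgue ?Y"
  proof (rule emeasure_lebesgue_cong_AE_cube[OF _ _ Y])
    show "eigenvalue_level J R i \<subseteq> unit_cube" by (auto simp: eigenvalue_level_def spectrum_def)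
    show "AE \<omega> in cube. \<omega> \<in> eigenvalue_level J R i \<longleftrightarrow> \<omega> \<in> ?Y"
      using card_eigenvalues AE_cube
    proof eventually_elim
      case (elim \<omega>)
      have "J \<omega> \<noteq> {\<lambda>_. 0}" if "card (leading \<omega>) = i"
      proof
        assume J0: "J \<omega> = {\<lambda>_. 0}"
        have "eigenvalues_on (J \<omega>) (R \<omega>) = {}" unfolding J0 eigenvalues_on_def by simp
        then show False using elim(1) that assms by simp
      qed
      then show ?case using elim by (auto simp: eigenvalue_level_def spectrum_def)
    qed
  qed auto
  also have "emeasure lebesgue ?Y > 0 \<longleftrightarrow> \<not> (AE \<omega> in cube. card (leading \<omega>) \<noteq> i)"
  proof -
    have "(AE \<omega> in cube. card (leading \<omega>) \<noteq> i) \<longleftrightarrow> (AE \<omega> in lebesgue. \<omega> \<notin> ?Y)"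
      unfolding AE_cube_iff by (rule AE_cong) auto
    also have "\<dots> \<longleftrightarrow> ?Y \<in> null_sets lebesgue"
      using AE_iff_null_sets[OF Y] by simp
    also have "\<dots> \<longleftrightarrow> emeasure lebesgue ?Y = 0" using Y by (auto simp: null_sets_def)
    finally show ?thesis by (simp add: zero_less_iff_neq_zero)
  qed
  finally show ?thesis .
qed

lemma essential_levels_subset: "essential_levels J R \<subseteq> {1..m}"
proof
  fix i assume "i \<in> essential_levels J R"
  then have i: "1 \<le> i" "\<not> (AE \<omega> in cube. card (leading \<omega>) \<noteq> i)"
    using level_positive_iff[of i] by (auto simp: essential_levels_def)
  have "i \<le> m"
  proof (rule ccontr)
    assume "\<not> i \<le> m"
    then have "card (leading \<omega>) \<noteq> i" for \<omega> using card_leading_le[of \<omega>] by simp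
    then show False using i(2) by simp
  qed
  then show "i \<in> {1..m}" using i by simp
qed

lemma card_leading_essential: "AE \<omega> in cube. card (leading \<omega>) = 0 \<or> card (leading \<omega>) \<in> essential_levels J R"
proof -
  have "AE \<omega> in cube. \<forall>i\<in>{1..m} - essential_levels J R. card (leading \<omega>) \<noteq> i"
  proof (rule AE_finite_allI)
    fix i assume i: "i \<in> {1..m} - essential_levels J R"
    then show "AE \<omega> in cube. card (leading \<omega>) \<noteq> i"
      using level_positive_iff[of i] by (auto simp: essential_levels_def)
  qed simp
  then show ?thesis
  proof eventually_elim
    case (elim \<omega>)
    then show ?case using card_leading_le[of \<omega>] by fastforce
  qed
qed

text \<open>
  If almost no fiber had an eigenvalue, an eigenfunction of \<open>L\<close> would have zero fibers.
\<close>

lemma essential_levels_nonempty: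
  assumes j: "j < m" and ev: "is_s_eigenvalue V L (a j)"
  shows "essential_levels J R \<noteq> {}"
proof
  assume empty: "essential_levels J R = {}"
  obtain f where f: "f \<in> s_eigenspace V L (a j)" "\<not> (AE x in lebesgue. f x = 0)"
    using ev by (auto simp: is_s_eigenvalue_def)
  have "AE \<omega> in cube. fiberization f \<omega> = fiberization (\<lambda>_. 0) \<omega>"
    using card_leading_essential eigenvalues_eq s_eigenspace_fiber[OF a[OF j] f(1)] fiberization_zero
  proof eventually_elim
    case (elim \<omega>)
    have "leading \<omega> = {}" using elim(1) empty finite_leading[of \<omega>] by simp
    then have "eigenvalues_on (J \<omega>) (R \<omega>) = {}" using elim(2) by simp
    then have "fiberization f \<omega> = (\<lambda>_. 0)" using elim(3) unfolding eigenvalues_on_def eigen_fiber_def by blast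
    then show ?case using elim(4) by simp
  qed
  then have "AE x in lebesgue. f x = 0"
    by (rule fiberization_injective[OF s_eigenspace_L2[OF f(1)] L2_space_zero])
  then show False using f(2) by simp
qed

section \<open>Listing the eigenvalues\<close>

lemma lam_bounded: "\<exists>C\<ge>0. AE \<omega> in cube. \<forall>j\<in>{..<m}. cmod (lam j \<omega>) \<le> C"
proof -
  have "\<forall>j\<in>{..<m}. \<exists>C. AE \<omega> in cube. cmod (lam j \<omega>) \<le> C"
    using a by (simp add: bounded_spectrum_def)
  from bchoice[OF this] obtain C where C: "\<forall>j\<in>{..<m}. AE \<omega> in cube. cmod (lam j \<omega>) \<le> C j" ..
  let ?C = "\<Sum>j<m. \<bar>C j\<bar>"
  have "AE \<omega> in cube. \<forall>j\<in>{..<m}. cmod (lam j \<omega>) \<le> ?C"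
  proof (rule AE_finite_allI)
    fix j assume j: "j \<in> {..<m}"
    have le: "C j \<le> ?C"
      using member_le_sum[of j "{..<m}" "\<lambda>j. \<bar>C j\<bar>"] j by simp
    have "AE \<omega> in cube. cmod (lam j \<omega>) \<le> C j" by (rule bspec[OF C j])
    then show "AE \<omega> in cube. cmod (lam j \<omega>) \<le> ?C"
      by eventually_elim (use le in linarith)
  qed simp
  moreover have "0 \<le> ?C" by (rule sum_nonneg) simp
  ultimately show ?thesis by blast
qed

text \<open>
  The eigenvalues of \<open>R \<omega>\<close> in the order of their leading indices, continued by distinct numbers
  larger than the bound \<open>C\<close> on all eigenvalues.  Thus all listed numbers are distinct, and the
  padding never meets an eigenvalue.
\<close>

definition listed :: "real \<Rightarrow> nat \<Rightarrow> real^'d \<Rightarrow> complex" where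
  "listed C j \<omega> = (if j < card (leading \<omega>) then lam (sorted_list_of_set (leading \<omega>) ! j) \<omega>
     else complex_of_real (C + 1 + real j))"

lemma sorted_leading_nth:
  assumes "j < card (leading \<omega>)" shows "sorted_list_of_set (leading \<omega>) ! j \<in> leading \<omega>"
proof -
  have "j < length (sorted_list_of_set (leading \<omega>))" using assms by simp
  from nth_mem[OF this] show ?thesis by (simp add: finite_leading)
qed

lemma listed_measurable: "listed C j \<in> borel_measurable cube"
  unfolding listed_def[abs_def]
proof (rule measurable_leading_cases)
  fix N assume N: "N \<subseteq> {..<m}"
  then have fin: "finite N" by (rule finite_subset) simp
  show "(\<lambda>\<omega>. if j < card N then lam (sorted_list_of_set N ! j) \<omega> else complex_of_real (C + 1 + real j)) \<in> borel_measurable cube"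
  proof (cases "j < card N")
    case True
    then have "j < length (sorted_list_of_set N)" by simp
    from nth_mem[OF this] have "sorted_list_of_set N ! j \<in> N" using fin by simp
    then have "sorted_list_of_set N ! j < m" using N by blast
    then show ?thesis using True lam_measurable by simp
  qed simp
qed

lemma listed_bounded:
  assumes C: "0 \<le> C" "\<forall>j\<in>{..<m}. cmod (lam j \<omega>) \<le> C"
  shows "cmod (listed C j \<omega>) \<le> C + 1 + real j"
proof (cases "j < card (leading \<omega>)")
  case True
  then have "sorted_list_of_set (leading \<omega>) ! j < m"
    using sorted_leading_nth[OF True] leading_subset[of \<omega>] by blast
  then have "cmod (listed C j \<omega>) \<le> C" using C(2) True by (simp add: listed_def)
  then show ?thesis by simp
next
  case False
  then have "cmod (listed C j \<omega>) = \<bar>C + 1 + real j\<bar>"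
    unfolding listed_def by (simp only: if_False norm_of_real)
  then show ?thesis using C(1) by simp
qed

lemma listed_inj:
  assumes C: "0 \<le> C" "\<forall>j\<in>{..<m}. cmod (lam j \<omega>) \<le> C"
  shows "inj_on (\<lambda>j. listed C j \<omega>) A"
proof -
  let ?l = "sorted_list_of_set (leading \<omega>)"
  have small: "cmod (listed C j \<omega>) \<le> C" if "j < card (leading \<omega>)" for j
  proof -
    have "?l ! j < m" using sorted_leading_nth[OF that] leading_subset[of \<omega>] by blast
    then show ?thesis using C(2) that by (simp add: listed_def)
  qed
  have large: "C < cmod (listed C j \<omega>)" if "\<not> j < card (leading \<omega>)" for j
  proof -
    have "cmod (listed C j \<omega>) = \<bar>C + 1 + real j\<bar>"
      using that unfolding listed_def by (simp only: if_False norm_of_real)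
    then show ?thesis using C(1) by simp
  qed
  show ?thesis
  proof (rule inj_onI)
    fix i j assume eq: "listed C i \<omega> = listed C j \<omega>"
    consider "i < card (leading \<omega>)" "j < card (leading \<omega>)"
      | "\<not> i < card (leading \<omega>)" "\<not> j < card (leading \<omega>)"
      | "i < card (leading \<omega>)" "\<not> j < card (leading \<omega>)"
      | "\<not> i < card (leading \<omega>)" "j < card (leading \<omega>)" by blast
    then show "i = j"
    proof cases
      case 1
      then have "lam (?l ! i) \<omega> = lam (?l ! j) \<omega>" using eq by (simp add: listed_def)
      then have "?l ! i = ?l ! j"
        by (rule inj_onD[OF leading_inj _ sorted_leading_nth[OF 1(1)] sorted_leading_nth[OF 1(2)]])
      moreover have "i < length ?l" "j < length ?l" using 1 by simp_all
      ultimately show ?thesis using nth_eq_iff_index_eq[of ?l i j] by simp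
    next
      case 2
      then have "complex_of_real (C + 1 + real i) = complex_of_real (C + 1 + real j)"
        using eq by (simp only: listed_def if_False)
      then show ?thesis unfolding of_real_eq_iff by simp
    next
      case 3
      then show ?thesis using small[OF 3(1)] large[OF 3(2)] eq by simp
    next
      case 4
      then show ?thesis using small[OF 4(2)] large[OF 4(1)] eq by simp
    qed
  qed
qed

lemma listed_covers:
  assumes "k \<in> active \<omega>"
  obtains j where "j < card (leading \<omega>)" "listed C j \<omega> = lam k \<omega>"
proof -
  have "lam k \<omega> \<in> (\<lambda>j. lam j \<omega>) ` leading \<omega>" unfolding leading_image using assms by blast
  then obtain i where i: "i \<in> leading \<omega>" "lam i \<omega> = lam k \<omega>" by auto
  then have "i \<in> set (sorted_list_of_set (leading \<omega>))" by (simp add: finite_leading)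
  then obtain j where j: "j < length (sorted_list_of_set (leading \<omega>))" "sorted_list_of_set (leading \<omega>) ! j = i"
    unfolding in_set_conv_nth by blast
  show ?thesis by (rule that[of j]) (use i j in \<open>simp_all add: listed_def\<close>)
qed

end

section \<open>A diagonalization of minimal length\<close>

text \<open>
  The listed eigenvalues are bounded measurable functions, so they are the symbols of sequences
  \<open>b j\<close>.  Here \<open>g\<close> is an essential upper bound on the number of eigenvalues.
\<close>

locale listed_eigen_system = eigen_system V L J R m a W
  for V :: "(real ^ 'd \<Rightarrow> complex) set" and L J R m a W +
  fixes C :: real and g :: nat and b :: "nat \<Rightarrow> int^'d \<Rightarrow> complex"
  assumes C_nonneg: "0 \<le> C"
    and C_bound: "AE \<omega> in cube. \<forall>j\<in>{..<m}. cmod (lam j \<omega>) \<le> C"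
    and card_le: "AE \<omega> in cube. card (leading \<omega>) \<le> g"
    and b: "\<And>j. bounded_spectrum (b j)"
    and b_eq: "\<And>j. AE \<omega> in cube. fourier_series (b j) \<omega> = listed C j \<omega>"
begin

lemma listed_cut:
  assumes k: "k < m" and f: "f \<in> s_eigenspace V L (a k)"
  shows "\<exists>r. r \<in> s_eigenspace V L (b j) \<and>
    (AE \<omega> in cube. fiberization r \<omega> = (if listed C j \<omega> = lam k \<omega> then fiberization f \<omega> else (\<lambda>_. 0)))"
proof -
  let ?A = "{\<omega> \<in> space cube. listed C j \<omega> = lam k \<omega>}"
  have A: "?A \<in> sets cube"
    using pred_lam_eq[OF listed_measurable lam_measurable[OF k]] by (simp only: pred_def)
  have eq: "AE \<omega> in cube. \<omega> \<in> ?A \<longrightarrow> lam k \<omega> = fourier_series (b j) \<omega>"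
    using b_eq[of j] by eventually_elim simp
  obtain r where r: "r \<in> s_eigenspace V L (b j)"
    "AE \<omega> in cube. fiberization r \<omega> = (if \<omega> \<in> ?A then fiberization f \<omega> else (\<lambda>_. 0))"
    by (rule s_eigenspace_restrict[OF a[OF k] b f A eq])
  have "AE \<omega> in cube. fiberization r \<omega> = (if listed C j \<omega> = lam k \<omega> then fiberization f \<omega> else (\<lambda>_. 0))"
    using r(2) AE_cube by eventually_elim simp
  then show ?thesis using r(1) by blast
qed

text \<open>
  Where \<open>R \<omega>\<close> has exactly \<open>g\<close> eigenvalues, the first \<open>g\<close> listed numbers are all eigenvalues.  If
  the eigenspace of \<open>b j\<close> were trivial, every cut of a component \<open>W n k\<close> to the set where
  \<open>lam k\<close> is the \<open>j\<close>-th listed number would vanish; but where there are \<open>g\<close> eigenvalues, the \<open>j\<close>-th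
  listed number is the symbol of an active index.
\<close>

lemma listed_eigenvalue:
  assumes j: "j < g" and g_level: "\<not> (AE \<omega> in cube. card (leading \<omega>) \<noteq> g)"
  shows "is_s_eigenvalue V L (b j)"
proof (rule ccontr)
  assume "\<not> is_s_eigenvalue V L (b j)"
  then have null: "AE x in lebesgue. r x = 0" if "r \<in> s_eigenspace V L (b j)" for r
    using that unfolding is_s_eigenvalue_def by blast
  have "AE \<omega> in cube. listed C j \<omega> = lam k \<omega> \<longrightarrow> fiberization (W n k) \<omega> = (\<lambda>_. 0)" if k: "k < m" for n k
  proof -
    obtain r where r: "r \<in> s_eigenspace V L (b j)"
      "AE \<omega> in cube. fiberization r \<omega> = (if listed C j \<omega> = lam k \<omega> then fiberization (W n k) \<omega> else (\<lambda>_. 0))"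
      using listed_cut[OF k W[OF k]] by blast
    have "AE \<omega> in cube. fiberization r \<omega> = fiberization (\<lambda>_. 0) \<omega>"
      by (rule fiberization_cong_AE[OF s_eigenspace_L2[OF r(1)] L2_space_zero null[OF r(1)]])
    then show ?thesis using r(2) fiberization_zero
    proof eventually_elim
      case (elim \<omega>)
      show ?case
      proof
        assume "listed C j \<omega> = lam k \<omega>"
        then have "fiberization (W n k) \<omega> = fiberization r \<omega>" using elim(2) by simp
        then show "fiberization (W n k) \<omega> = (\<lambda>_. 0)" using elim(1,3) by simp
      qed
    qed
  qed
  then have "AE \<omega> in cube. \<forall>n. \<forall>k\<in>{..<m}. listed C j \<omega> = lam k \<omega> \<longrightarrow> fiberization (W n k) \<omega> = (\<lambda>_. 0)"
    unfolding AE_all_countable by (intro allI AE_finite_allI) simp_all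
  then have "AE \<omega> in cube. card (leading \<omega>) \<noteq> g"
  proof eventually_elim
    case (elim \<omega>)
    show ?case
    proof
      assume "card (leading \<omega>) = g"
      then have j': "j < card (leading \<omega>)" using j by simp
      let ?k = "sorted_list_of_set (leading \<omega>) ! j"
      have "?k \<in> active \<omega>" using sorted_leading_nth[OF j'] by (simp add: leading_def)
      then obtain n where k: "?k < m" and n: "fiberization (W n ?k) \<omega> \<noteq> (\<lambda>_. 0)"
        unfolding active_def by blast
      have "listed C j \<omega> = lam ?k \<omega>" using j' by (simp add: listed_def)
      then show False using elim k n by blast
    qed
  qed
  then show False using g_level by simp
qed

text \<open>
  Decompose \<open>f\<close> along the old sequences and cut each component \<open>p k\<close> into the pieces on
  which \<open>lam k\<close> equals the \<open>j\<close>-th listed number.  Wherever the fiber of \<open>p k\<close> is nonzero,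
  \<open>lam k\<close> is an eigenvalue, so it occurs exactly once among the first \<open>g\<close> listed numbers and
  exactly one piece keeps that fiber.
\<close>

lemma listed_spanning:
  assumes f: "f \<in> V"
  shows "\<exists>h. (\<forall>j. h j \<in> s_eigenspace V L (b j)) \<and> (AE x in lebesgue. f x = (\<Sum>j<g. h j x))"
proof -
  obtain p where p: "\<And>k. k < m \<Longrightarrow> p k \<in> s_eigenspace V L (a k)"
    "AE \<omega> in cube. fiberization f \<omega> = (\<lambda>i. \<Sum>k<m. fiberization (p k) \<omega> i)"
    using decompose[OF f] by blast
  have "\<forall>j. \<forall>k\<in>{..<m}. \<exists>r. r \<in> s_eigenspace V L (b j) \<and> (AE \<omega> in cube. fiberization r \<omega> = (if listed C j \<omega> = lam k \<omega> then fiberization (p k) \<omega> else (\<lambda>_. 0)))"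
    using listed_cut p(1) by simp
  then have "\<forall>j. \<exists>r. \<forall>k\<in>{..<m}. r k \<in> s_eigenspace V L (b j) \<and> (AE \<omega> in cube. fiberization (r k) \<omega> = (if listed C j \<omega> = lam k \<omega> then fiberization (p k) \<omega> else (\<lambda>_. 0)))"
    by (intro allI bchoice) (rule spec)
  from choice[OF this] obtain r where
    r': "\<forall>j. \<forall>k\<in>{..<m}. r j k \<in> s_eigenspace V L (b j) \<and> (AE \<omega> in cube. fiberization (r j k) \<omega> = (if listed C j \<omega> = lam k \<omega> then fiberization (p k) \<omega> else (\<lambda>_. 0)))" ..
  have r: "r j k \<in> s_eigenspace V L (b j)"
    "AE \<omega> in cube. fiberization (r j k) \<omega> = (if listed C j \<omega> = lam k \<omega> then fiberization (p k) \<omega> else (\<lambda>_. 0))"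
    if "k < m" for j k
    using r'[THEN spec, THEN bspec, of k j] that by simp_all
  define h where "h j = (\<lambda>x. \<Sum>k<m. r j k x)" for j
  have hV: "h j \<in> s_eigenspace V L (b j)" for j
    unfolding h_def by (rule s_eigenspace_sum[OF b]) (use r(1) in simp_all)
  have hL: "h j \<in> L2_space lebesgue" for j by (rule s_eigenspace_L2[OF hV])
  have hfib: "AE \<omega> in cube. \<forall>j\<in>{..<g}. fiberization (h j) \<omega> = (\<lambda>i. \<Sum>k<m. fiberization (r j k) \<omega> i)"
  proof (rule AE_finite_allI)
    show "AE \<omega> in cube. fiberization (h j) \<omega> = (\<lambda>i. \<Sum>k<m. fiberization (r j k) \<omega> i)" for j
      unfolding h_def by (rule fiberization_sum, rule s_eigenspace_L2, rule r(1), simp)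
  qed simp
  have rfib: "AE \<omega> in cube. \<forall>j\<in>{..<g}. \<forall>k\<in>{..<m}. fiberization (r j k) \<omega> =
      (if listed C j \<omega> = lam k \<omega> then fiberization (p k) \<omega> else (\<lambda>_. 0))"
    by (intro AE_finite_allI finite_lessThan r(2)) simp
  have pfib: "AE \<omega> in cube. \<forall>k\<in>{..<m}. eigen_fiber \<omega> (lam k \<omega>) (fiberization (p k) \<omega>)"
    by (intro AE_finite_allI finite_lessThan s_eigenspace_fiber a p(1)) simp_all
  have sumfib: "AE \<omega> in cube. fiberization (\<lambda>x. \<Sum>j<g. h j x) \<omega> = (\<lambda>i. \<Sum>j<g. fiberization (h j) \<omega> i)"
    by (rule fiberization_sum) (rule hL)
  have "AE \<omega> in cube. fiberization f \<omega> = fiberization (\<lambda>x. \<Sum>j<g. h j x) \<omega>"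
    using p(2) hfib rfib pfib sumfib eigenvalues_eq card_le C_bound
  proof eventually_elim
    case (elim \<omega>)
    have one: "(\<Sum>j<g. fiberization (r j k) \<omega> i) = fiberization (p k) \<omega> i" if k: "k < m" for k i
    proof (cases "fiberization (p k) \<omega> = (\<lambda>_. 0)")
      case True
      have "fiberization (r j k) \<omega> i = 0" if "j < g" for j
        using elim(3) that k True by simp
      then show ?thesis using True by simp
    next
      case False
      have "eigen_fiber \<omega> (lam k \<omega>) (fiberization (p k) \<omega>)" using elim(4) k by simp
      then have "lam k \<omega> \<in> eigenvalues_on (J \<omega>) (R \<omega>)"
        unfolding eigen_fiber_def eigenvalues_on_def using False by blast
      then obtain l where l: "l \<in> active \<omega>" "lam k \<omega> = lam l \<omega>"
        unfolding elim(6) leading_image by blast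
      obtain j where j: "j < card (leading \<omega>)" "listed C j \<omega> = lam l \<omega>"
        by (rule listed_covers[OF l(1)])
      have jg: "j < g" using j(1) elim(7) by simp
      have val: "fiberization (r j' k) \<omega> i = (if j' = j then fiberization (p k) \<omega> i else 0)" if j': "j' < g" for j'
      proof -
        have "listed C j' \<omega> = lam k \<omega> \<longleftrightarrow> j' = j"
          using inj_onD[OF listed_inj[OF C_nonneg elim(8), of UNIV], of j' j] j(2) l(2) by auto
        moreover have "fiberization (r j' k) \<omega> = (if listed C j' \<omega> = lam k \<omega> then fiberization (p k) \<omega> else (\<lambda>_. 0))"
          using elim(3) j' k by simp
        ultimately show ?thesis by simp
      qed
      have "(\<Sum>j'<g. fiberization (r j' k) \<omega> i) = (\<Sum>j'<g. if j' = j then fiberization (p k) \<omega> i else 0)"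
        by (intro sum.cong refl val) simp
      also have "\<dots> = fiberization (p k) \<omega> i" using jg by simp
      finally show ?thesis .
    qed
    have "(\<Sum>j<g. fiberization (h j) \<omega> i) = (\<Sum>k<m. fiberization (p k) \<omega> i)" for i
    proof -
      have "(\<Sum>j<g. fiberization (h j) \<omega> i) = (\<Sum>j<g. \<Sum>k<m. fiberization (r j k) \<omega> i)"
        by (intro sum.cong refl) (use elim(2) in simp)
      also have "\<dots> = (\<Sum>k<m. \<Sum>j<g. fiberization (r j k) \<omega> i)" by (rule sum.swap)
      also have "\<dots> = (\<Sum>k<m. fiberization (p k) \<omega> i)" by (intro sum.cong refl one) simp
      finally show ?thesis .
    qed
    then show ?case unfolding elim(1) elim(5) by simp
  qed
  then have "AE x in lebesgue. f x = (\<Sum>j<g. h j x)"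
    by (rule fiberization_injective[OF V_L2[OF f] L2_space_sum[OF hL]])
  then show ?thesis using hV by blast
qed

text \<open>
  At almost every frequency the fibers are eigenvectors for distinct numbers.
\<close>

lemma listed_independent:
  assumes hV: "\<And>j. j < g \<Longrightarrow> h j \<in> s_eigenspace V L (b j)"
    and sum: "AE x in lebesgue. (\<Sum>j<g. h j x) = 0" and i: "i < g"
  shows "AE x in lebesgue. h i x = 0"
proof -
  have b_all: "AE \<omega> in cube. \<forall>j. fourier_series (b j) \<omega> = listed C j \<omega>"
    unfolding AE_all_countable by (intro allI b_eq)
  have hL: "h j \<in> L2_space lebesgue" if "j < g" for j by (rule s_eigenspace_L2[OF hV[OF that]])
  have "AE \<omega> in cube. fiberization (\<lambda>x. \<Sum>j<g. h j x) \<omega> = fiberization (\<lambda>_. 0) \<omega>"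
    by (rule fiberization_cong_AE[OF L2_space_sum L2_space_zero sum]) (rule hL, simp)
  moreover have "AE \<omega> in cube. fiberization (\<lambda>x. \<Sum>j<g. h j x) \<omega> = (\<lambda>k. \<Sum>j<g. fiberization (h j) \<omega> k)"
    by (rule fiberization_sum) (rule hL, simp)
  moreover have "AE \<omega> in cube. \<forall>j\<in>{..<g}. eigen_fiber \<omega> (fourier_series (b j) \<omega>) (fiberization (h j) \<omega>)"
    by (intro AE_finite_allI finite_lessThan s_eigenspace_fiber b hV) simp
  ultimately have "AE \<omega> in cube. fiberization (h i) \<omega> = fiberization (\<lambda>_. 0) \<omega>"
    using fiberization_zero b_all C_bound AE_cube
  proof eventually_elim
    case (elim \<omega>)
    have e: "eigen_fiber \<omega> (listed C j \<omega>) (fiberization (h j) \<omega>)" if "j < g" for j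
      using elim(3,5) that by simp
    have "fiberization (h i) \<omega> = (\<lambda>_. 0)"
    proof (rule eigenvectors_independent[OF J_closed[OF elim(7)] R_bounded[OF elim(7)] _ _ listed_inj[OF C_nonneg elim(6)] _ i])
      show "fiberization (h j) \<omega> \<in> J \<omega>" if "j < g" for j using e[OF that] by (simp add: eigen_fiber_def)
      show "R \<omega> (fiberization (h j) \<omega>) = (\<lambda>k. listed C j \<omega> * fiberization (h j) \<omega> k)" if "j < g" for j
        using e[OF that] by (simp add: eigen_fiber_def)
      show "(\<lambda>k. \<Sum>j<g. fiberization (h j) \<omega> k) = (\<lambda>_. 0)" using elim(1,2,4) by simp
    qed
    then show ?case using elim(4) by simp
  qed
  then show "AE x in lebesgue. h i x = 0"
    by (rule fiberization_injective[OF hL[OF i] L2_space_zero])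
qed

theorem listed_diagonalization:
  assumes g: "1 \<le> g" "\<not> (AE \<omega> in cube. card (leading \<omega>) \<noteq> g)"
  shows "is_s_diagonalization V L (map b [0..<g])"
proof -
  have direct: "is_direct_sum lebesgue V (\<lambda>j. s_eigenspace V L (map b [0..<g] ! j)) g"
    unfolding is_direct_sum_def
  proof (intro conjI allI impI)
    show "V = {f \<in> L2_space lebesgue. \<exists>h. (\<forall>j<g. h j \<in> s_eigenspace V L (map b [0..<g] ! j)) \<and> (AE x in lebesgue. f x = (\<Sum>j<g. h j x))}"
    proof (intro equalityI subsetI)
      fix f assume "f \<in> {f \<in> L2_space lebesgue. \<exists>h. (\<forall>j<g. h j \<in> s_eigenspace V L (map b [0..<g] ! j)) \<and> (AE x in lebesgue. f x = (\<Sum>j<g. h j x))}"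
      then obtain h where f: "f \<in> L2_space lebesgue" and h: "\<forall>j<g. h j \<in> s_eigenspace V L (map b [0..<g] ! j)"
        and fh: "AE x in lebesgue. f x = (\<Sum>j<g. h j x)" by blast
      have "(\<lambda>x. \<Sum>j<g. h j x) \<in> V"
        by (rule closed_subspace_sum[OF V_closed]) (use h in \<open>auto intro: s_eigenspace_V\<close>)
      then show "f \<in> V" by (rule V_cong_AE[OF _ f fh])
    next
      fix f assume f: "f \<in> V"
      obtain h where h: "\<forall>j. h j \<in> s_eigenspace V L (b j)" "AE x in lebesgue. f x = (\<Sum>j<g. h j x)"
        using listed_spanning[OF f] by blast
      have "\<forall>j<g. h j \<in> s_eigenspace V L (map b [0..<g] ! j)" using h(1) by simp
      then show "f \<in> {f \<in> L2_space lebesgue. \<exists>h. (\<forall>j<g. h j \<in> s_eigenspace V L (map b [0..<g] ! j)) \<and> (AE x in lebesgue. f x = (\<Sum>j<g. h j x))}"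
        using V_L2[OF f] h(2) by blast
    qed
  next
    fix h i assume h: "(\<forall>j<g. h j \<in> s_eigenspace V L (map b [0..<g] ! j)) \<and> (AE x in lebesgue. (\<Sum>j<g. h j x) = 0)" and i: "i < g"
    show "AE x in lebesgue. h i x = 0"
      by (rule listed_independent[OF _ conjunct2[OF h] i]) (use h in simp)
  qed
  have "map b [0..<g] \<noteq> []" using g(1) by simp
  moreover have "\<forall>c\<in>set (map b [0..<g]). bounded_spectrum c \<and> is_s_eigenvalue V L c"
    using b listed_eigenvalue[OF _ g(2)] by auto
  ultimately show ?thesis unfolding is_s_diagonalization_def using direct by simp
qed

end

text \<open>
  With \<open>g\<close> the largest essential level, almost every fiber has at most \<open>g\<close> eigenvalues, and exactly
  \<open>g\<close> eigenvalues occur on a set of positive measure.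
\<close>

theorem (in eigen_system) minimal_diagonalization:
  assumes ne: "essential_levels J R \<noteq> {}"
  shows "\<exists>bs. length bs = s_gnum J R \<and> is_s_diagonalization V L bs"
proof -
  define g where "g = s_gnum J R"
  have fin: "finite (essential_levels J R)" by (rule finite_subset[OF essential_levels_subset]) simp
  have g_in: "g \<in> essential_levels J R" unfolding g_def s_gnum_def by (rule Max_in[OF fin ne])
  then have g_pos: "1 \<le> g" by (simp add: essential_levels_def)
  have g_level: "\<not> (AE \<omega> in cube. card (leading \<omega>) \<noteq> g)"
    using g_in level_positive_iff[OF g_pos] by (simp add: essential_levels_def)
  have card_le: "AE \<omega> in cube. card (leading \<omega>) \<le> g"
    using card_leading_essential
  proof eventually_elim
    case (elim \<omega>)
    then show ?case unfolding g_def s_gnum_def using Max_ge[OF fin] by auto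
  qed
  obtain C where C: "0 \<le> C" "AE \<omega> in cube. \<forall>j\<in>{..<m}. cmod (lam j \<omega>) \<le> C"
    using lam_bounded by blast
  have "\<forall>j. \<exists>b. bounded_spectrum b \<and> (AE \<omega> in cube. fourier_series b \<omega> = listed C j \<omega>)"
  proof
    fix j
    have "AE \<omega> in cube. cmod (listed C j \<omega>) \<le> C + 1 + real j"
      using C(2) by eventually_elim (rule listed_bounded[OF C(1)])
    from fourier_series_surjective[OF listed_measurable this]
    show "\<exists>b. bounded_spectrum b \<and> (AE \<omega> in cube. fourier_series b \<omega> = listed C j \<omega>)" by blast
  qed
  from choice[OF this] obtain b where
    b': "\<forall>j. bounded_spectrum (b j) \<and> (AE \<omega> in cube. fourier_series (b j) \<omega> = listed C j \<omega>)" ..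
  interpret listed_eigen_system V L J R m a W C g b
    by unfold_locales (use C card_le b' in simp_all)
  have "is_s_diagonalization V L (map b [0..<g])"
    by (rule listed_diagonalization[OF g_pos g_level])
  then show ?thesis unfolding g_def by (intro exI conjI) simp_all
qed

text \<open>
  Choose the decompositions of the functions with fibers \<open>P\<^sub>J\<^sub>(\<^sub>\<omega>\<^sub>) e\<^sub>n\<close>.
\<close>

lemma (in fibered_operator) eigen_system_of_diagonalization:
  assumes diag: "is_s_diagonalization V L as"
  obtains W where "eigen_system V L J R (length as) (\<lambda>j. as ! j) W"
proof -
  have a: "bounded_spectrum (as ! j)" if "j < length as" for j
    using diag that unfolding is_s_diagonalization_def by simp
  have decompose: "\<exists>g. (\<forall>j<length as. g j \<in> s_eigenspace V L (as ! j)) \<and>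
      (AE \<omega> in cube. fiberization f \<omega> = (\<lambda>k. \<Sum>j<length as. fiberization (g j) \<omega> k))" if f: "f \<in> V" for f
  proof -
    have V_eq: "V = {f \<in> L2_space lebesgue. \<exists>g. (\<forall>j<length as. g j \<in> s_eigenspace V L (as ! j)) \<and> (AE x in lebesgue. f x = (\<Sum>j<length as. g j x))}"
      using diag unfolding is_s_diagonalization_def is_direct_sum_def by (elim conjE)
    obtain g where g: "\<forall>j<length as. g j \<in> s_eigenspace V L (as ! j)" "AE x in lebesgue. f x = (\<Sum>j<length as. g j x)"
      using f V_eq by blast
    have gL: "g j \<in> L2_space lebesgue" if "j \<in> {..<length as}" for j
      by (rule s_eigenspace_L2[of _ "as ! j"]) (use g(1) that in simp)
    have "AE \<omega> in cube. fiberization f \<omega> = fiberization (\<lambda>x. \<Sum>j<length as. g j x) \<omega>"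
      by (rule fiberization_cong_AE[OF V_L2[OF f] L2_space_sum g(2)]) (rule gL)
    moreover have "AE \<omega> in cube. fiberization (\<lambda>x. \<Sum>j<length as. g j x) \<omega> = (\<lambda>k. \<Sum>j<length as. fiberization (g j) \<omega> k)"
      by (rule fiberization_sum) (rule gL)
    ultimately have "AE \<omega> in cube. fiberization f \<omega> = (\<lambda>k. \<Sum>j<length as. fiberization (g j) \<omega> k)"
      by eventually_elim simp
    then show ?thesis using g(1) by blast
  qed
  obtain F where F: "\<And>n. F n \<in> V"
    "\<And>n. AE \<omega> in cube. fiberization (F n) \<omega> = ell2_proj (J \<omega>) (unit_vec n)"
    using projection_generators by blast
  have "\<forall>n. \<exists>g. (\<forall>j<length as. g j \<in> s_eigenspace V L (as ! j)) \<and>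
      (AE \<omega> in cube. fiberization (F n) \<omega> = (\<lambda>k. \<Sum>j<length as. fiberization (g j) \<omega> k))"
    by (intro allI decompose F(1))
  from choice[OF this] obtain W where W: "\<forall>n. (\<forall>j<length as. W n j \<in> s_eigenspace V L (as ! j)) \<and>
      (AE \<omega> in cube. fiberization (F n) \<omega> = (\<lambda>k. \<Sum>j<length as. fiberization (W n j) \<omega> k))" ..
  have "eigen_system V L J R (length as) (\<lambda>j. as ! j) W"
  proof unfold_locales
    show "W n j \<in> s_eigenspace V L (as ! j)" if "j < length as" for n j using W that by blast
    show "AE \<omega> in cube. ell2_proj (J \<omega>) (unit_vec n) = (\<lambda>k. \<Sum>j<length as. fiberization (W n j) \<omega> k)" for n
      using F(2)[of n] W[THEN spec, THEN conjunct2, of n] by eventually_elim simp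
  qed (rule a decompose; assumption)+
  then show ?thesis by (rule that)
qed

theorem proposition6p15:
  fixes V :: "(real ^ 'd \<Rightarrow> complex) set"
    and L :: "(real ^ 'd \<Rightarrow> complex) \<Rightarrow> real ^ 'd \<Rightarrow> complex"
    and J :: "real ^ 'd \<Rightarrow> (int ^ 'd \<Rightarrow> complex) set"
    and R :: "real ^ 'd \<Rightarrow> (int ^ 'd \<Rightarrow> complex) \<Rightarrow> int ^ 'd \<Rightarrow> complex"
  assumes "shift_invariant V"
    and "finitely_generated V"
    and "shift_preserving V L"
    and "s_diagonalizable V L"
    and "is_range_function V J"
    and "is_range_operator V L J R"
  shows "finite (essential_levels J R) \<and> essential_levels J R \<noteq> {} \<and>
         s_beta V L = s_gnum J R"
proof -
  interpret fibered_operator V L J R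
  proof
    show "closed_subspace lebesgue V" using assms(1) by (simp add: shift_invariant_def)
    show "L f \<in> V" if "f \<in> V" for f
      using assms(3) that by (simp add: shift_preserving_def bounded_operator_on_def)
  qed (fact assms)+
  have bound: "essential_levels J R \<subseteq> {1..length as} \<and> essential_levels J R \<noteq> {} \<and>
      (\<exists>bs. length bs = s_gnum J R \<and> is_s_diagonalization V L bs)" if diag: "is_s_diagonalization V L as" for as
  proof -
    obtain W where "eigen_system V L J R (length as) (\<lambda>j. as ! j) W"
      by (rule eigen_system_of_diagonalization[OF diag])
    then interpret eigen_system V L J R "length as" "\<lambda>j. as ! j" W .
    have "0 < length as" "is_s_eigenvalue V L (as ! 0)"
      using diag unfolding is_s_diagonalization_def by auto
    then have "essential_levels J R \<noteq> {}" by (rule essential_levels_nonempty)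
    then show ?thesis using essential_levels_subset minimal_diagonalization by blast
  qed
  obtain as where as: "is_s_diagonalization V L as" using assms(4) by (auto simp: s_diagonalizable_def)
  have fin: "finite (essential_levels J R)" using bound[OF as] finite_subset by blast
  have "s_beta V L = s_gnum J R"
    unfolding s_beta_def
  proof (rule Least_equality)
    show "\<exists>bs. length bs = s_gnum J R \<and> is_s_diagonalization V L bs" using bound[OF as] by blast
    fix m assume "\<exists>as. length as = m \<and> is_s_diagonalization V L as"
    then obtain cs where cs: "length cs = m" "is_s_diagonalization V L cs" by blast
    have "s_gnum J R \<in> essential_levels J R"
      unfolding s_gnum_def using bound[OF as] by (intro Max_in fin) blast
    then show "s_gnum J R \<le> m" using bound[OF cs(2)] cs(1) by auto
  qed
  then show ?thesis using fin bound[OF as] by blast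
qed

end
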